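(* Fix $h\in(0,1)$, $\rho>0$ and $z\in L^2(\Gamma)$. Let $\tau,\theta>0$ satisfy $$\Big(\frac1\tau-\frac{c_\gamma^2}{c_1^2}\Big)\frac{\theta}{\tau}>\rho^2\|\nabla\|^2,$$ let $(f^h_0,p^h_0)\in F^h_{ad}\times(\mathcal{V}^h_0)^d$, and define iteratively for $n\ge0$: $$f^h_{n+1}=\arg\min_{f\in F^h_{ad}}\Big\{(f,u^h_a(f^h_n))_\Omega+\rho(\nabla f,p^h_n)_\Omega+\tfrac{1}{2\tau}\|f-f^h_n\|^2_\Omega\Big\},\qquad \widetilde f^h_{n+1}=2f^h_{n+1}-f^h_n,$$ $$p^h_{n+1}=\arg\max_{p\in(\mathcal{V}^h_0)^d}\Big\{\rho(\nabla\widetilde f^h_{n+1},p)_\Omega-I_{\mathcal{B}_1}(p)-\tfrac{\theta}{2\tau}\|p-p^h_n\|^2_\Omega\Big\},$$ and set $\mu^h_n=(f^h_n,p^h_n)$. Then: (i) There exist a subsequence $(\mu^h_{n_k})_k$ and $\mu^h_*=(f^h_*,p^h_* )$ with $f^h_*\in F^h_{ad}$, $p^h_*\in\mathcal{B}_1$ and $(\nabla f^h_*,p^h_* )_\Omega=\int_\Omega|\nabla f^h_*|$, such that $\mu^h_{n_k}\to\mu^h_*$ in $\mathcal{V}^h_1\times(\mathcal{V}^h_0)^d$. Moreover, for all $(g,q)\in F^h_{ad}\times\mathcal{B}_1$, $$(g-f^h_*,u^h_a(f^h_* ))_\Omega+\rho(\nabla(g-f^h_* ),p^h_* )_\Omega-\rho(\nabla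 f^h_*,q-p^h_* )_\Omega\ge0,$$ and $f^h_*$ is a minimizer of $\min_{f\in F^h_{ad}}\tfrac12\|u^h(f)-z\|^2_{L^2(\Gamma)}+\rho\,TV(f)$. (ii) $\|\mu^h_{n+1}-\mu^h_n\|^2=\mathcal{O}(1/n)$ as $n\to\infty$, where $\|\cdot\|$ is a norm on the finite-dimensional space $\mathcal{V}^h_1\times(\mathcal{V}^h_0)^d$.
   Context: Let $\Omega\subset\mathbb{R}^d$, $d\ge2$, be open bounded connected with polygonal boundary, $\Gamma\subset\partial\Omega$ relatively open. Let $\alpha\in L^\infty(\Omega)^{d\times d}$ be symmetric with $\alpha(x)\xi\cdot\xi\ge\underline\alpha|\xi|^2$ a.e. ($\underline\alpha>0$), $\beta\in L^\infty(\Omega)$, $\beta\ge0$, $\sigma\in L^\infty(\partial\Omega)$, $\sigma\ge0$, with $\beta\ge\beta_0>0$ a.e. in $\Omega$ or $\sigma\ge\sigma_0>0$ a.e. on $\partial\Omega$; $j\in H^{-1/2}(\partial\Omega)$. $a(u,v)=(\alpha\nabla u,\nabla v)_\Omega+(\beta u,v)_\Omega+(\sigma u,v)_{\partial\Omega}$, where $(\cdot,\cdot)_\Omega$, $(\cdot,\cdot)_\Gamma$, $(\cdot,\cdot)_{\partial\Omega}$ are $L^2$ inner products and $\|\cdot\|_\Omega$ the $L^2(\Omega)$-norm. $c_1>0$ is a constant with $c_1\|u\|^2_{H^1(\Omega)}\le a(u,u)$ for all $u\in H^1(\Omega)$, and $c_\gamma>0$ is a constant with $\|u\|_{L^2(\partial\Omega)}\le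 c_\gamma\|u\|_{H^1(\Omega)}$ (trace) for all $u\in H^1(\Omega)$. $\mathcal{T}^h$ is a regular triangulation of $\overline\Omega$ (from a quasi-uniform family, boundary vertices are nodes); $\mathcal{V}^h_1$ = continuous piecewise linear functions, $\mathcal{V}^h_0$ = piecewise constant functions on $\mathcal{T}^h$. For $f\in L^2(\Omega)$, $u^h(f)\in\mathcal{V}^h_1$ solves $a(u^h(f),v)=(f,v)_\Omega+\langle j,v\rangle$ for all $v\in\mathcal{V}^h_1$, and the discrete adjoint state $u^h_a(f)\in\mathcal{V}^h_1$ solves $a(u^h_a(f),v)=(u^h(f)-z,v)_\Gamma$ for all $v\in\mathcal{V}^h_1$. $TV(f)=\sup\{\int_\Omega f\,\mathrm{div}\,G:G\in C^1_c(\Omega)^d,|G(x)|_\infty\le1\}$; for $f\in\mathcal{V}^h_1$, $\int_\Omega|\nabla f|:=TV(f)=\sum_{T\in\mathcal{T}^h}|T|\sum_{j=1}^d|\partial_{x_j}f|_T|$. $F_{ad}=\{f\in BV(\Omega):\underline f\le f\le\overline f\text{ a.e.}\}$ for given constants $\underline f\le\overline f$, and $F^h_{ad}=F_{ad}\cap\mathcal{V}^h_1$. $\mathcal{B}_1=\{p=(p_j)_{j=1}^d\in(\mathcal{V}^h_0)^d:\max_j\|p_j\|_{L^\infty(\Omega)}\le1\}$ and $I_{\mathcal{B}_1}$ is its indicator function ($0$ on $\mathcal{B}_1$, $+\infty$ outside). $\|\nabla\|:=\sup_{0\ne v\in\mathcal{V}^h_1}\|\nabla v\|_\Omega/\|v\|_\Omega$.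 *)

theory Defs
  imports "HOL-Analysis.Analysis" "HOL-Library.Landau_Symbols"
begin

definition ipO :: "(real^'n) set \<Rightarrow> (real^'n \<Rightarrow> real) \<Rightarrow> (real^'n \<Rightarrow> real) \<Rightarrow> real" where
  "ipO \<Omega> f g = (LINT x:\<Omega>|lebesgue. f x * g x)"

definition nrmO :: "(real^'n) set \<Rightarrow> (real^'n \<Rightarrow> real) \<Rightarrow> real" where
  "nrmO \<Omega> f = sqrt (ipO \<Omega> f f)"

definition vipO :: "(real^'n) set \<Rightarrow> (real^'n \<Rightarrow> real^'n) \<Rightarrow> (real^'n \<Rightarrow> real^'n) \<Rightarrow> real" where
  "vipO \<Omega> p q = (LINT x:\<Omega>|lebesgue. p x \<bullet> q x)"

definition vnrmO :: "(real^'n) set \<Rightarrow> (real^'n \<Rightarrow> real^'n) \<Rightarrow> real" where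
  "vnrmO \<Omega> p = sqrt (vipO \<Omega> p p)"

text \<open>Classical (pointwise) gradient; for piecewise linear functions it coincides a.e.
  with the weak gradient.\<close>
definition grad :: "(real^'n \<Rightarrow> real) \<Rightarrow> real^'n \<Rightarrow> real^'n" where
  "grad f x = (THE D. GDERIV f x :> D)"

definition is_mesh :: "(real^'n) set \<Rightarrow> (real^'n) set set \<Rightarrow> real \<Rightarrow> bool" where
  "is_mesh \<Omega> \<T> h \<longleftrightarrow> triangulation \<T> \<and> \<Union>\<T> = closure \<Omega> \<and>
     (\<forall>T\<in>\<T>. int CARD('n) simplex T) \<and> h = Max (diameter ` \<T>)"

text \<open>Continuous piecewise linear functions (normalised to 0 outside closure Omega;
  continuity on closure Omega follows from affinity on each closed simplex).\<close>
definition V1 :: "(real^'n) set \<Rightarrow> (real^'n) set set \<Rightarrow> (real^'n \<Rightarrow> real) set" where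
  "V1 \<Omega> \<T> = {f. (\<forall>x. x \<notin> closure \<Omega> \<longrightarrow> f x = 0) \<and>
                  (\<forall>T\<in>\<T>. \<exists>a b. \<forall>x\<in>T. f x = a \<bullet> x + b)}"

text \<open>(V0)^d: vector fields constant on each element (canonical representative:
  value c T on interior T, 0 on the null set of element boundaries).\<close>
definition V0v :: "(real^'n) set set \<Rightarrow> (real^'n \<Rightarrow> real^'n) set" where
  "V0v \<T> = {p. \<exists>c. \<forall>x. (\<forall>T\<in>\<T>. x \<in> interior T \<longrightarrow> p x = c T) \<and>
                       ((\<forall>T\<in>\<T>. x \<notin> interior T) \<longrightarrow> p x = 0)}"

definition B1 :: "(real^'n) set set \<Rightarrow> (real^'n \<Rightarrow> real^'n) set" where
  "B1 \<T> = {p \<in> V0v \<T>. \<forall>x j. \<bar>p x $ j\<bar> \<le> 1}"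

definition indB1 :: "(real^'n) set set \<Rightarrow> (real^'n \<Rightarrow> real^'n) \<Rightarrow> ereal" where
  "indB1 \<T> p = (if p \<in> B1 \<T> then 0 else \<infinity>)"

definition gradnorm :: "(real^'n) set \<Rightarrow> (real^'n) set set \<Rightarrow> real" where
  "gradnorm \<Omega> \<T> = (SUP v \<in> V1 \<Omega> \<T> - {\<lambda>x. 0}. vnrmO \<Omega> (grad v) / nrmO \<Omega> v)"

definition C1c :: "(real^'n) set \<Rightarrow> (real^'n \<Rightarrow> real) \<Rightarrow> bool" where
  "C1c \<Omega> \<phi> \<longleftrightarrow> (\<forall>x. \<exists>D. GDERIV \<phi> x :> D) \<and> continuous_on UNIV (grad \<phi>) \<and>
      compact (closure {x. \<phi> x \<noteq> 0}) \<and> closure {x. \<phi> x \<noteq> 0} \<subseteq> \<Omega>"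

definition divg :: "(real^'n \<Rightarrow> real^'n) \<Rightarrow> real^'n \<Rightarrow> real" where
  "divg G x = (\<Sum>i\<in>UNIV. grad (\<lambda>y. G y $ i) x $ i)"

definition TVtests :: "(real^'n) set \<Rightarrow> (real^'n \<Rightarrow> real^'n) set" where
  "TVtests \<Omega> = {G. (\<forall>i. C1c \<Omega> (\<lambda>y. G y $ i)) \<and> (\<forall>x i. \<bar>G x $ i\<bar> \<le> 1)}"

definition TV :: "(real^'n) set \<Rightarrow> (real^'n \<Rightarrow> real) \<Rightarrow> real" where
  "TV \<Omega> f = (SUP G \<in> TVtests \<Omega>. LINT x:\<Omega>|lebesgue. f x * divg G x)"

definition BV :: "(real^'n) set \<Rightarrow> (real^'n \<Rightarrow> real) \<Rightarrow> bool" where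
  "BV \<Omega> f \<longleftrightarrow> set_integrable lebesgue \<Omega> f \<and>
     bdd_above ((\<lambda>G. LINT x:\<Omega>|lebesgue. f x * divg G x) ` TVtests \<Omega>)"

definition Fad :: "(real^'n) set \<Rightarrow> real \<Rightarrow> real \<Rightarrow> (real^'n \<Rightarrow> real) set" where
  "Fad \<Omega> lo hi = {f. BV \<Omega> f \<and> (AE x in lebesgue. x \<in> \<Omega> \<longrightarrow> lo \<le> f x \<and> f x \<le> hi)}"

definition Fadh :: "(real^'n) set \<Rightarrow> (real^'n) set set \<Rightarrow> real \<Rightarrow> real \<Rightarrow> (real^'n \<Rightarrow> real) set" where
  "Fadh \<Omega> \<T> lo hi = Fad \<Omega> lo hi \<inter> V1 \<Omega> \<T>"

definition bfacets :: "(real^'n) set \<Rightarrow> (real^'n) set set \<Rightarrow> (real^'n) set set" where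
  "bfacets \<Omega> \<T> = {F. \<exists>T\<in>\<T>. F face_of T \<and> aff_dim F = int CARD('n) - 1 \<and> F \<subseteq> frontier \<Omega>}"

definition fnormal :: "(real^'n) set \<Rightarrow> real^'n" where
  "fnormal F = (SOME \<nu>. norm \<nu> = 1 \<and> (\<forall>x\<in>F. \<forall>y\<in>F. (x - y) \<bullet> \<nu> = 0))"

definition fbase :: "(real^'n) set \<Rightarrow> real^'n" where
  "fbase F = (SOME x. x \<in> F)"

definition fproj :: "(real^'n) set \<Rightarrow> real^'n \<Rightarrow> real^'n" where
  "fproj F y = y - ((y - fbase F) \<bullet> fnormal F) *\<^sub>R fnormal F"

text \<open>Prism of height 1 over F: its d-volume over a subset A of F is the (d-1)-dimensional
  surface measure of A.\<close>
definition fprism :: "(real^'n) set \<Rightarrow> (real^'n) set" where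
  "fprism F = {y. fproj F y \<in> F \<and> 0 \<le> (y - fbase F) \<bullet> fnormal F \<and> (y - fbase F) \<bullet> fnormal F \<le> 1}"

text \<open>Surface ((d-1)-dimensional Hausdorff) measure on the boundary of Omega.\<close>
definition bmeas :: "(real^'n) set \<Rightarrow> (real^'n) set set \<Rightarrow> (real^'n) measure" where
  "bmeas \<Omega> \<T> = measure_of UNIV (sets borel)
     (\<lambda>A. \<Sum>F\<in>bfacets \<Omega> \<T>. emeasure lebesgue (fprism F \<inter> fproj F -` A))"

definition bip :: "(real^'n) set \<Rightarrow> (real^'n) set set \<Rightarrow> (real^'n) set
                   \<Rightarrow> (real^'n \<Rightarrow> real) \<Rightarrow> (real^'n \<Rightarrow> real) \<Rightarrow> real" where
  "bip \<Omega> \<T> A f g = (LINT x:A|bmeas \<Omega> \<T>. f x * g x)"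

definition aform :: "(real^'n) set \<Rightarrow> (real^'n) set set \<Rightarrow> (real^'n \<Rightarrow> real^'n^'n) \<Rightarrow>
    (real^'n \<Rightarrow> real) \<Rightarrow> (real^'n \<Rightarrow> real) \<Rightarrow>
    (real^'n \<Rightarrow> real) \<Rightarrow> (real^'n \<Rightarrow> real^'n) \<Rightarrow> (real^'n \<Rightarrow> real) \<Rightarrow> (real^'n \<Rightarrow> real^'n) \<Rightarrow> real" where
  "aform \<Omega> \<T> \<alpha> \<beta> \<sigma> u gu v gv =
     (LINT x:\<Omega>|lebesgue. (\<alpha> x *v gu x) \<bullet> gv x) + (LINT x:\<Omega>|lebesgue. \<beta> x * u x * v x)
     + (LINT x:frontier \<Omega>|bmeas \<Omega> \<T>. \<sigma> x * u x * v x)"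

definition L2O :: "(real^'n) set \<Rightarrow> (real^'n \<Rightarrow> real) \<Rightarrow> bool" where
  "L2O \<Omega> u \<longleftrightarrow> set_borel_measurable lebesgue \<Omega> u \<and> set_integrable lebesgue \<Omega> (\<lambda>x. (u x)\<^sup>2)"

definition weak_grad :: "(real^'n) set \<Rightarrow> (real^'n \<Rightarrow> real) \<Rightarrow> (real^'n \<Rightarrow> real^'n) \<Rightarrow> bool" where
  "weak_grad \<Omega> u g \<longleftrightarrow> (\<forall>i. L2O \<Omega> (\<lambda>x. g x $ i)) \<and>
     (\<forall>\<phi>. C1c \<Omega> \<phi> \<longrightarrow> (\<forall>i. (LINT x:\<Omega>|lebesgue. u x * grad \<phi> x $ i)
                               = - (LINT x:\<Omega>|lebesgue. g x $ i * \<phi> x)))"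

definition H1norm2 :: "(real^'n) set \<Rightarrow> (real^'n \<Rightarrow> real) \<Rightarrow> (real^'n \<Rightarrow> real^'n) \<Rightarrow> real" where
  "H1norm2 \<Omega> u g = (LINT x:\<Omega>|lebesgue. (u x)\<^sup>2) + (LINT x:\<Omega>|lebesgue. (norm (g x))\<^sup>2)"

text \<open>Discrete state u^h(f); J is the action of j on V1 (through traces).\<close>
definition uh where
  "uh \<Omega> \<T> \<alpha> \<beta> \<sigma> J f = (THE u. u \<in> V1 \<Omega> \<T> \<and>
     (\<forall>v\<in>V1 \<Omega> \<T>. aform \<Omega> \<T> \<alpha> \<beta> \<sigma> u (grad u) v (grad v) = ipO \<Omega> f v + J v))"

definition uha where
  "uha \<Omega> \<T> \<Gamma> \<alpha> \<beta> \<sigma> J z f = (THE w. w \<in> V1 \<Omega> \<T> \<and>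
     (\<forall>v\<in>V1 \<Omega> \<T>. aform \<Omega> \<T> \<alpha> \<beta> \<sigma> w (grad w) v (grad v)
        = bip \<Omega> \<T> \<Gamma> (\<lambda>x. uh \<Omega> \<T> \<alpha> \<beta> \<sigma> J f x - z x) v))"

definition cost where
  "cost \<Omega> \<T> \<Gamma> \<alpha> \<beta> \<sigma> J z \<rho> f =
     1/2 * bip \<Omega> \<T> \<Gamma> (\<lambda>x. uh \<Omega> \<T> \<alpha> \<beta> \<sigma> J f x - z x) (\<lambda>x. uh \<Omega> \<T> \<alpha> \<beta> \<sigma> J f x - z x)
     + \<rho> * TV \<Omega> f"

end

theory Submission
  imports Defs "HOL-Library.Function_Algebras"
begin

text \<open>
  The discrete misfit is a convex quadratic in the control \<open>f\<close>: with \<open>S f\<close> the solution of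
  \<open>a(S f, v) = (f, v)\<close> for all \<open>v\<close>, symmetry of \<open>a\<close> gives \<open>(g, u\<^sub>a(f)) = (S f, S g)\<^sub>\<Gamma> + l(g)\<close> with \<open>l\<close> linear, and
  coercivity together with the trace inequality gives \<open>\<parallel>S f\<parallel>\<^sub>\<Gamma>\<^sup>2 \<le> (c\<^sub>\<gamma>/c\<^sub>1)\<^sup>2 \<parallel>f\<parallel>\<^sup>2\<close>. Adding the first-order conditions
  of the two subproblems, the iteration becomes a forward-backward step for a variational
  inequality on the product space, in the metric
  \<open>\<parallel>f\<parallel>\<^sup>2/\<tau> - 2 \<rho> (\<nabla>f, p) + \<theta> \<parallel>p\<parallel>\<^sup>2/\<tau>\<close>; the step size condition says precisely that this metric
  strictly dominates \<open>\<parallel>S f\<parallel>\<^sub>\<Gamma>\<^sup>2\<close>. A solution of the variational inequality exists because the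
  ergodic averages of the iterates have a cluster point and the gap at the averages decays.
  Fejer monotonicity with respect to this solution makes the squared increments summable; they
  are also monotonically decreasing, hence \<open>O(1/n)\<close>, and every cluster point solves the variational
  inequality. Finally \<open>TV(f)\<close> is the maximum of \<open>(\<nabla>f, q)\<close> over \<open>q \<in> B\<^sub>1\<close> for piecewise linear \<open>f\<close>,
  by integration by parts and smooth cutoffs on the simplices, which turns solutions of the
  variational inequality into minimizers.
\<close>

section \<open>Linear and bilinear forms on subspaces; the forward-backward iteration\<close>

text \<open>The discrete spaces are sets of functions, so the linear algebra lives on subspaces of
  the pointwise vector space of all functions. Finite dimension is expressed by finitely many linear
  functionals that jointly vanish only at 0 (values at vertices, values inside elements). A positive
  definite form then has a finite orthonormal basis, which gives Riesz representation, boundedness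
  of bilinear forms and subsequence compactness. Fejer monotonicity is monotonicity towards a
  solution, so using it for existence would be circular; hence existence comes first, from an energy
  estimate that compares the iterates with arbitrary points of the constraint set.
  \<open>grad\<close> is a definite description and has no controlled value on the mesh skeleton.
  All forms are therefore evaluated with a representative that is zero there, which makes them
  exactly bilinear; the two versions agree a.e. The constants \<open>c1\<close> and
  \<open>c\<gamma>\<close> speak about weak gradients, so integration by parts is needed already to
  apply them to discrete functions, and not only for the total variation.\<close>

instantiation "fun" :: (type, real_vector) real_vector
begin
definition scaleR_fun_def: "c *\<^sub>R f = (\<lambda>x. c *\<^sub>R f x)"
instance
  by standard (simp_all add: scaleR_fun_def fun_eq_iff scaleR_add_right scaleR_add_left)
end

lemma scaleR_fun_apply [simp]: "(c *\<^sub>R f) x = c *\<^sub>R f x"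
  by (simp add: scaleR_fun_def)

lemma tendsto_divide_Suc: "(\<lambda>n. c / real (Suc n)) \<longlonglongrightarrow> 0"
  by (intro real_tendsto_divide_at_top[OF tendsto_const]
      filterlim_compose[OF filterlim_real_sequentially filterlim_Suc])

section \<open>Linear, bilinear and positive forms on a subspace\<close>

definition linear_on :: "'v::real_vector set \<Rightarrow> ('v \<Rightarrow> real) \<Rightarrow> bool" where
  "linear_on V l \<longleftrightarrow>
     (\<forall>x\<in>V. \<forall>y\<in>V. l (x + y) = l x + l y) \<and> (\<forall>c. \<forall>x\<in>V. l (c *\<^sub>R x) = c * l x)"

lemma linear_onI:
  assumes "\<And>x y. x \<in> V \<Longrightarrow> y \<in> V \<Longrightarrow> l (x + y) = l x + l y"
    and "\<And>c x. x \<in> V \<Longrightarrow> l (c *\<^sub>R x) = c * l x"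
  shows "linear_on V l"
  using assms by (simp add: linear_on_def)

lemma linear_on_subset: "linear_on V l \<Longrightarrow> W \<subseteq> V \<Longrightarrow> linear_on W l"
  unfolding linear_on_def by blast

lemma linear_on_add: "linear_on V l \<Longrightarrow> x \<in> V \<Longrightarrow> y \<in> V \<Longrightarrow> l (x + y) = l x + l y"
  and linear_on_scale: "linear_on V l \<Longrightarrow> x \<in> V \<Longrightarrow> l (c *\<^sub>R x) = c * l x"
  by (auto simp: linear_on_def)

lemma linear_on_diff:
  assumes "linear_on V l" "subspace V" "x \<in> V" "y \<in> V"
  shows "l (x - y) = l x - l y"
proof -
  have "l (x + (-1) *\<^sub>R y) = l x + (-1) * l y"
    using assms by (simp only: linear_on_add linear_on_scale subspace_scale)
  then show ?thesis by simp
qed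

lemma linear_on_zero: "linear_on V l \<Longrightarrow> subspace V \<Longrightarrow> l 0 = 0"
  using linear_on_scale[of V l 0 0] by (simp add: subspace_0)

lemma linear_on_sum:
  assumes "linear_on V l" "subspace V" "\<And>i. i \<in> I \<Longrightarrow> x i \<in> V"
  shows "l (\<Sum>i\<in>I. c i *\<^sub>R x i) = (\<Sum>i\<in>I. c i * l (x i))"
proof (cases "finite I")
  case True
  then show ?thesis using assms(3)
  proof (induction I)
    case (insert i I)
    then show ?case using assms(1,2)
      by (simp add: linear_on_add linear_on_scale subspace_scale subspace_sum)
  qed (simp add: linear_on_zero[OF assms(1,2)])
qed (simp add: linear_on_zero[OF assms(1,2)])

definition bilinear_on :: "'v::real_vector set \<Rightarrow> ('v \<Rightarrow> 'v \<Rightarrow> real) \<Rightarrow> bool" where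
  "bilinear_on V B \<longleftrightarrow> (\<forall>x\<in>V. linear_on V (B x) \<and> linear_on V (\<lambda>y. B y x))"

lemma bilinear_on_right: "bilinear_on V B \<Longrightarrow> x \<in> V \<Longrightarrow> linear_on V (B x)"
  and bilinear_on_left: "bilinear_on V B \<Longrightarrow> x \<in> V \<Longrightarrow> linear_on V (\<lambda>y. B y x)"
  by (auto simp: bilinear_on_def)

lemma bilinear_on_symI:
  assumes "\<And>x y. x \<in> V \<Longrightarrow> y \<in> V \<Longrightarrow> B x y = B y x" "subspace V"
    and "\<And>x. x \<in> V \<Longrightarrow> linear_on V (B x)"
  shows "bilinear_on V B"
  unfolding bilinear_on_def
proof (intro ballI conjI)
  fix x assume x: "x \<in> V"
  show "linear_on V (B x)" using assms(3) x .
  then have "linear_on V (\<lambda>y. B y x) \<longleftrightarrow> linear_on V (B x)"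
    unfolding linear_on_def using assms(1) x
    by (metis assms(2) subspace_add subspace_scale)
  then show "linear_on V (\<lambda>y. B y x)" using assms(3) x by simp
qed

lemma bilinear_on_simps:
  assumes "bilinear_on V B" "subspace V" "x \<in> V" "y \<in> V" "z \<in> V"
  shows "B (x + y) z = B x z + B y z" "B z (x + y) = B z x + B z y"
    "B (x - y) z = B x z - B y z" "B z (x - y) = B z x - B z y"
    "B (c *\<^sub>R x) z = c * B x z" "B z (c *\<^sub>R x) = c * B z x"
  using bilinear_on_right[OF assms(1,5)] bilinear_on_left[OF assms(1,5)] assms(2-4)
    linear_on_add linear_on_scale linear_on_diff
  by (metis (no_types, lifting))+

locale form_space =
  fixes V :: "'v::real_vector set" and M :: "'v \<Rightarrow> 'v \<Rightarrow> real"
  assumes subspace: "subspace V"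
    and bilinear: "bilinear_on V M"
    and sym: "x \<in> V \<Longrightarrow> y \<in> V \<Longrightarrow> M x y = M y x"
    and pos: "x \<in> V \<Longrightarrow> x \<noteq> 0 \<Longrightarrow> 0 < M x x"
begin

lemmas form_simps = bilinear_on_simps[OF bilinear subspace]

lemma nonneg: "x \<in> V \<Longrightarrow> 0 \<le> M x x"
  using pos[of x] linear_on_zero[OF bilinear_on_right[OF bilinear subspace_0[OF subspace]] subspace]
  by (cases "x = 0") auto

end

lemma psd_cauchy_schwarz:
  assumes "bilinear_on V B" "subspace V" "x \<in> V" "y \<in> V" "B x y = B y x"
    and psd: "\<And>x. x \<in> V \<Longrightarrow> 0 \<le> B x x"
  shows "(B x y)\<^sup>2 \<le> B x x * B y y"
proof -
  have mem: "x + t *\<^sub>R y \<in> V" "t *\<^sub>R y \<in> V" for t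
    using assms by (auto intro: subspace_add subspace_scale)
  have *: "0 \<le> B x x + 2 * t * B x y + t\<^sup>2 * B y y" for t
    using psd[OF mem(1), of t] assms(3-5) mem(2)[of t] mem(1)[of t]
    by (simp add: bilinear_on_simps[OF assms(1,2)] power2_eq_square algebra_simps)
  show ?thesis
  proof (cases "B y y = 0")
    case True
    have "B x y = 0"
    proof (rule ccontr)
      assume ne: "B x y \<noteq> 0"
      \<comment> \<open>With \<open>B y y = 0\<close> the quadratic in \<open>t\<close> is affine;
        this \<open>t\<close> is where it takes the value -1.\<close>
      have "0 \<le> B x x + 2 * (- (B x x + 1) / (2 * B x y)) * B x y"
        using *[of "- (B x x + 1) / (2 * B x y)"] True by simp
      also have "\<dots> = -1" using ne by (simp add: field_simps)
      finally show False by simp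
    qed
    then show ?thesis using True by simp
  next
    case False
    then have y: "0 < B y y" using psd[OF assms(4)] by simp
    \<comment> \<open>The value of \<open>t\<close> is the minimiser of the quadratic in
      \<open>t\<close>.\<close>
    have "0 \<le> B x x + 2 * (- B x y / B y y) * B x y + (- B x y / B y y)\<^sup>2 * B y y"
      by (rule *)
    also have "\<dots> = B x x - (B x y)\<^sup>2 / B y y"
      using y by (simp add: field_simps power2_eq_square)
    finally show ?thesis using y by (simp add: field_simps)
  qed
qed

text \<open>Along the segment from \<open>x1\<close> to \<open>x\<close> the quadratic part
  contributes only to order \<open>t\<close> squared; after division by \<open>t\<close>, letting
  \<open>t\<close> tend to 0 from the right leaves the one-sided derivative. Weight and centre stay
  free because both subproblems of the iteration and the existence of a solution use the
  lemma.\<close>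

lemma quadratic_first_order:
  assumes B: "bilinear_on V B" "subspace V" "\<And>x y. x \<in> V \<Longrightarrow> y \<in> V \<Longrightarrow> B x y = B y x"
    and l: "linear_on V l" and C: "C \<subseteq> V" "convex C"
    and x0: "x0 \<in> V" and x1: "x1 \<in> C"
    and min: "\<And>x. x \<in> C \<Longrightarrow> l x1 + \<kappa> / 2 * B (x1 - x0) (x1 - x0) \<le> l x + \<kappa> / 2 * B (x - x0) (x - x0)"
    and x: "x \<in> C"
  shows "0 \<le> l (x - x1) + \<kappa> * B (x1 - x0) (x - x1)"
proof -
  define e y where "e = x - x1" and "y = x1 - x0"
  have e: "e \<in> V" and y: "y \<in> V" and x1V: "x1 \<in> V"
    using x x1 x0 C B(2) by (auto simp: e_def y_def intro: subspace_diff)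
  define d q where "d = l e + \<kappa> * B y e" and "q = \<kappa> / 2 * B e e"
  have "0 \<le> d + t * q" if t: "0 < t" "t < 1" for t
  proof -
    have te: "t *\<^sub>R e \<in> V" using e B(2) by (simp add: subspace_scale)
    have "x1 + t *\<^sub>R e = (1 - t) *\<^sub>R x1 + t *\<^sub>R x" by (simp add: e_def algebra_simps)
    then have "x1 + t *\<^sub>R e \<in> C" using convexD[OF C(2) x1 x, of "1 - t" t] t by simp
    from min[OF this] have "0 \<le> l (x1 + t *\<^sub>R e) - l x1
        + \<kappa> / 2 * (B (y + t *\<^sub>R e) (y + t *\<^sub>R e) - B y y)"
      by (simp add: y_def algebra_simps)
    also have "B (y + t *\<^sub>R e) (y + t *\<^sub>R e) = B y y + 2 * t * B y e + t * t * B e e"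
      using e y te B(3)[OF e y] B(2)
      by (simp add: bilinear_on_simps[OF B(1,2)] subspace_add algebra_simps)
    also have "l (x1 + t *\<^sub>R e) = l x1 + t * l e"
      using e x1V te by (simp add: linear_on_add[OF l] linear_on_scale[OF l])
    finally have "0 \<le> t * (d + t * q)" by (simp add: d_def q_def field_simps)
    then show ?thesis using t by (simp add: zero_le_mult_iff)
  qed
  then have ev: "\<forall>\<^sub>F t in at_right 0. 0 \<le> d + t * q"
    unfolding eventually_at_right_field by (intro exI[of _ 1]) auto
  have "((\<lambda>t. d + t * q) \<longlongrightarrow> d + 0 * q) (at_right 0)" by (intro tendsto_intros)
  from tendsto_lowerbound[OF this ev] show ?thesis by (simp add: d_def e_def y_def)
qed

text \<open>Gram-Schmidt by induction on the separating functionals: the kernel of one functional is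
  separated by the others and has codimension at most one, so each functional adds at most one basis
  vector. \<open>V\<close> has to be arbitrary, because the induction descends to kernels.\<close>

lemma exists_orthonormal_family:
  assumes "finite \<Lambda>" "form_space V M"
    and "\<And>l. l \<in> \<Lambda> \<Longrightarrow> linear_on V l"
    and "\<And>x. x \<in> V \<Longrightarrow> (\<And>l. l \<in> \<Lambda> \<Longrightarrow> l x = 0) \<Longrightarrow> x = 0"
  shows "\<exists>E. finite E \<and> E \<subseteq> V \<and> (\<forall>e\<in>E. \<forall>e'\<in>E. M e e' = (if e = e' then 1 else 0)) \<and>
    (\<forall>x\<in>V. x = (\<Sum>e\<in>E. M x e *\<^sub>R e))"
  using assms
proof (induction \<Lambda> arbitrary: V)
  case empty
  then show ?case by (intro exI[of _ "{}"]) auto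
next
  case (insert l \<Lambda>)
  interpret form_space V M by fact
  have lin: "linear_on V l" using insert.prems by simp
  define V' where "V' = {x\<in>V. l x = 0}"
  have V'V: "V' \<subseteq> V" by (auto simp: V'_def)
  have sub': "subspace V'"
    unfolding V'_def using subspace lin
    by (auto simp: subspace_def linear_on_add linear_on_scale linear_on_zero[OF lin subspace])
  have "form_space V' M"
    using V'V bilinear sym pos sub'
    by unfold_locales (auto simp: bilinear_on_def intro: linear_on_subset, blast+)
  then obtain E where E: "finite E" "E \<subseteq> V'"
      "\<forall>e\<in>E. \<forall>e'\<in>E. M e e' = (if e = e' then 1 else 0)"
      "\<forall>x\<in>V'. x = (\<Sum>e\<in>E. M x e *\<^sub>R e)"
  proof -
    have "\<exists>E. finite E \<and> E \<subseteq> V' \<and> (\<forall>e\<in>E. \<forall>e'\<in>E. M e e' = (if e = e' then 1 else 0)) \<and>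
        (\<forall>x\<in>V'. x = (\<Sum>e\<in>E. M x e *\<^sub>R e))"
    proof (rule insert.IH)
      show "form_space V' M" by fact
      show "linear_on V' l'" if "l' \<in> \<Lambda>" for l'
        using insert.prems(2)[of l'] that V'V linear_on_subset by blast
      show "x = 0" if "x \<in> V'" "\<And>l. l \<in> \<Lambda> \<Longrightarrow> l x = 0" for x
        using insert.prems(3)[of x] that by (auto simp: V'_def)
    qed
    then show ?thesis using that by blast
  qed
  have EV: "e \<in> E \<Longrightarrow> e \<in> V" for e using E(2) V'V by auto
  show ?case
  proof (cases "V' = V")
    case True
    then show ?thesis using E by blast
  next
    case False
    then obtain w where w: "w \<in> V" "l w \<noteq> 0" by (auto simp: V'_def)
    \<comment> \<open>The subtracted projection lies in the kernel of \<open>l\<close>, so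
      \<open>l w1 = l w\<close> and \<open>w1\<close> cannot vanish.\<close>
    define w1 where "w1 = w - (\<Sum>e\<in>E. M w e *\<^sub>R e)"
    have s: "(\<Sum>e\<in>E. M w e *\<^sub>R e) \<in> V'"
      using E(2) by (intro subspace_sum sub' subspace_scale) auto
    have w1: "w1 \<in> V" using w s V'V subspace by (auto simp: w1_def intro: subspace_diff)
    have lw1: "l w1 = l w"
      using s w V'V by (auto simp: w1_def V'_def linear_on_diff[OF lin subspace])
    have ne: "w1 \<noteq> 0" using lw1 w linear_on_zero[OF lin subspace] by auto
    have orth: "M w1 e = 0" if "e \<in> E" for e
    proof -
      have "M w1 e = M w e - M (\<Sum>e'\<in>E. M w e' *\<^sub>R e') e"
        unfolding w1_def using that EV w s V'V by (intro form_simps) auto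
      also have "M (\<Sum>e'\<in>E. M w e' *\<^sub>R e') e = (\<Sum>e'\<in>E. M w e' * M e' e)"
        using that EV by (intro linear_on_sum[OF bilinear_on_left[OF bilinear] subspace]) auto
      also have "\<dots> = (\<Sum>e'\<in>E. if e' = e then M w e else 0)"
        using E(3) that by (intro sum.cong) auto
      also have "\<dots> = M w e" using E(1) that by simp
      finally show ?thesis by simp
    qed
    define b where "b = (1 / sqrt (M w1 w1)) *\<^sub>R w1"
    have pw: "0 < M w1 w1" using pos w1 ne by blast
    have b: "b \<in> V" using w1 subspace by (simp add: b_def subspace_scale)
    have Mbb: "M b b = 1"
      using w1 pw b unfolding b_def
      by (simp add: form_simps subspace subspace_scale)
    have borth: "M b e = 0" if "e \<in> E" for e
      using that orth w1 EV by (simp add: b_def form_simps)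
    have lb: "l b \<noteq> 0"
      using lw1 w pw by (simp add: b_def linear_on_scale[OF lin w1])
    have bE: "b \<notin> E" using lb E(2) by (auto simp: V'_def)
    have "x = (\<Sum>e\<in>insert b E. M x e *\<^sub>R e)" if x: "x \<in> V" for x
    proof -
      \<comment> \<open>This multiple of \<open>b\<close> cancels \<open>l x\<close>, so the
        remainder lies in \<open>V'\<close>, where the induction hypothesis expands it.\<close>
      define t where "t = l x / l b"
      define y where "y = x - t *\<^sub>R b"
      have tb: "t *\<^sub>R b \<in> V" using b subspace by (simp add: subspace_scale)
      have yV: "y \<in> V" using x tb subspace by (simp add: y_def subspace_diff)
      have y: "y \<in> V'"
        using yV lb b x tb
        by (simp add: V'_def y_def t_def linear_on_diff[OF lin subspace] linear_on_scale[OF lin])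
      have xy: "x = y + t *\<^sub>R b" by (simp add: y_def)
      have Mxe: "M x e = M y e" if "e \<in> E" for e
        using that EV b yV borth tb by (simp add: xy form_simps)
      have yb: "M y b = 0"
      proof -
        have "M y b = M (\<Sum>e\<in>E. M y e *\<^sub>R e) b" using E(4) y by metis
        also have "\<dots> = (\<Sum>e\<in>E. M y e * M e b)"
          using b EV by (intro linear_on_sum[OF bilinear_on_left[OF bilinear] subspace]) auto
        also have "\<dots> = 0" using borth sym b EV by (intro sum.neutral) auto
        finally show ?thesis .
      qed
      have "M x b = t" using yb Mbb b yV tb by (simp add: xy form_simps)
      moreover have "(\<Sum>e\<in>E. M x e *\<^sub>R e) = y"
        using E(4) y Mxe by (metis (no_types, lifting) sum.cong)
      ultimately show ?thesis using bE E(1) xy by (simp add: add.commute)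
    qed
    moreover have "\<forall>e\<in>insert b E. \<forall>e'\<in>insert b E. M e e' = (if e = e' then 1 else 0)"
      using E(3) Mbb borth bE sym b EV by auto
    ultimately show ?thesis using E(1) EV b
      by (intro exI[of _ "insert b E"]) auto
  qed
qed

locale finite_form_space = form_space V M for V :: "'v::real_vector set" and M +
  fixes \<Lambda> :: "('v \<Rightarrow> real) set"
  assumes finite_functionals: "finite \<Lambda>"
    and linear_functionals: "l \<in> \<Lambda> \<Longrightarrow> linear_on V l"
    and separating: "x \<in> V \<Longrightarrow> (\<And>l. l \<in> \<Lambda> \<Longrightarrow> l x = 0) \<Longrightarrow> x = 0"
begin

definition E :: "'v set" where
  "E = (SOME E. finite E \<and> E \<subseteq> V \<and> (\<forall>e\<in>E. \<forall>e'\<in>E. M e e' = (if e = e' then 1 else 0)) \<and>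
    (\<forall>x\<in>V. x = (\<Sum>e\<in>E. M x e *\<^sub>R e)))"

lemma basis: "finite E" "E \<subseteq> V" "e \<in> E \<Longrightarrow> e' \<in> E \<Longrightarrow> M e e' = (if e = e' then 1 else 0)"
  and expand: "x \<in> V \<Longrightarrow> x = (\<Sum>e\<in>E. M x e *\<^sub>R e)"
  using someI_ex[OF exists_orthonormal_family[OF finite_functionals form_space_axioms
      linear_functionals separating], folded E_def] by blast+

lemma linear_expand:
  assumes "linear_on V l" "x \<in> V" shows "l x = (\<Sum>e\<in>E. M x e * l e)"
proof -
  have "l x = l (\<Sum>e\<in>E. M x e *\<^sub>R e)" using expand[OF assms(2)] by (rule arg_cong)
  also have "\<dots> = (\<Sum>e\<in>E. M x e * l e)"
    using basis(2) by (intro linear_on_sum[OF assms(1) subspace]) auto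
  finally show ?thesis .
qed

lemma bilinear_expand:
  assumes "bilinear_on V B" "x \<in> V" "y \<in> V"
  shows "B x y = (\<Sum>e\<in>E. \<Sum>e'\<in>E. M x e * M y e' * B e e')"
proof -
  have "B x y = (\<Sum>e\<in>E. M x e * B e y)"
    using linear_expand[OF bilinear_on_left[OF assms(1,3)] assms(2)] .
  also have "\<dots> = (\<Sum>e\<in>E. M x e * (\<Sum>e'\<in>E. M y e' * B e e'))"
    using basis(2) by (intro sum.cong refl arg_cong2[where f="(*)"]
        linear_expand bilinear_on_right[OF assms(1)] assms) auto
  finally show ?thesis by (simp add: sum_distrib_left mult.assoc)
qed

lemma norm_expand: "x \<in> V \<Longrightarrow> M x x = (\<Sum>e\<in>E. (M x e)\<^sup>2)"
  using linear_expand[OF bilinear_on_right[OF bilinear], of x x]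
  by (simp add: power2_eq_square)

lemma coeff_bound: "x \<in> V \<Longrightarrow> e \<in> E \<Longrightarrow> (M x e)\<^sup>2 \<le> M x x"
  unfolding norm_expand using basis(1) by (intro member_le_sum) auto

text \<open>Expansion in the basis bounds any form by the absolute sum of its matrix entries.
  Applied to gradients it becomes an inverse inequality on the mesh.\<close>

lemma form_bounded:
  assumes "bilinear_on V B"
  shows "\<exists>C. \<forall>x\<in>V. B x x \<le> C * M x x"
proof (intro exI ballI)
  fix x assume x: "x \<in> V"
  have "M x e * M x e' * B e e' \<le> M x x * \<bar>B e e'\<bar>" if e: "e \<in> E" "e' \<in> E" for e e'
  proof -
    have "(\<bar>M x e\<bar> - \<bar>M x e'\<bar>)\<^sup>2 \<ge> 0" by simp
    then have "\<bar>M x e\<bar> * \<bar>M x e'\<bar> \<le> ((M x e)\<^sup>2 + (M x e')\<^sup>2) / 2"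
      by (simp add: power2_diff)
    also have "\<dots> \<le> M x x" using coeff_bound[OF x e(1)] coeff_bound[OF x e(2)] by simp
    finally have "\<bar>M x e\<bar> * \<bar>M x e'\<bar> * \<bar>B e e'\<bar> \<le> M x x * \<bar>B e e'\<bar>"
      by (rule mult_right_mono) simp
    then show ?thesis
      by (rule order_trans[rotated]) (metis abs_ge_self abs_mult)
  qed
  then have "B x x \<le> (\<Sum>e\<in>E. \<Sum>e'\<in>E. M x x * \<bar>B e e'\<bar>)"
    unfolding bilinear_expand[OF assms x x] by (intro sum_mono) auto
  then show "B x x \<le> (\<Sum>e\<in>E. \<Sum>e'\<in>E. \<bar>B e e'\<bar>) * M x x"
    by (simp add: sum_distrib_left sum_distrib_right mult.commute)
qed

lemma riesz:
  assumes "linear_on V l" shows "\<exists>!u. u \<in> V \<and> (\<forall>v\<in>V. M u v = l v)"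
proof (rule ex_ex1I)
  define u where "u = (\<Sum>e\<in>E. l e *\<^sub>R e)"
  have "u \<in> V" using basis(2) by (auto simp: u_def intro!: subspace_sum subspace_scale subspace)
  moreover have "M u v = l v" if "v \<in> V" for v
  proof -
    have "M u v = (\<Sum>e\<in>E. l e * M e v)" unfolding u_def
      using basis(2) that by (intro linear_on_sum[OF bilinear_on_left[OF bilinear] subspace]) auto
    also have "\<dots> = (\<Sum>e\<in>E. M v e * l e)"
      using basis(2) that sym by (intro sum.cong) (auto simp: mult.commute)
    finally show ?thesis using linear_expand[OF assms that] by simp
  qed
  ultimately show "\<exists>u. u \<in> V \<and> (\<forall>v\<in>V. M u v = l v)" by blast
next
  fix u u' assume u: "u \<in> V \<and> (\<forall>v\<in>V. M u v = l v)" and u': "u' \<in> V \<and> (\<forall>v\<in>V. M u' v = l v)"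
  have mem: "u - u' \<in> V" using u u' subspace by (simp add: subspace_diff)
  have "M (u - u') (u - u') = 0" using u u' mem by (simp add: form_simps)
  then show "u = u'" using pos[OF mem] by force
qed

text \<open>Convergence of the basis coordinates. It carries over to every linear functional and
  bilinear form, point evaluations included, and is equivalent to convergence in the norm of
  \<open>M\<close> (\<open>conv_norm\<close>, \<open>norm_conv\<close>).\<close>

definition conv :: "(nat \<Rightarrow> 'v) \<Rightarrow> 'v \<Rightarrow> bool" where
  "conv x y \<longleftrightarrow> (\<forall>e\<in>E. (\<lambda>n. M (x n) e) \<longlonglongrightarrow> M y e)"

lemma conv_linear:
  assumes "conv x y" "\<And>n. x n \<in> V" "y \<in> V" "linear_on V l"
  shows "(\<lambda>n. l (x n)) \<longlonglongrightarrow> l y"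
proof -
  have "(\<lambda>n. \<Sum>e\<in>E. M (x n) e * l e) \<longlonglongrightarrow> (\<Sum>e\<in>E. M y e * l e)"
    using assms(1) by (intro tendsto_sum tendsto_mult tendsto_const) (auto simp: conv_def)
  then show ?thesis using assms by (simp add: linear_expand[OF assms(4), symmetric])
qed

lemma conv_bilinear:
  assumes "conv x a" "conv y b" "\<And>n. x n \<in> V" "\<And>n. y n \<in> V" "a \<in> V" "b \<in> V" "bilinear_on V B"
  shows "(\<lambda>n. B (x n) (y n)) \<longlonglongrightarrow> B a b"
proof -
  have "(\<lambda>n. \<Sum>e\<in>E. \<Sum>e'\<in>E. M (x n) e * M (y n) e' * B e e')
      \<longlonglongrightarrow> (\<Sum>e\<in>E. \<Sum>e'\<in>E. M a e * M b e' * B e e')"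
    using assms(1,2) by (intro tendsto_sum tendsto_mult tendsto_const) (auto simp: conv_def)
  then show ?thesis using assms by (simp add: bilinear_expand[OF assms(7), symmetric])
qed

lemma conv_diff:
  assumes "conv x a" "conv y b" "\<And>n. x n \<in> V" "\<And>n. y n \<in> V" "a \<in> V" "b \<in> V"
  shows "conv (\<lambda>n. x n - y n) (a - b)"
  using assms basis(2) by (auto simp: conv_def form_simps subset_iff intro!: tendsto_diff)

lemma conv_const: "conv (\<lambda>n. a) a"
  by (simp add: conv_def)

lemma conv_norm:
  assumes "conv x a" "\<And>n. x n \<in> V" "a \<in> V"
  shows "(\<lambda>n. M (x n - a) (x n - a)) \<longlonglongrightarrow> 0"
proof -
  have d: "conv (\<lambda>n. x n - a) (a - a)"
    by (rule conv_diff) (use assms conv_const in auto)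
  have "(\<lambda>n. M (x n - a) (x n - a)) \<longlonglongrightarrow> M (a - a) (a - a)"
    by (rule conv_bilinear[OF d d _ _ _ _ bilinear])
      (use assms subspace in \<open>auto intro: subspace_diff subspace_0\<close>)
  then show ?thesis
    using linear_on_zero[OF bilinear_on_right[OF bilinear subspace_0[OF subspace]] subspace] by simp
qed

lemma norm_conv:
  assumes "(\<lambda>n. M (x n - a) (x n - a)) \<longlonglongrightarrow> 0" "\<And>n. x n \<in> V" "a \<in> V"
  shows "conv x a"
  unfolding conv_def
proof
  fix e assume e: "e \<in> E"
  have "(\<lambda>n. (M (x n) e - M a e)\<^sup>2) \<longlonglongrightarrow> 0"
  proof (rule tendsto_sandwich[OF _ _ tendsto_const assms(1)])
    show "\<forall>\<^sub>F n in sequentially. (M (x n) e - M a e)\<^sup>2 \<le> M (x n - a) (x n - a)"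
      using coeff_bound[OF _ e] assms e basis(2) subspace
      by (intro always_eventually allI) (metis form_simps(3) subsetD subspace_diff)
  qed auto
  then have "(\<lambda>n. M (x n) e - M a e) \<longlonglongrightarrow> 0" by (simp add: tendsto_power_zero power_tendsto_0_iff)
  then show "(\<lambda>n. M (x n) e) \<longlonglongrightarrow> M a e" by (simp add: LIM_zero_iff)
qed

text \<open>Bolzano-Weierstrass for the finitely many coordinates, each bounded by
  \<open>sqrt R\<close>; the limit is reassembled from the limits of the coordinates.\<close>

lemma bounded_subseq:
  fixes x :: "nat \<Rightarrow> 'v"
  assumes "\<And>n. x n \<in> V" "\<And>n. M (x n) (x n) \<le> R"
  shows "\<exists>a r. a \<in> V \<and> strict_mono r \<and> conv (x \<circ> r) a"
proof -
  have b: "bounded (range (\<lambda>n. M (x n) e))" if "e \<in> E" for e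
  proof -
    have "\<bar>M (x n) e\<bar> \<le> sqrt R" for n
      using coeff_bound[OF assms(1) that, of n] assms(2)[of n]
      by (metis order_trans real_sqrt_abs real_sqrt_le_iff)
    then show ?thesis by (auto simp: bounded_iff)
  qed
  have "\<forall>d\<subseteq>E. \<exists>l::'v\<Rightarrow>real. \<exists>r. strict_mono r \<and>
      (\<forall>\<epsilon>>0. \<forall>\<^sub>F n in sequentially. \<forall>i\<in>d. dist ((\<lambda>e. M (x (r n)) e) i) (l i) < \<epsilon>)"
    by (rule compact_lemma_general[where f="\<lambda>n e. M (x n) e" and proj="\<lambda>f e. f e"
          and unproj="\<lambda>f. f"]) (use b basis(1) in \<open>auto simp: image_image\<close>)
  from this[THEN spec[of _ E], THEN mp, OF subset_refl]
  obtain l r where lr: "strict_mono (r::nat\<Rightarrow>nat) \<and>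
      (\<forall>\<epsilon>>0. \<forall>\<^sub>F n in sequentially. \<forall>e\<in>E. dist (M (x (r n)) e) (l e) < \<epsilon>)"
    by (elim exE)
  then have r: "strict_mono r"
    and l: "\<And>\<epsilon>. \<epsilon> > 0 \<Longrightarrow> \<forall>\<^sub>F n in sequentially. \<forall>e\<in>E. dist (M (x (r n)) e) (l e) < \<epsilon>"
    by simp_all
  define a where "a = (\<Sum>e\<in>E. l e *\<^sub>R e)"
  have aV: "a \<in> V" using basis(2) by (auto simp: a_def intro!: subspace_sum subspace_scale subspace)
  have "M a e = l e" if "e \<in> E" for e
  proof -
    have "M a e = (\<Sum>e'\<in>E. l e' * M e' e)" unfolding a_def
      using basis(2) that by (intro linear_on_sum[OF bilinear_on_left[OF bilinear] subspace]) auto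
    also have "\<dots> = (\<Sum>e'\<in>E. if e' = e then l e else 0)"
      using that by (intro sum.cong) (auto simp: basis(3))
    finally show ?thesis using that basis(1) by simp
  qed
  then have "conv (x \<circ> r) a"
    unfolding conv_def
    by (intro ballI tendstoI) (use l in \<open>fastforce elim: eventually_mono\<close>)
  then show ?thesis using r aV by blast
qed

end


text \<open>\<open>M\<close> is the metric of the preconditioned forward-backward step for the variational
  inequality of the monotone operator \<open>Q + l + K\<close>: the symmetric part \<open>Q\<close> is taken explicitly and the skew part
  \<open>K\<close> implicitly.\<close>

locale forward_backward = finite_form_space V M \<Lambda>
  for V :: "'v::real_vector set" and M \<Lambda> +
  fixes Q K :: "'v \<Rightarrow> 'v \<Rightarrow> real" and l :: "'v \<Rightarrow> real" and C :: "'v set" and z :: "nat \<Rightarrow> 'v"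
    and R :: real
  assumes Q: "bilinear_on V Q" "\<And>x y. x \<in> V \<Longrightarrow> y \<in> V \<Longrightarrow> Q x y = Q y x"
      "\<And>x. x \<in> V \<Longrightarrow> 0 \<le> Q x x" "\<And>x. x \<in> V \<Longrightarrow> Q x x \<le> M x x"
    and K: "bilinear_on V K" "\<And>x. x \<in> V \<Longrightarrow> K x x = 0"
    and l: "linear_on V l"
    and C: "C \<subseteq> V" "convex C" "\<And>x. x \<in> C \<Longrightarrow> M x x \<le> R"
      "\<And>x a. (\<And>n. x n \<in> C) \<Longrightarrow> a \<in> V \<Longrightarrow> conv x a \<Longrightarrow> a \<in> C"
    and z: "z 0 \<in> V" "\<And>n. z (Suc n) \<in> C"
    and step: "\<And>n x. x \<in> C \<Longrightarrow> 0 \<le> Q (z n) (x - z (Suc n)) + l (x - z (Suc n))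
      + K (z (Suc n)) (x - z (Suc n)) + M (z (Suc n) - z n) (x - z (Suc n))"
begin

abbreviation "\<delta> n \<equiv> z (Suc n) - z n"
abbreviation "nM x \<equiv> M x x"

lemma zV: "z n \<in> V"
  using z C(1) by (cases n) auto

lemmas Q_simps = bilinear_on_simps[OF Q(1) subspace]
lemmas K_simps = bilinear_on_simps[OF K(1) subspace]

lemma CV: "x \<in> C \<Longrightarrow> x \<in> V"
  using C(1) by auto

lemma VD: "x \<in> V \<Longrightarrow> y \<in> V \<Longrightarrow> x - y \<in> V"
  using subspace by (rule subspace_diff)

section \<open>Energy estimate and existence of a solution\<close>

definition \<Phi> :: "'v \<Rightarrow> real" where "\<Phi> x = Q x x / 2 + l x"

text \<open>Expresses the explicit term of a step through energies; its one unfavourable part, half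
  of \<open>Q (y - x) (y - x)\<close>, is what the last term of \<open>M_identity\<close> absorbs
  thanks to \<open>Q \<le> M\<close>.\<close>

lemma Q_identity:
  assumes "x \<in> V" "y \<in> V" "w \<in> V"
  shows "Q x (w - y) = Q w w / 2 - Q y y / 2 - Q (w - x) (w - x) / 2 + Q (y - x) (y - x) / 2"
  using assms Q(2)[of x y] Q(2)[of x w] Q(2)[of w y] by (simp add: Q_simps VD field_simps)

lemma M_identity:
  assumes "x \<in> V" "y \<in> V" "w \<in> V"
  shows "M (y - x) (w - y) = M (w - x) (w - x) / 2 - nM (w - y) / 2 - nM (y - x) / 2"
  using assms sym[of x y] sym[of x w] sym[of w y] by (simp add: form_simps VD field_simps)

text \<open>An estimate against every \<open>x\<close> in \<open>C\<close>, without reference to a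
  solution, whose right-hand side telescopes. Skewness removes
  \<open>K (z (Suc n)) (z (Suc n))\<close>.\<close>

lemma step_energy:
  assumes x: "x \<in> C"
  shows "\<Phi> (z (Suc n)) - K (z (Suc n)) x
    \<le> \<Phi> x + M (x - z n) (x - z n) / 2 - M (x - z (Suc n)) (x - z (Suc n)) / 2"
proof -
  note xV = CV[OF x]
  have l': "l (x - z (Suc n)) = l x - l (z (Suc n))"
    using linear_on_diff[OF l subspace xV zV] .
  have K': "K (z (Suc n)) (x - z (Suc n)) = K (z (Suc n)) x"
    using xV zV K(2) by (simp add: K_simps)
  have "0 \<le> Q (x - z n) (x - z n)" "Q (\<delta> n) (\<delta> n)
      \<le> nM (\<delta> n)"
    using Q(3,4) VD xV zV by auto
  then show ?thesis
    using step[OF x, of n] unfolding l' K' Q_identity[OF zV zV xV] M_identity[OF zV zV xV] \<Phi>_def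
    by linarith
qed

lemma \<Phi>_convex: "convex_on C \<Phi>"
proof (rule convex_onI)
  fix t :: real and x y assume t: "0 < t" "t < 1" and x: "x \<in> C" and y: "y \<in> C"
  note V = CV[OF x] CV[OF y]
  have s: "(1 - t) *\<^sub>R x \<in> V" "t *\<^sub>R y \<in> V" "(1 - t) *\<^sub>R x + t *\<^sub>R y \<in> V"
    using V subspace by (auto intro: subspace_scale subspace_add)
  have "(1 - t) * \<Phi> x + t * \<Phi> y - \<Phi> ((1 - t) *\<^sub>R x + t *\<^sub>R y)
      = t * (1 - t) * Q (x - y) (x - y) / 2"
    unfolding \<Phi>_def using V s Q(2)[of x y]
    by (simp only: Q_simps VD linear_on_add[OF l] linear_on_scale[OF l]) (simp add: field_simps)
  moreover have "0 \<le> t * (1 - t) * Q (x - y) (x - y) / 2"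
    using t Q(3) VD V by auto
  ultimately show "\<Phi> ((1 - t) *\<^sub>R x + t *\<^sub>R y) \<le> (1 - t) * \<Phi> x + t * \<Phi> y" by linarith
qed (rule C)

lemma K_skew:
  assumes "x \<in> V" "y \<in> V"
  shows "K x y = - K y x"
proof -
  have "K (x - y) (x - y) = 0" using K(2) VD assms by blast
  moreover have "K (x - y) (x - y) = K x x - K y x - (K x y - K y y)"
    using assms by (simp add: K_simps VD)
  ultimately show ?thesis using assms K(2) by simp
qed

definition solution :: "'v \<Rightarrow> bool" where
  "solution s \<longleftrightarrow> s \<in> C \<and> (\<forall>x\<in>C. 0 \<le> Q s (x - s) + l (x - s) + K s (x - s))"

text \<open>The solution is a cluster point of the ergodic averages of the iterates.\<close>

lemma solution_exists: "\<exists>s. solution s"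
proof -
  \<comment> \<open>The average starts at \<open>z 1\<close>, since \<open>z 0\<close> is only known
    to lie in \<open>V\<close>.\<close>
  define m where "m N = (\<Sum>i\<le>N. (1 / real (Suc N)) *\<^sub>R z (Suc i))" for N
  have mC: "m N \<in> C" for N
    unfolding m_def using z(2) C(2) by (intro convex_sum) auto
  have mV: "m N \<in> V" for N using mC CV by blast
  have mbound: "\<Phi> (m N) - K (m N) x \<le> \<Phi> x + nM (x - z 0) / 2 / real (Suc N)"
    if x: "x \<in> C" for N x
  proof -
    \<comment> \<open>Summing \<open>step_energy\<close> telescopes the distances to
      \<open>x\<close>; convexity of \<open>\<Phi>\<close> and linearity of \<open>K\<close> in its
      first argument then move the sum to the average, with an error of order
      \<open>1 / N\<close>.\<close>
    have tel: "(\<Sum>i\<le>N. \<Phi> (z (Suc i)) - K (z (Suc i)) x)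
        \<le> real (Suc N) * \<Phi> x + nM (x - z 0) / 2 - M (x - z (Suc N)) (x - z (Suc N)) / 2"
    proof (induction N)
      case 0
      show ?case using step_energy[OF x, of 0] by simp
    next
      case (Suc N)
      then show ?case using step_energy[OF x, of "Suc N"] by (simp add: algebra_simps)
    qed
    have nn: "0 \<le> M (x - z (Suc N)) (x - z (Suc N))"
      using nonneg VD CV[OF x] zV by blast
    have "\<Phi> (m N) \<le> (\<Sum>i\<le>N. (1 / real (Suc N)) * \<Phi> (z (Suc i)))"
      unfolding m_def using z(2) by (intro convex_on_sum[OF _ _ \<Phi>_convex]) auto
    moreover have "K (m N) x = (\<Sum>i\<le>N. (1 / real (Suc N)) * K (z (Suc i)) x)"
      unfolding m_def
      using zV CV[OF x] by (intro linear_on_sum[OF bilinear_on_left[OF K(1)] subspace]) auto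
    ultimately have "\<Phi> (m N) - K (m N) x
        \<le> (1 / real (Suc N)) * (\<Sum>i\<le>N. \<Phi> (z (Suc i)) - K (z (Suc i)) x)"
      by (simp add: sum_subtractf sum_distrib_left right_diff_distrib)
    also have "\<dots> \<le> (1 / real (Suc N)) * (real (Suc N) * \<Phi> x + nM (x - z 0) / 2)"
      using tel nn by (intro mult_left_mono) auto
    also have "\<dots> = \<Phi> x + nM (x - z 0) / 2 / real (Suc N)"
      by (simp add: field_simps del: of_nat_Suc)
    finally show ?thesis .
  qed
  obtain s r where sV: "s \<in> V" and r: "strict_mono r" and conv: "conv (m \<circ> r) s"
    using bounded_subseq[of m R] mV mC C(3) by blast
  have sC: "s \<in> C" using C(4)[OF _ sV conv] mC by simp
  have lim: "\<Phi> s - K s x \<le> \<Phi> x" if x: "x \<in> C" for x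
  proof (rule LIMSEQ_le)
    have "(\<lambda>k. Q ((m \<circ> r) k) ((m \<circ> r) k)) \<longlonglongrightarrow> Q s s"
      by (rule conv_bilinear[OF conv conv _ _ _ _ Q(1)]) (use mV sV in auto)
    moreover have "(\<lambda>k. l ((m \<circ> r) k)) \<longlonglongrightarrow> l s"
      by (rule conv_linear[OF conv _ _ l]) (use mV sV in auto)
    moreover have "(\<lambda>k. K ((m \<circ> r) k) x) \<longlonglongrightarrow> K s x"
      by (rule conv_linear[OF conv _ _ bilinear_on_left[OF K(1)]]) (use mV sV x CV in auto)
    ultimately show "(\<lambda>k. \<Phi> (m (r k)) - K (m (r k)) x) \<longlonglongrightarrow> \<Phi> s - K s x"
      unfolding \<Phi>_def comp_def by (intro tendsto_intros) auto
    have "(\<lambda>k. \<Phi> x + nM (x - z 0) / 2 / real (Suc k)) \<longlonglongrightarrow> \<Phi> x + 0"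
      by (intro tendsto_add tendsto_const tendsto_divide_Suc)
    from LIMSEQ_subseq_LIMSEQ[OF this r]
    show "(\<lambda>k. \<Phi> x + nM (x - z 0) / 2 / real (Suc (r k))) \<longlonglongrightarrow> \<Phi> x"
      by (simp add: comp_def)
  qed (use mbound[OF x] in auto)
  have "0 \<le> Q s (x - s) + l (x - s) + K s (x - s)" if x: "x \<in> C" for x
  proof -
    note Ks = bilinear_on_right[OF K(1) sV]
    have lin: "linear_on V (\<lambda>x. l x + K s x)"
      by (intro linear_onI) (simp_all add: linear_on_add[OF l] linear_on_scale[OF l]
          linear_on_add[OF Ks] linear_on_scale[OF Ks] algebra_simps)
    \<comment> \<open>As \<open>K s s = 0\<close>, the limit inequality says that \<open>s\<close>
      minimises \<open>\<Phi> y + K s y\<close> over \<open>C\<close>; the variational inequality is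
      the first-order condition of this problem.\<close>
    have min: "l s + K s s + 1 / 2 * Q (s - 0) (s - 0) \<le> l y + K s y + 1 / 2 * Q (y - 0) (y - 0)"
      if "y \<in> C" for y
      using lim[OF that] K(2)[OF sV] by (simp add: \<Phi>_def)
    show ?thesis
      using quadratic_first_order[OF Q(1) subspace Q(2) lin C(1,2) subspace_0[OF subspace] sC min x]
      by simp
  qed
  then show ?thesis using sC by (auto simp: solution_def)
qed

text \<open>Cocoercivity of \<open>Q\<close> in the metric \<open>M\<close>, by polarisation: four
  times the left side equals \<open>Q (x - y) (x - y) - Q (x + y) (x + y)\<close>, where
  \<open>Q \<le> M\<close> bounds the first term and the second is nonnegative.\<close>

lemma quarter_bound:
  assumes "x \<in> V" "y \<in> V"
  shows "- Q x y \<le> M (x - y) (x - y) / 4"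
proof -
  have "0 \<le> Q (x + y) (x + y)" "Q (x - y) (x - y) \<le> M (x - y) (x - y)"
    using assms Q(3,4) subspace by (auto intro: subspace_add subspace_diff)
  moreover have "Q (x - y) (x - y) - Q (x + y) (x + y) = - 4 * Q x y"
    using assms Q(2)[of x y] subspace by (simp add: Q_simps VD subspace_add)
  ultimately show ?thesis by simp
qed

text \<open>The step is tested with \<open>s\<close> and the inequality for \<open>s\<close> with
  \<open>z (Suc n)\<close>. In the sum \<open>l\<close> cancels by linearity and \<open>K\<close> by
  skewness; the remaining \<open>Q\<close> term costs a quarter of the squared increment, against
  the half gained in \<open>M_identity\<close>.\<close>

lemma step_fejer:
  assumes s: "solution s"
  shows "nM (\<delta> n) / 2
    \<le> M (s - z n) (s - z n) - M (s - z (Suc n)) (s - z (Suc n))"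
proof -
  have sC: "s \<in> C" and sV: "s \<in> V" using s CV by (auto simp: solution_def)
  have ineq: "0 \<le> Q s (z (Suc n) - s) + l (z (Suc n) - s) + K s (z (Suc n) - s)"
    using s z(2) by (auto simp: solution_def)
  have d: "z (Suc n) - s \<in> V" "z n - s \<in> V" using VD zV sV by auto
  have "- Q (z (Suc n) - s) (z n - s)
      \<le> M ((z (Suc n) - s) - (z n - s)) ((z (Suc n) - s) - (z n - s)) / 4"
    by (rule quarter_bound[OF d])
  then have q: "- Q (z (Suc n) - s) (z n - s) \<le> nM (\<delta> n) / 4" by simp
  have lin: "l (s - z (Suc n)) + l (z (Suc n) - s) = 0"
    using linear_on_diff[OF l subspace] sV zV by simp
  have k: "K (z (Suc n)) (s - z (Suc n)) + K s (z (Suc n) - s) = 0"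
    using sV zV K(2) K_skew[of s "z (Suc n)"] by (simp add: K_simps)
  have "Q (z n) (s - z (Suc n)) + Q s (z (Suc n) - s) = - Q (z (Suc n) - s) (z n - s)"
    using sV zV Q(2) by (simp add: Q_simps VD)
  with step[OF sC, of n] ineq lin k q
  have "0 \<le> nM (\<delta> n) / 4 + M (\<delta> n) (s - z (Suc n))"
    by linarith
  then show ?thesis unfolding M_identity[OF zV zV sV] by simp
qed

text \<open>Two consecutive steps are tested with each other's results, so \<open>l\<close> and
  \<open>K\<close> cancel again. The rest is \<open>quarter_bound\<close> for the two increments and
  the expansion of the square of their difference.\<close>

lemma step_decreasing:
  "M (z (Suc (Suc n)) - z (Suc n)) (z (Suc (Suc n)) - z (Suc n))
    \<le> nM (\<delta> n)"
proof -
  define x y w where "x = z n" and "y = z (Suc n)" and "w = z (Suc (Suc n))"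
  have V: "x \<in> V" "y \<in> V" "w \<in> V" using zV by (auto simp: x_def y_def w_def)
  have d: "w - y \<in> V" "y - x \<in> V" using VD V by auto
  have 1: "0 \<le> Q x (w - y) + l (w - y) + K y (w - y) + M (y - x) (w - y)"
    using step[OF z(2)[of "Suc n"], of n] by (simp add: x_def y_def w_def)
  have 2: "0 \<le> Q y (y - w) + l (y - w) + K w (y - w) + M (w - y) (y - w)"
    using step[OF z(2)[of n], of "Suc n"] by (simp add: x_def y_def w_def)
  have lin: "l (w - y) + l (y - w) = 0"
    using linear_on_diff[OF l subspace] V by simp
  have k: "K y (w - y) + K w (y - w) = 0"
    using V K(2) K_skew[of w y] by (simp add: K_simps)
  have q: "Q x (w - y) + Q y (y - w) = - Q (w - y) (y - x)"
    using V Q(2) by (simp add: Q_simps VD)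
  have m: "M (w - y) (y - w) = - nM (w - y)"
    using V by (simp add: form_simps VD)
  have "0 \<le> - Q (w - y) (y - x) + M (y - x) (w - y) - nM (w - y)"
    using 1 2 lin k q m by linarith
  also have "\<dots> \<le> nM ((w - y) - (y - x)) / 4 + M (y - x) (w - y) - nM (w - y)"
    using quarter_bound[OF d] by linarith
  finally have 3: "0 \<le> nM ((w - y) - (y - x)) / 4 + M (y - x) (w - y) - nM (w - y)" .
  have 4: "nM ((w - y) - (y - x))
      = nM (w - y) - 2 * M (y - x) (w - y) + nM (y - x)"
    using d sym[of "w - y" "y - x"] by (simp only: bilinear_on_simps[OF bilinear subspace] VD)
  have 5: "0 \<le> nM ((w - y) - (y - x))" using nonneg VD d by blast
  have "nM (w - y) \<le> nM (y - x)" using 3 4 5 by linarith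
  then show ?thesis by (simp add: x_def y_def w_def)
qed

text \<open>In a decreasing sequence the last of \<open>n + 1\<close> terms is at most their
  average, and the sum is bounded by the Fejer estimate.\<close>

lemma rate:
  "\<exists>B. \<forall>n. real (Suc n) * nM (\<delta> n) \<le> B"
proof -
  obtain s where s: "solution s" using solution_exists ..
  have sV: "s \<in> V" using s CV by (auto simp: solution_def)
  define D where "D n = nM (\<delta> n)" for n
  have "(\<Sum>i\<le>n. D i / 2) \<le> nM (s - z 0) - M (s - z (Suc n)) (s - z (Suc n))" for n
  proof (induction n)
    case 0
    show ?case using step_fejer[OF s, of 0] by (simp add: D_def)
  next
    case (Suc n)
    then show ?case using step_fejer[OF s, of "Suc n"] by (simp add: D_def)
  qed
  then have sum: "(\<Sum>i\<le>n. D i / 2) \<le> nM (s - z 0)" for n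
    by (rule order_trans) (simp add: nonneg VD sV zV)
  have mono: "D n \<le> D i" if "i \<le> n" for i n
    by (rule lift_Suc_antimono_le[OF _ that]) (simp only: D_def step_decreasing)
  have "real (Suc n) * D n \<le> 2 * nM (s - z 0)" for n
  proof -
    have "(\<Sum>i\<le>n. D n / 2) \<le> (\<Sum>i\<le>n. D i / 2)"
      by (intro sum_mono) (use mono in auto)
    also note sum
    finally show ?thesis by simp
  qed
  then show ?thesis unfolding D_def by blast
qed

lemma cluster_point_solution:
  "\<exists>s r. solution s \<and> strict_mono r \<and> conv (z \<circ> r) s"
proof -
  \<comment> \<open>Compactness is applied to the shifted sequence, all of whose members lie in the
    bounded set \<open>C\<close>. The increments tend to 0, so the unshifted subsequence has the
    same limit.\<close>
  obtain s r where sV: "s \<in> V" and r: "strict_mono r" and cv: "conv ((\<lambda>n. z (Suc n)) \<circ> r) s"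
    using bounded_subseq[of "\<lambda>n. z (Suc n)" R] zV z(2) C(3) by blast
  define x y where "x k = z (r k)" and "y k = z (Suc (r k))" for k
  have xy: "x k \<in> V" "y k \<in> V" for k using zV by (auto simp: x_def y_def)
  have "y = (\<lambda>n. z (Suc n)) \<circ> r" by (simp add: fun_eq_iff y_def)
  then have cy: "conv y s" using cv by simp
  have sC: "s \<in> C" by (rule C(4)[OF _ sV cy]) (simp add: y_def z)
  obtain B where B: "\<And>n. real (Suc n) * nM (\<delta> n) \<le> B"
    using rate by blast
  have D0: "(\<lambda>n. nM (\<delta> n)) \<longlonglongrightarrow> 0"
  proof (rule tendsto_sandwich[OF _ _ tendsto_const])
    show "\<forall>\<^sub>F n in sequentially. nM (\<delta> n) \<le> B / real (Suc n)"
      using B by (intro always_eventually allI) (simp add: field_simps)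
    show "\<forall>\<^sub>F n in sequentially. 0 \<le> nM (\<delta> n)"
      using nonneg VD zV by (intro always_eventually allI) blast
    show "(\<lambda>n. B / real (Suc n)) \<longlonglongrightarrow> 0"
      by (rule tendsto_divide_Suc)
  qed
  have cd: "conv (\<lambda>k. y k - x k) 0"
  proof (rule norm_conv)
    show "(\<lambda>n. M (y n - x n - 0) (y n - x n - 0)) \<longlonglongrightarrow> 0"
      using LIMSEQ_subseq_LIMSEQ[OF D0 r] by (simp add: x_def y_def comp_def)
  qed (use VD xy subspace_0[OF subspace] in auto)
  have "conv (\<lambda>k. y k - (y k - x k)) (s - 0)"
    by (rule conv_diff[OF cy cd]) (use VD xy sV subspace_0[OF subspace] in auto)
  then have cx: "conv x s" by simp
  have "0 \<le> Q s (w - s) + l (w - s) + K s (w - s)" if w: "w \<in> C" for w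
  proof (rule LIMSEQ_le_const)
    have cw: "conv (\<lambda>k. w - y k) (w - s)"
      by (rule conv_diff[OF conv_const cy]) (use xy sV CV w in auto)
    have wV: "w - y k \<in> V" "w - s \<in> V" for k using VD CV w xy sV by auto
    \<comment> \<open>The limit is taken in the step inequality itself; the metric term disappears
      because its first argument is the vanishing increment.\<close>
    have "(\<lambda>k. Q (x k) (w - y k) + l (w - y k) + K (y k) (w - y k) + M (y k - x k) (w - y k))
        \<longlonglongrightarrow> Q s (w - s) + l (w - s) + K s (w - s) + M 0 (w - s)"
      by (intro tendsto_add conv_bilinear[OF cx cw _ _ _ _ Q(1)] conv_linear[OF cw _ _ l]
          conv_bilinear[OF cy cw _ _ _ _ K(1)] conv_bilinear[OF cd cw _ _ _ _ bilinear])
        (use wV xy sV VD subspace_0[OF subspace] in auto)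
    moreover have "M 0 (w - s) = 0"
      using linear_on_zero[OF bilinear_on_left[OF bilinear] subspace] wV by blast
    ultimately show "(\<lambda>k. Q (x k) (w - y k) + l (w - y k) + K (y k) (w - y k) + M (y k - x k) (w - y k))
        \<longlonglongrightarrow> Q s (w - s) + l (w - s) + K s (w - s)" by simp
    show "\<exists>N. \<forall>n\<ge>N. 0 \<le> Q (x n) (w - y n) + l (w - y n) + K (y n) (w - y n) + M (y n - x n) (w - y n)"
      using step[OF w] by (auto simp: x_def y_def)
  qed
  then have "solution s" using sC by (simp add: solution_def)
  moreover have "x = z \<circ> r" by (simp add: fun_eq_iff x_def)
  ultimately show ?thesis using r cx by blast
qed

end

section \<open>Piecewise linear and piecewise constant functions on a mesh\<close>

text \<open>A class closed under sums and products, unlike integrability. On sets of finite measure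
  it reduces the integrability of the integrands built from discrete functions and coefficients to
  closure rules.\<close>

definition ess_bounded :: "'a measure \<Rightarrow> 'a set \<Rightarrow> ('a \<Rightarrow> real) \<Rightarrow> bool" where
  "ess_bounded \<mu> A g \<longleftrightarrow> set_borel_measurable \<mu> A g \<and> (\<exists>C. AE x in \<mu>. x \<in> A \<longrightarrow> \<bar>g x\<bar> \<le> C)"

lemma ess_boundedI:
  "set_borel_measurable \<mu> A g \<Longrightarrow> (\<And>x. x \<in> A \<Longrightarrow> \<bar>g x\<bar> \<le> C) \<Longrightarrow> ess_bounded \<mu> A g"
  by (auto simp: ess_bounded_def)

lemma ess_bounded_const: "A \<in> sets \<mu> \<Longrightarrow> ess_bounded \<mu> A (\<lambda>x. c)"
  by (auto intro!: ess_boundedI[where C="\<bar>c\<bar>"] simp: set_borel_measurable_def)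

lemma ess_bounded_add:
  assumes "ess_bounded \<mu> A f" "ess_bounded \<mu> A g"
  shows "ess_bounded \<mu> A (\<lambda>x. f x + g x)"
proof -
  obtain C D where "AE x in \<mu>. x \<in> A \<longrightarrow> \<bar>f x\<bar> \<le> C" "AE x in \<mu>. x \<in> A \<longrightarrow> \<bar>g x\<bar> \<le> D"
    using assms by (auto simp: ess_bounded_def)
  then have "AE x in \<mu>. x \<in> A \<longrightarrow> \<bar>f x + g x\<bar> \<le> C + D"
    by eventually_elim (auto intro: order_trans[OF abs_triangle_ineq add_mono])
  moreover have "set_borel_measurable \<mu> A (\<lambda>x. f x + g x)"
    using assms by (auto simp: ess_bounded_def set_borel_measurable_def distrib_left
        intro: borel_measurable_add)
  ultimately show ?thesis by (auto simp: ess_bounded_def)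
qed

lemma ess_bounded_mult:
  assumes "ess_bounded \<mu> A f" "ess_bounded \<mu> A g"
  shows "ess_bounded \<mu> A (\<lambda>x. f x * g x)"
proof -
  obtain C D where "AE x in \<mu>. x \<in> A \<longrightarrow> \<bar>f x\<bar> \<le> C" "AE x in \<mu>. x \<in> A \<longrightarrow> \<bar>g x\<bar> \<le> D"
    using assms by (auto simp: ess_bounded_def)
  then have "AE x in \<mu>. x \<in> A \<longrightarrow> \<bar>f x * g x\<bar> \<le> C * D"
    by eventually_elim (auto simp: abs_mult intro: mult_mono')
  moreover have "(\<lambda>x. (indicator A x *\<^sub>R f x) * (indicator A x *\<^sub>R g x)) \<in> borel_measurable \<mu>"
    using assms by (intro borel_measurable_times) (auto simp: ess_bounded_def set_borel_measurable_def)
  then have "set_borel_measurable \<mu> A (\<lambda>x. f x * g x)"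
    unfolding set_borel_measurable_def
    by (rule back_subst[of "\<lambda>h. h \<in> borel_measurable \<mu>"]) (auto simp: fun_eq_iff indicator_def)
  ultimately show ?thesis by (auto simp: ess_bounded_def)
qed

lemma ess_bounded_cmult: "A \<in> sets \<mu> \<Longrightarrow> ess_bounded \<mu> A g \<Longrightarrow> ess_bounded \<mu> A (\<lambda>x. c * g x)"
  using ess_bounded_mult[OF ess_bounded_const] .

lemma ess_bounded_sum:
  assumes "A \<in> sets \<mu>" "\<And>i. i \<in> I \<Longrightarrow> ess_bounded \<mu> A (f i)"
  shows "ess_bounded \<mu> A (\<lambda>x. \<Sum>i\<in>I. f i x)"
proof (cases "finite I")
  case True
  then show ?thesis using assms(2)
    by (induction I) (auto intro: ess_bounded_add simp: ess_bounded_const[OF assms(1)])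
qed (simp add: ess_bounded_const[OF assms(1)])

lemma ess_bounded_set_integrable:
  fixes g :: "'a \<Rightarrow> real"
  assumes "ess_bounded \<mu> A g" "A \<in> sets \<mu>" "emeasure \<mu> A < \<infinity>"
  shows "set_integrable \<mu> A g"
proof -
  obtain C where C: "AE x in \<mu>. x \<in> A \<longrightarrow> \<bar>g x\<bar> \<le> C" using assms by (auto simp: ess_bounded_def)
  show ?thesis unfolding set_integrable_def
    by (rule integrableI_bounded_set[where A=A and B=C])
      (use assms C in \<open>auto simp: ess_bounded_def set_borel_measurable_def\<close>)
qed

text \<open>Holds by completeness of Lebesgue measure. It transfers measurability from a controlled
  representative to \<open>grad u\<close>, whose values on the skeleton are unspecified.\<close>

lemma lebesgue_measurable_cong_AE:
  fixes f g :: "'a::euclidean_space \<Rightarrow> 'b::topological_space"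
  assumes "f \<in> borel_measurable lebesgue" "AE x in lebesgue. f x = g x"
  shows "g \<in> borel_measurable lebesgue"
proof (rule measurableI)
  fix A :: "'b set" assume "A \<in> sets borel"
  then have "f -` A \<inter> space lebesgue \<in> sets lebesgue" using assms(1) by (rule measurable_sets[rotated])
  then show "g -` A \<inter> space lebesgue \<in> sets lebesgue"
    by (rule completion.in_sets_AE[rotated]) (use assms(2) in auto)
qed auto

lemma set_borel_measurable_cong_AE:
  fixes f g :: "'a::euclidean_space \<Rightarrow> real"
  assumes "set_borel_measurable lebesgue A f" "AE x in lebesgue. x \<in> A \<longrightarrow> f x = g x"
  shows "set_borel_measurable lebesgue A g"
  unfolding set_borel_measurable_def
  by (rule lebesgue_measurable_cong_AE[OF assms(1)[unfolded set_borel_measurable_def]])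
    (use assms(2) in \<open>auto simp: indicator_def\<close>)

lemma ess_bounded_cong_AE:
  fixes f g :: "'a::euclidean_space \<Rightarrow> real"
  assumes "ess_bounded lebesgue A f" "AE x in lebesgue. x \<in> A \<longrightarrow> f x = g x"
  shows "ess_bounded lebesgue A g"
proof -
  obtain C where C: "AE x in lebesgue. x \<in> A \<longrightarrow> \<bar>f x\<bar> \<le> C"
    using assms by (auto simp: ess_bounded_def)
  have "AE x in lebesgue. x \<in> A \<longrightarrow> \<bar>g x\<bar> \<le> C"
    using C assms(2) by eventually_elim auto
  then show ?thesis
    using set_borel_measurable_cong_AE[OF _ assms(2)] assms(1) by (auto simp: ess_bounded_def)
qed

lemma set_integral_lebesgue_cong_AE:
  fixes f g :: "'a::euclidean_space \<Rightarrow> real"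
  assumes "set_borel_measurable lebesgue A f" "AE x in lebesgue. x \<in> A \<longrightarrow> f x = g x"
  shows "(LINT x:A|lebesgue. f x) = (LINT x:A|lebesgue. g x)"
  unfolding set_lebesgue_integral_def
  by (rule integral_cong_AE)
    (use assms set_borel_measurable_cong_AE[OF assms] in
      \<open>auto simp: set_borel_measurable_def indicator_def\<close>)

lemma grad_eq:
  assumes "GDERIV f x :> D" shows "grad f x = D"
  unfolding grad_def
proof (rule the_equality[where P="\<lambda>D. GDERIV f x :> D", OF assms])
  fix D' assume "GDERIV f x :> D'"
  then have "(\<lambda>h. h \<bullet> D') = (\<lambda>h. h \<bullet> D)"
    using assms has_derivative_unique unfolding gderiv_def by blast
  then have "\<forall>h. h \<bullet> D' = h \<bullet> D" by (simp add: fun_eq_iff)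
  then show "D' = D" by (simp only: vector_eq_ldot)
qed

lemma ess_bounded_inner:
  fixes p q :: "'a \<Rightarrow> real^'n"
  assumes "A \<in> sets \<mu>" "\<And>j. ess_bounded \<mu> A (\<lambda>x. p x $ j)" "\<And>j. ess_bounded \<mu> A (\<lambda>x. q x $ j)"
  shows "ess_bounded \<mu> A (\<lambda>x. p x \<bullet> q x)"
  unfolding inner_vec_def inner_real_def by (intro ess_bounded_sum ess_bounded_mult assms)

section \<open>The mesh and its two function spaces\<close>

locale mesh =
  fixes \<Omega> :: "(real^'n) set" and \<T> :: "(real^'n) set set"
  assumes open_\<Omega>: "open \<Omega>" and bounded_\<Omega>: "bounded \<Omega>"
    and regular_\<Omega>: "\<Omega> = interior (closure \<Omega>)"
    and triangulation: "triangulation \<T>" and Union_\<T>: "\<Union>\<T> = closure \<Omega>"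
    and simplices: "T \<in> \<T> \<Longrightarrow> int CARD('n) simplex T"
begin

abbreviation "V \<equiv> V1 \<Omega> \<T>"
abbreviation "W \<equiv> V0v \<T>"
abbreviation "ip \<equiv> ipO \<Omega>"
abbreviation "vip \<equiv> vipO \<Omega>"
abbreviation "nrm \<equiv> nrmO \<Omega>"
abbreviation "vnrm \<equiv> vnrmO \<Omega>"
abbreviation "gnorm \<equiv> gradnorm \<Omega> \<T>"
abbreviation "bdd\<Omega> \<equiv> ess_bounded lebesgue \<Omega>"

lemma finite_\<T>: "finite \<T>"
  using triangulation by (simp add: triangulation_def)

lemma compact_simplex': "T \<in> \<T> \<Longrightarrow> compact T"
  using simplices compact_simplex by blast

lemma convex_simplex': "T \<in> \<T> \<Longrightarrow> convex T"
  using simplices convex_simplex by blast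

lemma interior_simplex_nonempty: "T \<in> \<T> \<Longrightarrow> interior T \<noteq> {}"
proof -
  assume T: "T \<in> \<T>"
  have d: "aff_dim T = int CARD('n)" using aff_dim_simplex[OF simplices[OF T]] .
  then have "T \<noteq> {}" by auto
  then have "rel_interior T \<noteq> {}" using rel_interior_eq_empty convex_simplex'[OF T] by blast
  then show ?thesis using d by (simp add: interior_rel_interior_gen)
qed

text \<open>Here regularity of the domain enters: the elements cover only the closure, and
  \<open>\<Omega> = interior (closure \<Omega>)\<close> excludes slits running through an
  element.\<close>

lemma interior_simplex_subset: "T \<in> \<T> \<Longrightarrow> interior T \<subseteq> \<Omega>"
  using Union_\<T> regular_\<Omega> interior_mono[of T "closure \<Omega>"] by blast

text \<open>The intersection of two elements is a face of each. A proper face misses the interior,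
  so a common interior point forces inclusion in both directions.\<close>

lemma interior_simplex_eq:
  assumes "S \<in> \<T>" "T \<in> \<T>" "x \<in> interior S" "x \<in> interior T"
  shows "S = T"
proof -
  have *: "S \<subseteq> T" if "S \<in> \<T>" "T \<in> \<T>" "x \<in> interior S" "x \<in> interior T" for S T
  proof (rule ccontr)
    assume "\<not> S \<subseteq> T"
    then have "S \<inter> T \<noteq> S" by auto
    moreover have "S \<inter> T face_of S" using triangulation that by (auto simp: triangulation_def)
    ultimately have "S \<inter> T \<inter> interior S = {}" by (rule face_of_disjoint_interior[rotated])
    then show False using that interior_subset by blast
  qed
  show ?thesis using *[of S T] *[of T S] assms by blast
qed

definition U :: "(real^'n) set" where "U = (\<Union>T\<in>\<T>. interior T)"

lemma U_subset: "U \<subseteq> \<Omega>"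
  using interior_simplex_subset by (auto simp: U_def)

text \<open>The exceptional set lies in finitely many frontiers of convex sets, which are
  negligible.\<close>

lemma AE_U: "AE x in lebesgue. x \<in> \<Omega> \<longrightarrow> x \<in> U"
proof -
  have "negligible (\<Union>T\<in>\<T>. frontier T)"
    using finite_\<T> convex_simplex' by (intro negligible_Union) (auto intro: negligible_convex_frontier)
  moreover have "\<Omega> - U \<subseteq> (\<Union>T\<in>\<T>. frontier T)"
  proof
    fix x assume x: "x \<in> \<Omega> - U"
    then obtain T where "T \<in> \<T>" "x \<in> T" using Union_\<T> closure_subset[of \<Omega>] by blast
    then show "x \<in> (\<Union>T\<in>\<T>. frontier T)"
      using x closure_subset[of T] by (auto simp: U_def frontier_def)
  qed
  ultimately have "\<Omega> - U \<in> null_sets lebesgue"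
    using negligible_subset negligible_iff_null_sets by blast
  from AE_not_in[OF this] show ?thesis by eventually_elim auto
qed

lemma AE_U_imp:
  assumes "\<And>x. x \<in> U \<Longrightarrow> P x" shows "AE x in lebesgue. x \<in> \<Omega> \<longrightarrow> P x"
  using AE_U by eventually_elim (use assms in auto)

lemma sets_\<Omega>: "\<Omega> \<in> sets lebesgue"
  using open_\<Omega> by auto

lemma emeasure_\<Omega>: "emeasure lebesgue \<Omega> < \<infinity>"
  using emeasure_bounded_finite[OF bounded_\<Omega>] open_\<Omega> by auto

lemmas integrable_ess_bounded = ess_bounded_set_integrable[OF _ sets_\<Omega> emeasure_\<Omega>]

lemma V1_affine:
  assumes "u \<in> V" "T \<in> \<T>"
  obtains a b where "\<And>x. x \<in> T \<Longrightarrow> u x = a \<bullet> x + b"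
proof -
  have "\<exists>a b. \<forall>x\<in>T. u x = a \<bullet> x + b" using assms by (simp add: V1_def)
  then show ?thesis using that by (elim exE) blast
qed

lemma subspace_V1: "subspace V"
  unfolding subspace_def
proof (intro conjI ballI allI)
  show "0 \<in> V" by (auto simp: V1_def intro!: exI[of _ 0])
next
  fix u v assume u: "u \<in> V" and v: "v \<in> V"
  have "\<exists>a b. \<forall>x\<in>T. (u + v) x = a \<bullet> x + b" if T: "T \<in> \<T>" for T
  proof -
    obtain a b where "\<And>x. x \<in> T \<Longrightarrow> u x = a \<bullet> x + b" by (rule V1_affine[OF u T]) blast
    moreover obtain a' b' where "\<And>x. x \<in> T \<Longrightarrow> v x = a' \<bullet> x + b'" by (rule V1_affine[OF v T]) blast
    ultimately show ?thesis by (intro exI[of _ "a + a'"] exI[of _ "b + b'"]) (auto simp: inner_add_left)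
  qed
  then show "u + v \<in> V" using u v by (auto simp: V1_def)
next
  fix c :: real and u assume u: "u \<in> V"
  have "\<exists>a b. \<forall>x\<in>T. (c *\<^sub>R u) x = a \<bullet> x + b" if T: "T \<in> \<T>" for T
  proof -
    obtain a b where "\<And>x. x \<in> T \<Longrightarrow> u x = a \<bullet> x + b" by (rule V1_affine[OF u T]) blast
    then show ?thesis by (intro exI[of _ "c *\<^sub>R a"] exI[of _ "c * b"]) (auto simp: algebra_simps)
  qed
  then show "c *\<^sub>R u \<in> V" using u by (auto simp: V1_def)
qed

lemma subspace_V0v: "subspace W"
  unfolding subspace_def
proof (intro conjI ballI allI)
  show "0 \<in> W" by (auto simp: V0v_def intro!: exI[of _ 0])
next
  fix p q assume "p \<in> W" "q \<in> W"
  then obtain c d where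
    "\<forall>x. (\<forall>T\<in>\<T>. x \<in> interior T \<longrightarrow> p x = c T) \<and> ((\<forall>T\<in>\<T>. x \<notin> interior T) \<longrightarrow> p x = 0)"
    "\<forall>x. (\<forall>T\<in>\<T>. x \<in> interior T \<longrightarrow> q x = d T) \<and> ((\<forall>T\<in>\<T>. x \<notin> interior T) \<longrightarrow> q x = 0)"
    by (auto simp: V0v_def)
  then show "p + q \<in> W" by (auto simp: V0v_def intro!: exI[of _ "\<lambda>T. c T + d T"])
next
  fix t p assume "p \<in> W"
  then obtain c where
    "\<forall>x. (\<forall>T\<in>\<T>. x \<in> interior T \<longrightarrow> p x = c T) \<and> ((\<forall>T\<in>\<T>. x \<notin> interior T) \<longrightarrow> p x = 0)"
    by (auto simp: V0v_def)
  then show "t *\<^sub>R p \<in> W" by (auto simp: V0v_def intro!: exI[of _ "\<lambda>T. t *\<^sub>R c T"])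
qed

lemma V0v_representation:
  assumes "p \<in> W"
  obtains c where "\<And>x. p x = (\<Sum>T\<in>\<T>. indicat_real (interior T) x *\<^sub>R c T)"
proof -
  obtain c where c: "\<And>x T. T \<in> \<T> \<Longrightarrow> x \<in> interior T \<Longrightarrow> p x = c T"
    "\<And>x. (\<forall>T\<in>\<T>. x \<notin> interior T) \<Longrightarrow> p x = 0"
    using assms unfolding V0v_def by blast
  have "p x = (\<Sum>T\<in>\<T>. indicat_real (interior T) x *\<^sub>R c T)" for x
  proof (cases "\<exists>T\<in>\<T>. x \<in> interior T")
    case True
    then obtain T where T: "T \<in> \<T>" "x \<in> interior T" by blast
    have "(\<Sum>S\<in>\<T>. indicator (interior S) x *\<^sub>R c S) = (\<Sum>S\<in>\<T>. if S = T then c T else 0)"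
      using interior_simplex_eq T by (intro sum.cong) (auto simp: indicator_def)
    then show ?thesis using T c(1) finite_\<T> by simp
  next
    case False
    then show ?thesis using c(2) by (auto simp: indicator_def intro!: sum.neutral)
  qed
  then show ?thesis using that by blast
qed

lemma V0v_ess_bounded:
  assumes "p \<in> W" shows "bdd\<Omega> (\<lambda>x. p x $ j)"
proof -
  obtain c where c: "\<And>x. p x = (\<Sum>T\<in>\<T>. indicat_real (interior T) x *\<^sub>R c T)"
    by (rule V0v_representation[OF assms]) blast
  have "bdd\<Omega> (indicator (interior T) :: _ \<Rightarrow> real)" for T
    by (intro ess_boundedI[where C=1])
      (auto simp: set_borel_measurable_def open_\<Omega>
        intro!: borel_measurable_times borel_measurable_indicator)
  then have "bdd\<Omega> (\<lambda>x. \<Sum>T\<in>\<T>. indicator (interior T) x * c T $ j)"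
    using sets_\<Omega> by (intro ess_bounded_sum ess_bounded_mult ess_bounded_const) auto
  then show ?thesis by (simp add: c)
qed

lemma V1_continuous: "u \<in> V \<Longrightarrow> continuous_on (closure \<Omega>) u"
proof -
  assume u: "u \<in> V"
  have "continuous_on (\<Union>T\<in>\<T>. T) u"
  proof (rule continuous_on_closed_Union)
    fix T assume T: "T \<in> \<T>"
    then show "closed T" using compact_simplex' compact_imp_closed by blast
    obtain a b where ab: "\<And>x. x \<in> T \<Longrightarrow> u x = a \<bullet> x + b" by (rule V1_affine[OF u T]) blast
    have "continuous_on T (\<lambda>x. a \<bullet> x + b)" by (intro continuous_intros)
    then show "continuous_on T u" using continuous_on_cong[of T T u "\<lambda>x. a \<bullet> x + b"] ab by simp
  qed (rule finite_\<T>)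
  then show ?thesis using Union_\<T> by simp
qed

lemma compact_closure_\<Omega>: "compact (closure \<Omega>)"
  using bounded_\<Omega> by simp

lemma V1_zero_outside: "u \<in> V \<Longrightarrow> x \<notin> closure \<Omega> \<Longrightarrow> u x = 0"
  by (auto simp: V1_def)

lemma V1_bounded:
  assumes "u \<in> V" obtains C where "0 \<le> C" "\<And>x. \<bar>u x\<bar> \<le> C"
proof -
  have "bounded (u ` closure \<Omega>)"
    using compact_continuous_image[OF V1_continuous[OF assms] compact_closure_\<Omega>] compact_imp_bounded
    by blast
  then obtain C where C: "\<And>x. x \<in> closure \<Omega> \<Longrightarrow> \<bar>u x\<bar> \<le> C" by (auto simp: bounded_iff)
  have "\<bar>u x\<bar> \<le> max C 0" for x
    using C[of x] V1_zero_outside[OF assms, of x] by (cases "x \<in> closure \<Omega>") auto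
  then show ?thesis by (rule that[rotated]) simp
qed

lemma V1_borel: "u \<in> V \<Longrightarrow> u \<in> borel_measurable borel"
proof -
  assume u: "u \<in> V"
  have "(\<lambda>x. indicator (closure \<Omega>) x *\<^sub>R u x) \<in> borel_measurable borel"
    using V1_continuous[OF u] by (intro borel_measurable_continuous_on_indicator) auto
  moreover have "(\<lambda>x. indicator (closure \<Omega>) x *\<^sub>R u x) = u"
    using V1_zero_outside[OF u] by (auto simp: fun_eq_iff indicator_def)
  ultimately show ?thesis by simp
qed

lemma V1_ess_bounded:
  assumes "u \<in> V" "A \<in> sets \<mu>" "sets borel \<subseteq> sets \<mu>" "space \<mu> = UNIV"
  shows "ess_bounded \<mu> A u"
proof -
  obtain C where C: "\<And>x. \<bar>u x\<bar> \<le> C" using V1_bounded[OF assms(1)] by blast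
  have "u \<in> borel_measurable \<mu>"
    using V1_borel[OF assms(1)] assms(3,4) by (auto simp: measurable_def)
  then show ?thesis using C assms(2)
    by (intro ess_boundedI[where C=C]) (auto simp: set_borel_measurable_def)
qed

lemma V1_ess_bounded_\<Omega>: "u \<in> V \<Longrightarrow> bdd\<Omega> u"
  by (rule V1_ess_bounded[OF _ sets_\<Omega>]) auto

text \<open>The representative of the gradient that is zero on the skeleton. It belongs to
  \<open>V0v\<close> and is linear in \<open>u\<close> at every point, whereas \<open>grad\<close>
  may fail to be additive where a summand is not differentiable.\<close>

definition pgrad :: "(real^'n \<Rightarrow> real) \<Rightarrow> real^'n \<Rightarrow> real^'n" where
  "pgrad u x = (if x \<in> U then grad u x else 0)"

lemma V1_affine_grad:
  assumes "T \<in> \<T>" "\<And>x. x \<in> T \<Longrightarrow> u x = a \<bullet> x + b" "x \<in> interior T"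
  shows "GDERIV u x :> a"
proof -
  have "((\<lambda>x. a \<bullet> x + b) has_derivative (\<lambda>h. h \<bullet> a)) (at x)"
    by (auto intro!: derivative_eq_intros simp: inner_commute)
  then show ?thesis unfolding gderiv_def
    by (rule has_derivative_transform_within_open[OF _ open_interior assms(3)])
      (use assms(2) interior_subset in force)
qed

lemma V1_GDERIV:
  assumes "u \<in> V" "x \<in> U"
  shows "GDERIV u x :> pgrad u x"
proof -
  obtain T where T: "T \<in> \<T>" "x \<in> interior T" using assms by (auto simp: U_def)
  obtain a b where ab: "\<And>x. x \<in> T \<Longrightarrow> u x = a \<bullet> x + b" by (rule V1_affine[OF assms(1) T(1)]) blast
  have "GDERIV u x :> a" by (rule V1_affine_grad[OF T(1) ab T(2)])
  moreover from this have "pgrad u x = a" using grad_eq assms(2) by (simp add: pgrad_def)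
  ultimately show ?thesis by simp
qed

lemma pgrad_V0v:
  assumes "u \<in> V" shows "pgrad u \<in> W"
proof -
  have "\<exists>a. \<forall>x\<in>interior T. grad u x = a" if T: "T \<in> \<T>" for T
  proof -
    obtain a b where ab: "\<And>x. x \<in> T \<Longrightarrow> u x = a \<bullet> x + b" by (rule V1_affine[OF assms T]) blast
    then show ?thesis by (intro exI[of _ a] ballI grad_eq V1_affine_grad[OF T])
  qed
  then obtain c where "\<And>T x. T \<in> \<T> \<Longrightarrow> x \<in> interior T \<Longrightarrow> grad u x = c T" by metis
  then have "\<forall>x. (\<forall>T\<in>\<T>. x \<in> interior T \<longrightarrow> pgrad u x = c T) \<and>
      ((\<forall>T\<in>\<T>. x \<notin> interior T) \<longrightarrow> pgrad u x = 0)"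
    unfolding pgrad_def U_def by auto
  then show ?thesis unfolding V0v_def by blast
qed

lemma pgrad_add:
  assumes "u \<in> V" "v \<in> V" shows "pgrad (u + v) = pgrad u + pgrad v"
proof
  fix x
  show "pgrad (u + v) x = (pgrad u + pgrad v) x"
  proof (cases "x \<in> U")
    case True
    then have "grad (\<lambda>x. u x + v x) x = pgrad u x + pgrad v x"
      by (intro grad_eq GDERIV_add V1_GDERIV assms)
    then show ?thesis using True by (simp add: pgrad_def plus_fun_def)
  qed (simp add: pgrad_def)
qed

lemma pgrad_scale:
  assumes "u \<in> V" shows "pgrad (c *\<^sub>R u) = c *\<^sub>R pgrad u"
proof
  fix x
  show "pgrad (c *\<^sub>R u) x = (c *\<^sub>R pgrad u) x"
  proof (cases "x \<in> U")
    case True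
    then have "GDERIV (\<lambda>x. c * u x) x :> c *\<^sub>R pgrad u x + u x *\<^sub>R 0"
      by (intro GDERIV_mult V1_GDERIV assms GDERIV_const)
    from grad_eq[OF this] show ?thesis using True by (simp add: pgrad_def scaleR_fun_def)
  qed (simp add: pgrad_def)
qed

lemma grad_ess_bounded:
  assumes "u \<in> V" shows "bdd\<Omega> (\<lambda>x. grad u x $ j)"
  by (rule ess_bounded_cong_AE[OF V0v_ess_bounded[OF pgrad_V0v[OF assms], of j]])
    (rule AE_U_imp, simp add: pgrad_def)

lemma vipO_grad:
  assumes "u \<in> V" "p \<in> W"
  shows "vip (grad u) p = vip (pgrad u) p"
proof -
  have "bdd\<Omega> (\<lambda>x. grad u x \<bullet> p x)"
    by (intro ess_bounded_inner sets_\<Omega> grad_ess_bounded V0v_ess_bounded assms)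
  then show ?thesis unfolding vipO_def ess_bounded_def
    by (intro set_integral_lebesgue_cong_AE AE_U_imp) (auto simp: pgrad_def)
qed

section \<open>Inner products on the discrete spaces\<close>

lemma vipO_add:
  assumes "\<And>j. bdd\<Omega> (\<lambda>x. p x $ j)" "\<And>j. bdd\<Omega> (\<lambda>x. q x $ j)"
    "\<And>j. bdd\<Omega> (\<lambda>x. r x $ j)"
  shows "vip p (q + r) = vip p q + vip p r"
  unfolding vipO_def plus_fun_apply inner_add_right
  by (intro set_integral_add integrable_ess_bounded ess_bounded_inner sets_\<Omega> assms)

lemma vipO_scale: "vip p (c *\<^sub>R q) = c * vip p q"
  unfolding vipO_def scaleR_fun_apply inner_scaleR_right by simp

lemma vipO_commute: "vip p q = vip q p"
  unfolding vipO_def by (simp add: inner_commute)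

lemma ipO_add:
  assumes "bdd\<Omega> f" "bdd\<Omega> g" "bdd\<Omega> h"
  shows "ip f (g + h) = ip f g + ip f h"
  unfolding ipO_def plus_fun_apply distrib_left
  by (intro set_integral_add integrable_ess_bounded ess_bounded_mult assms)

lemma ipO_scale: "ip f (c *\<^sub>R g) = c * ip f g"
  unfolding ipO_def by (simp add: mult.left_commute)

lemma ipO_commute: "ip f g = ip g f"
  unfolding ipO_def by (simp add: mult.commute)

lemma bilinear_ipO: "bilinear_on V ip"
  by (intro bilinear_on_symI[OF ipO_commute] subspace_V1 linear_onI ipO_add ipO_scale
      V1_ess_bounded_\<Omega>)

lemma bilinear_vipO: "bilinear_on W vip"
  by (intro bilinear_on_symI[OF vipO_commute] subspace_V0v linear_onI vipO_add vipO_scale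
      V0v_ess_bounded)

lemma ipO_nonneg: "0 \<le> ip f f"
  unfolding ipO_def set_lebesgue_integral_def by (intro Bochner_Integration.integral_nonneg) auto

lemma vipO_nonneg: "0 \<le> vip f f"
  unfolding vipO_def set_lebesgue_integral_def by (intro Bochner_Integration.integral_nonneg) auto

lemma AE_zero_of_integral:
  assumes "bdd\<Omega> g" "\<And>x. 0 \<le> g x" "(LINT x:\<Omega>|lebesgue. g x) = 0"
  shows "AE x in lebesgue. x \<in> \<Omega> \<longrightarrow> g x = 0"
proof -
  have "integrable lebesgue (\<lambda>x. indicator \<Omega> x *\<^sub>R g x)"
    using integrable_ess_bounded[OF assms(1)] by (simp add: set_integrable_def)
  then have "AE x in lebesgue. indicator \<Omega> x *\<^sub>R g x = 0"
    using assms(2,3) by (subst integral_nonneg_eq_0_iff_AE[symmetric])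
      (auto simp: set_lebesgue_integral_def)
  then show ?thesis by eventually_elim (auto simp: indicator_def split: if_splits)
qed

lemma AE_open_exists:
  assumes "AE x in lebesgue. x \<in> \<Omega> \<longrightarrow> P x" "open S" "S \<noteq> {}" "S \<subseteq> \<Omega>"
  shows "\<exists>x\<in>S. P x"
proof (rule ccontr)
  assume "\<not> ?thesis"
  then have not: "x \<in> S \<Longrightarrow> \<not> P x" for x by blast
  have "AE x in lebesgue. x \<notin> S"
    using assms(1) by eventually_elim (use assms(4) not in blast)
  then have "S \<in> null_sets lebesgue" by (simp add: completion.null_sets_iff_AE)
  then have "negligible S" by (simp add: negligible_iff_null_sets)
  then show False using open_not_negligible assms by blast
qed

text \<open>Definiteness on functions rather than on classes: continuity turns zero a.e. into zero
  on the open set, hence on its closure, and outside the closure members of \<open>V1\<close> are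
  zero by normalisation.\<close>

lemma ipO_pos:
  assumes u: "u \<in> V" and "u \<noteq> 0"
  shows "0 < ip u u"
proof (rule ccontr)
  assume "\<not> 0 < ip u u"
  then have "ip u u = 0" using ipO_nonneg[of u] by simp
  then have ae: "AE x in lebesgue. x \<in> \<Omega> \<longrightarrow> u x * u x = 0"
    unfolding ipO_def by (intro AE_zero_of_integral ess_bounded_mult V1_ess_bounded_\<Omega> u) auto
  have "u x = 0" if "x \<in> \<Omega>" for x
  proof (rule ccontr)
    assume x: "u x \<noteq> 0"
    have "continuous_on \<Omega> u" using V1_continuous[OF u] closure_subset continuous_on_subset by blast
    then have "open (\<Omega> \<inter> u -` (- {0}))" using open_\<Omega> by (intro continuous_open_preimage) auto
    from AE_open_exists[OF ae this] show False using x that by auto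
  qed
  then have "u x = 0" if "x \<in> closure \<Omega>" for x
    using continuous_constant_on_closure[OF V1_continuous[OF u], of 0] that by blast
  then show False using assms(2) V1_zero_outside[OF u] by (auto simp: fun_eq_iff)
qed

lemma vipO_pos:
  assumes p: "p \<in> W" and "p \<noteq> 0"
  shows "0 < vip p p"
proof (rule ccontr)
  assume "\<not> 0 < vip p p"
  then have "vip p p = 0" using vipO_nonneg[of p] by simp
  then have ae: "AE x in lebesgue. x \<in> \<Omega> \<longrightarrow> p x \<bullet> p x = 0"
    unfolding vipO_def by (intro AE_zero_of_integral ess_bounded_inner V0v_ess_bounded sets_\<Omega> p) auto
  obtain c where c: "\<And>x T. T \<in> \<T> \<Longrightarrow> x \<in> interior T \<Longrightarrow> p x = c T"
    "\<And>x. (\<forall>T\<in>\<T>. x \<notin> interior T) \<Longrightarrow> p x = 0"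
    using p unfolding V0v_def by blast
  have "c T = 0" if T: "T \<in> \<T>" for T
    using AE_open_exists[OF ae open_interior interior_simplex_nonempty[OF T]
        interior_simplex_subset[OF T]] c(1)[OF T] by auto
  then have "p x = 0" for x using c by metis
  then show False using assms(2) by (auto simp: fun_eq_iff)
qed

end

section \<open>Integration by parts\<close>

lemma borel_imp_lebesgue_measurable:
  fixes f :: "'a::euclidean_space \<Rightarrow> real"
  assumes "f \<in> borel_measurable borel" shows "f \<in> borel_measurable lebesgue"
  using assms by (intro measurable_completion) simp

lemma integral_lebesgue_translation:
  fixes F :: "'a::euclidean_space \<Rightarrow> real"
  assumes "F \<in> borel_measurable borel"
  shows "(LINT x|lebesgue. F (c + x)) = (LINT x|lebesgue. F x)"
proof -
  note assms[measurable]
  have "(LINT x|lebesgue. F (c + x)) = (LINT x|lborel. F (c + x))"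
    by (intro integral_completion) measurable
  also have "\<dots> = (LINT x|distr lborel borel ((+) c). F x)"
    using assms by (subst integral_distr) auto
  also have "\<dots> = (LINT x|lebesgue. F x)"
    using assms by (simp add: lborel_distr_plus integral_completion)
  finally show ?thesis .
qed

lemma GDERIV_difference_quotient:
  fixes g :: "'a::real_inner \<Rightarrow> real"
  assumes "GDERIV g x :> D" "t \<longlonglongrightarrow> 0" "\<And>k. t k \<noteq> 0"
  shows "(\<lambda>k::nat. (g (x + t k *\<^sub>R v) - g x) / t k) \<longlonglongrightarrow> D \<bullet> v"
proof -
  have "(g has_derivative (\<lambda>h. h \<bullet> D)) (at (x + 0 *\<^sub>R v))"
    using assms(1) by (simp add: gderiv_def)
  moreover have "((\<lambda>s. x + s *\<^sub>R v) has_derivative (\<lambda>s. s *\<^sub>R v)) (at (0::real))"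
    by (auto intro!: derivative_eq_intros)
  ultimately have "((\<lambda>s. g (x + s *\<^sub>R v)) has_derivative (\<lambda>s. (s *\<^sub>R v) \<bullet> D)) (at (0::real))"
    by (rule has_derivative_compose[rotated])
  then have "((\<lambda>s. g (x + s *\<^sub>R v)) has_field_derivative (D \<bullet> v)) (at (0::real))"
    by (rule has_derivative_imp_has_field_derivative) (simp add: inner_commute)
  then have "((\<lambda>s. (g (x + s *\<^sub>R v) - g x) / s) \<longlongrightarrow> D \<bullet> v) (at 0)"
    by (simp add: DERIV_def)
  moreover have "filterlim t (at 0) sequentially"
    using assms(2,3) by (simp add: filterlim_at)
  ultimately show ?thesis by (rule filterlim_compose)
qed

section \<open>Continuously differentiable functions and compact supports\<close>

definition C1fun :: "(real^'n \<Rightarrow> real) \<Rightarrow> bool" where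
  "C1fun \<phi> \<longleftrightarrow> (\<forall>x. \<exists>D. GDERIV \<phi> x :> D) \<and> continuous_on UNIV (grad \<phi>)"

lemma C1fun_GDERIV: "C1fun \<phi> \<Longrightarrow> GDERIV \<phi> x :> grad \<phi> x"
  unfolding C1fun_def using grad_eq by metis

lemma C1funI:
  assumes "\<And>x. GDERIV \<phi> x :> D x" "continuous_on UNIV D"
  shows "C1fun \<phi>"
proof -
  have "grad \<phi> = D" using grad_eq[OF assms(1)] by (rule ext)
  then show ?thesis using assms by (auto simp: C1fun_def)
qed

lemma C1fun_continuous: "C1fun \<phi> \<Longrightarrow> continuous_on UNIV \<phi>"
  using C1fun_GDERIV has_derivative_continuous unfolding gderiv_def
  by (intro continuous_at_imp_continuous_on ballI) blast

lemma C1fun_const: "C1fun (\<lambda>x. c)"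
  by (rule C1funI[OF GDERIV_const]) simp

lemma C1fun_mult:
  assumes "C1fun f" "C1fun g" shows "C1fun (\<lambda>x. f x * g x)"
  by (rule C1funI[OF GDERIV_mult[OF C1fun_GDERIV C1fun_GDERIV]])
    (use assms in \<open>auto intro!: continuous_intros C1fun_continuous simp: C1fun_def\<close>)

lemma C1fun_add:
  assumes "C1fun f" "C1fun g" shows "C1fun (\<lambda>x. f x + g x)"
  by (rule C1funI[OF GDERIV_add[OF C1fun_GDERIV C1fun_GDERIV]])
    (use assms in \<open>auto intro!: continuous_intros simp: C1fun_def\<close>)

lemma C1fun_compose:
  assumes "C1fun f" "\<And>y. (g has_field_derivative g' y) (at y)" "continuous_on UNIV g'"
  shows "C1fun (\<lambda>x. g (f x))"
  by (rule C1funI[OF GDERIV_DERIV_compose[OF C1fun_GDERIV assms(2)]])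
    (use assms(1) in \<open>auto intro!: continuous_on_scaleR simp: C1fun_def
      continuous_on_compose2[OF assms(3) C1fun_continuous[OF assms(1)]]\<close>)

lemma C1fun_prod:
  "finite I \<Longrightarrow> (\<And>i. i \<in> I \<Longrightarrow> C1fun (f i)) \<Longrightarrow> C1fun (\<lambda>x. \<Prod>i\<in>I. f i x)"
  by (induction I rule: finite_induct) (auto intro: C1fun_const C1fun_mult)

lemma C1c_iff: "C1c \<Omega> \<phi> \<longleftrightarrow> C1fun \<phi> \<and> compact (closure {x. \<phi> x \<noteq> 0}) \<and> closure {x. \<phi> x \<noteq> 0} \<subseteq> \<Omega>"
  by (auto simp: C1c_def C1fun_def)

lemma C1cI:
  assumes "C1fun \<phi>" "compact K" "K \<subseteq> \<Omega>" "\<And>x. x \<notin> K \<Longrightarrow> \<phi> x = 0"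
  shows "C1c \<Omega> \<phi>"
proof -
  have "closure {x. \<phi> x \<noteq> 0} \<subseteq> K"
    using assms by (intro closure_minimal) (auto intro: compact_imp_closed)
  then show ?thesis
    using assms bounded_subset[OF compact_imp_bounded[OF assms(2)]]
    by (auto simp: C1c_iff compact_eq_bounded_closed)
qed

lemma C1c_support:
  assumes "C1c \<Omega> \<phi>"
  obtains K where "compact K" "K \<subseteq> \<Omega>" "\<And>x. x \<notin> K \<Longrightarrow> \<phi> x = 0"
  using assms closure_subset[of "{x. \<phi> x \<noteq> 0}"] by (intro that[of "closure {x. \<phi> x \<noteq> 0}"]) (auto simp: C1c_iff)

lemma C1c_add:
  assumes "C1c \<Omega> f" "C1c \<Omega> g" shows "C1c \<Omega> (\<lambda>x. f x + g x)"
proof -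
  obtain K where K: "compact K" "K \<subseteq> \<Omega>" "\<And>x. x \<notin> K \<Longrightarrow> f x = 0"
    using C1c_support[OF assms(1)] by metis
  obtain L where L: "compact L" "L \<subseteq> \<Omega>" "\<And>x. x \<notin> L \<Longrightarrow> g x = 0"
    using C1c_support[OF assms(2)] by metis
  show ?thesis
    by (rule C1cI[of _ "K \<union> L"])
      (use K L assms in \<open>auto simp: C1c_iff intro: C1fun_add\<close>)
qed

lemma C1c_zero: "C1c \<Omega> (\<lambda>x. 0)"
  by (rule C1cI[of _ "{}"]) (auto intro: C1fun_const)

lemma C1c_cmult:
  assumes "C1c \<Omega> f" shows "C1c \<Omega> (\<lambda>x. c * f x)"
proof -
  obtain K where K: "compact K" "K \<subseteq> \<Omega>" "\<And>x. x \<notin> K \<Longrightarrow> f x = 0"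
    using C1c_support[OF assms(1)] by metis
  show ?thesis
    by (rule C1cI[of _ K]) (use K assms in \<open>auto simp: C1c_iff intro: C1fun_mult[OF C1fun_const]\<close>)
qed

lemma C1c_sum:
  "(\<And>i. i \<in> I \<Longrightarrow> C1c \<Omega> (f i)) \<Longrightarrow> C1c \<Omega> (\<lambda>x. \<Sum>i\<in>I. f i x)"
  by (induction I rule: infinite_finite_induct) (auto intro: C1c_zero C1c_add)

lemma C1c_grad_outside:
  assumes "compact K" "\<And>x. x \<notin> K \<Longrightarrow> \<phi> x = 0" "x \<notin> K"
  shows "grad \<phi> x = 0"
proof (rule grad_eq)
  have "((\<lambda>x. 0::real) has_derivative (\<lambda>h. h \<bullet> 0)) (at x)" by simp
  then show "GDERIV \<phi> x :> 0" unfolding gderiv_def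
    by (rule has_derivative_transform_within_open[where s="- K"])
      (use compact_imp_closed[OF assms(1)] assms(2,3) in auto)
qed

lemma continuous_compact_support_bounded:
  fixes g :: "'a::topological_space \<Rightarrow> 'b::real_normed_vector"
  assumes "continuous_on UNIV g" "compact K" "\<And>x. x \<notin> K \<Longrightarrow> g x = 0"
  obtains C where "0 \<le> C" "\<And>x. norm (g x) \<le> C"
proof -
  have "bounded (g ` K)"
    by (intro compact_imp_bounded compact_continuous_image assms(2)
        continuous_on_subset[OF assms(1)]) auto
  then obtain C where C: "\<And>x. x \<in> K \<Longrightarrow> norm (g x) \<le> C" by (auto simp: bounded_iff)
  have "norm (g x) \<le> max C 0" for x using C[of x] assms(3)[of x] by (cases "x \<in> K") auto
  then show ?thesis by (rule that[rotated]) simp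
qed

lemma C1c_grad_bounded:
  assumes "C1c \<Omega> \<phi>" obtains C where "0 \<le> C" "\<And>x. norm (grad \<phi> x) \<le> C"
proof -
  obtain K where K: "compact K" "K \<subseteq> \<Omega>" "\<And>x. x \<notin> K \<Longrightarrow> \<phi> x = 0"
    using C1c_support[OF assms(1)] by metis
  show ?thesis
    by (rule continuous_compact_support_bounded[of "grad \<phi>" K, OF _ K(1) C1c_grad_outside[OF K(1,3)]])
      (use assms that in \<open>auto simp: C1c_def\<close>)
qed

lemma C1c_bounded:
  assumes "C1c \<Omega> \<phi>" obtains C where "0 \<le> C" "\<And>x. \<bar>\<phi> x\<bar> \<le> C"
proof -
  obtain K where K: "compact K" "K \<subseteq> \<Omega>" "\<And>x. x \<notin> K \<Longrightarrow> \<phi> x = 0"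
    using C1c_support[OF assms(1)] by metis
  show ?thesis
    by (rule continuous_compact_support_bounded[of \<phi> K, OF _ K(1,3)])
      (use assms that C1fun_continuous in \<open>auto simp: C1c_iff\<close>)
qed

lemma C1fun_lipschitz:
  assumes "C1fun \<phi>" "\<And>x. norm (grad \<phi> x) \<le> C"
  shows "\<bar>\<phi> x - \<phi> y\<bar> \<le> C * norm (x - y)"
proof -
  have "norm (\<phi> x - \<phi> y) \<le> C * norm (x - y)"
  proof (rule differentiable_bound[of UNIV \<phi> "\<lambda>x h. h \<bullet> grad \<phi> x"])
    show "(\<phi> has_derivative (\<lambda>h. h \<bullet> grad \<phi> x)) (at x within UNIV)" for x
      using C1fun_GDERIV[OF assms(1)] by (simp add: gderiv_def)
    show "onorm (\<lambda>h. h \<bullet> grad \<phi> x) \<le> C" for x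
    proof (rule onorm_le)
      fix h
      have "norm (h \<bullet> grad \<phi> x) \<le> norm h * norm (grad \<phi> x)" by (simp add: Cauchy_Schwarz_ineq2)
      also have "\<dots> \<le> C * norm h"
        using mult_left_mono[OF assms(2), of "norm h" x] by (simp add: mult.commute)
      finally show "norm (h \<bullet> grad \<phi> x) \<le> C * norm h" .
    qed
  qed auto
  then show ?thesis by simp
qed

section \<open>Integration by parts for piecewise linear functions\<close>

context mesh
begin

lemma C1c_ess_bounded:
  assumes "C1c \<Omega> \<phi>"
  shows "bdd\<Omega> \<phi>" "bdd\<Omega> (\<lambda>x. grad \<phi> x $ i)"
proof -
  obtain C where C: "\<And>x. \<bar>\<phi> x\<bar> \<le> C" using C1c_bounded[OF assms] by metis
  obtain D where D: "\<And>x. norm (grad \<phi> x) \<le> D" using C1c_grad_bounded[OF assms] by metis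
  have "continuous_on UNIV \<phi>" "continuous_on UNIV (\<lambda>x. grad \<phi> x $ i)"
    using assms C1fun_continuous by (auto simp: C1c_iff C1fun_def intro!: continuous_intros)
  then have m: "\<phi> \<in> borel_measurable lebesgue" "(\<lambda>x. grad \<phi> x $ i) \<in> borel_measurable lebesgue"
    by (simp_all add: borel_imp_lebesgue_measurable borel_measurable_continuous_onI)
  show "bdd\<Omega> \<phi>"
    by (rule ess_boundedI[OF _ C]) (use m sets_\<Omega> in \<open>auto simp: set_borel_measurable_def\<close>)
  show "bdd\<Omega> (\<lambda>x. grad \<phi> x $ i)"
  proof (rule ess_boundedI)
    show "\<bar>grad \<phi> x $ i\<bar> \<le> D" for x
      using D[of x] component_le_norm_cart[of "grad \<phi> x" i] by simp
  qed (use m sets_\<Omega> in \<open>auto simp: set_borel_measurable_def\<close>)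
qed

text \<open>The domain may be nonconvex, so the slopes of the affine pieces control differences only
  along segments that stay in the closure.\<close>

lemma V1_segment_lipschitz:
  assumes u: "u \<in> V"
  obtains L where "0 \<le> L" "\<And>x y. closed_segment x y \<subseteq> closure \<Omega> \<Longrightarrow> \<bar>u y - u x\<bar> \<le> L * norm (y - x)"
proof -
  have "\<forall>T\<in>\<T>. \<exists>a b. \<forall>x\<in>T. u x = a \<bullet> x + b" using u by (simp add: V1_def)
  then obtain a b where ab: "\<And>T x. T \<in> \<T> \<Longrightarrow> x \<in> T \<Longrightarrow> u x = a T \<bullet> x + b T" by metis
  define L where "L = (\<Sum>T\<in>\<T>. norm (a T))"
  have aL: "norm (a T) \<le> L" if "T \<in> \<T>" for T
    unfolding L_def using finite_\<T> that by (intro member_le_sum) auto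
  have L0: "0 \<le> L" by (auto simp: L_def intro: sum_nonneg)
  have "\<bar>u y - u x\<bar> \<le> L * norm (y - x)" if seg: "closed_segment x y \<subseteq> closure \<Omega>" for x y
  proof -
    define \<gamma> where "\<gamma> s = x + s *\<^sub>R (y - x)" for s :: real
    \<comment> \<open>The closed preimages of the elements cover the parameter interval and
      \<open>u\<close> is affine along each; Lipschitz bounds with one constant on finitely many
      closed pieces glue on an interval.\<close>
    have lip: "(L * norm (y - x))-lipschitz_on {0..1} (\<lambda>s. u (\<gamma> s))"
    proof (rule lipschitz_on_closed_Union[where I=\<T> and U="\<lambda>T. \<gamma> -` T"])
      fix T assume T: "T \<in> \<T>"
      show "(L * norm (y - x))-lipschitz_on (\<gamma> -` T) (\<lambda>s. u (\<gamma> s))"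
      proof (rule lipschitz_onI)
        fix s t assume st: "s \<in> \<gamma> -` T" "t \<in> \<gamma> -` T"
        have "u (\<gamma> s) - u (\<gamma> t) = (s - t) * (a T \<bullet> (y - x))"
          using st ab[OF T] by (simp add: \<gamma>_def algebra_simps)
        then have "dist (u (\<gamma> s)) (u (\<gamma> t)) = \<bar>s - t\<bar> * \<bar>a T \<bullet> (y - x)\<bar>"
          by (simp add: dist_real_def abs_mult)
        also have "\<dots> \<le> \<bar>s - t\<bar> * (norm (a T) * norm (y - x))"
          by (intro mult_left_mono Cauchy_Schwarz_ineq2) auto
        also have "\<dots> \<le> \<bar>s - t\<bar> * (L * norm (y - x))"
          by (intro mult_left_mono mult_right_mono aL T) auto
        finally show "dist (u (\<gamma> s)) (u (\<gamma> t)) \<le> L * norm (y - x) * dist s t"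
          by (simp add: dist_real_def mult.commute)
      qed (use L0 in auto)
      have "continuous_on UNIV \<gamma>" unfolding \<gamma>_def by (intro continuous_intros)
      then show "closed (\<gamma> -` T)"
        using compact_simplex'[OF T] compact_imp_closed by (intro continuous_closed_vimage) (auto simp: continuous_on_eq_continuous_at)
    next
      have "\<gamma> s \<in> closed_segment x y" if "s \<in> {0..1}" for s
        using that by (auto simp: \<gamma>_def in_segment algebra_simps intro!: exI[of _ s])
      then show "{0..1} \<subseteq> (\<Union>T\<in>\<T>. \<gamma> -` T)" using seg Union_\<T> by fastforce
    qed (use finite_\<T> L0 in auto)
    from lipschitz_onD[OF lip, of 1 0] show ?thesis by (simp add: \<gamma>_def dist_real_def)
  qed
  then show ?thesis using that L0 by blast
qed

text \<open>Integration by parts holds for difference quotients by translation invariance; the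
  Lipschitz bounds for \<open>u\<close> and \<open>\<phi>\<close> allow dominated convergence.\<close>

lemma V1_integration_by_parts:
  assumes u: "u \<in> V" and \<phi>: "C1c \<Omega> \<phi>"
  shows "(LINT x:\<Omega>|lebesgue. u x * grad \<phi> x $ i) = - (LINT x:\<Omega>|lebesgue. pgrad u x $ i * \<phi> x)"
proof -
  define e where "e = (axis i 1 :: real^'n)"
  have norm_e: "norm e = 1" by (simp add: e_def norm_axis_1)
  have inner_e: "v \<bullet> e = v $ i" for v by (simp add: e_def inner_axis)
  obtain K where K: "compact K" "K \<subseteq> \<Omega>" "\<And>x. x \<notin> K \<Longrightarrow> \<phi> x = 0"
    using C1c_support[OF \<phi>] by metis
  obtain \<delta> where \<delta>: "\<delta> > 0" "(\<Union>x\<in>K. ball x \<delta>) \<subseteq> \<Omega>"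
    using compact_subset_open_imp_ball_epsilon_subset[OF K(1) open_\<Omega> K(2)] by metis
  \<comment> \<open>Strictly between 0 and the distance \<open>\<delta>\<close> reserved around the
    support \<open>K\<close>, so that shifting a point of \<open>K\<close> by \<open>t k\<close>
    stays inside the domain.\<close>
  define t where "t k = \<delta> / real (Suc (Suc k))" for k
  have t: "0 < t k" "t k < \<delta>" for k
    using \<delta>(1) by (auto simp: t_def divide_less_eq add_pos_nonneg)
  have t0: "t \<longlonglongrightarrow> 0"
    unfolding t_def by (rule LIMSEQ_Suc[OF tendsto_divide_Suc])
  obtain C where C: "0 \<le> C" "\<And>x. \<bar>u x\<bar> \<le> C" using V1_bounded[OF u] by metis
  obtain L where L: "0 \<le> L" "\<And>x y. closed_segment x y \<subseteq> closure \<Omega> \<Longrightarrow> \<bar>u y - u x\<bar> \<le> L * norm (y - x)"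
    using V1_segment_lipschitz[OF u] by metis
  obtain C' where C': "0 \<le> C'" "\<And>x. \<bar>\<phi> x\<bar> \<le> C'" using C1c_bounded[OF \<phi>] by metis
  obtain L' where L': "0 \<le> L'" "\<And>x. norm (grad \<phi> x) \<le> L'" using C1c_grad_bounded[OF \<phi>] by metis
  have \<phi>C1: "C1fun \<phi>" using \<phi> by (simp add: C1c_iff)
  have ub: "u \<in> borel_measurable borel" using V1_borel[OF u] .
  have \<phi>b: "\<phi> \<in> borel_measurable borel"
    using C1fun_continuous[OF \<phi>C1] by (rule borel_measurable_continuous_onI)
  note ub[measurable] \<phi>b[measurable]
  note bm = borel_imp_lebesgue_measurable
  have intK: "integrable lebesgue (\<lambda>x. c * indicator B x)" if "compact B" for B :: "(real^'n) set" and c :: real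
    using compact_imp_closed[OF that] emeasure_bounded_finite[OF compact_imp_bounded[OF that]]
    by (intro integrable_mult_right integrable_real_indicator) auto
  have cpt: "compact (closure \<Omega>)" by (rule compact_closure_\<Omega>)

  \<comment> \<open>\<open>A\<close> carries the difference quotient on the smooth factor,
    \<open>B\<close> the backward one on \<open>u\<close>. Since \<open>u\<close> may jump to 0
    across the boundary, \<open>A\<close> is dominated by means of the zero extension of
    \<open>u\<close>, while \<open>B\<close> is evaluated only on \<open>K\<close>, away from the
    jump.\<close>
  define A where "A k x = u x * ((\<phi> (x + t k *\<^sub>R e) - \<phi> x) / t k)" for k x
  define B where "B k x = ((u (x - t k *\<^sub>R e) - u x) / t k) * \<phi> x" for k x
  have Alim: "(\<lambda>k. LINT x|lebesgue. A k x) \<longlonglongrightarrow> (LINT x|lebesgue. u x * grad \<phi> x $ i)"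
  proof (rule integral_dominated_convergence[where w="\<lambda>x. (C * L') * indicator (closure \<Omega>) x"])
    show "(\<lambda>x. u x * grad \<phi> x $ i) \<in> borel_measurable lebesgue"
    proof (rule bm, rule borel_measurable_times[OF ub], rule borel_measurable_continuous_onI)
      show "continuous_on UNIV (\<lambda>x. grad \<phi> x $ i)"
        using \<phi>C1 by (auto simp: C1fun_def intro!: continuous_intros)
    qed
    show "A k \<in> borel_measurable lebesgue" for k
      unfolding A_def[abs_def] by (intro bm) measurable
    show "integrable lebesgue (\<lambda>x. (C * L') * indicator (closure \<Omega>) x)" by (rule intK[OF cpt])
    show "AE x in lebesgue. (\<lambda>k. A k x) \<longlonglongrightarrow> u x * grad \<phi> x $ i"
    proof (rule AE_I2)
      fix x
      have "(\<lambda>k. (\<phi> (x + t k *\<^sub>R e) - \<phi> x) / t k) \<longlonglongrightarrow> grad \<phi> x \<bullet> e"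
        by (rule GDERIV_difference_quotient[OF C1fun_GDERIV[OF \<phi>C1] t0]) (use t(1) in \<open>auto simp: less_imp_neq[symmetric]\<close>)
      then show "(\<lambda>k. A k x) \<longlonglongrightarrow> u x * grad \<phi> x $ i"
        unfolding A_def inner_e by (rule tendsto_mult_left)
    qed
    show "AE x in lebesgue. norm (A k x) \<le> (C * L') * indicator (closure \<Omega>) x" for k
    proof (rule AE_I2)
      fix x
      have q: "\<bar>(\<phi> (x + t k *\<^sub>R e) - \<phi> x) / t k\<bar> \<le> L'"
        using C1fun_lipschitz[OF \<phi>C1 L'(2), of "x + t k *\<^sub>R e" x] t(1)[of k] norm_e
        by (simp add: field_simps abs_divide)
      show "norm (A k x) \<le> (C * L') * indicator (closure \<Omega>) x"
      proof (cases "x \<in> closure \<Omega>")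
        case True
        have "\<bar>u x\<bar> * \<bar>(\<phi> (x + t k *\<^sub>R e) - \<phi> x) / t k\<bar> \<le> C * L'"
          using C q by (intro mult_mono) auto
        then show ?thesis using True by (simp add: A_def abs_mult)
      next
        case False
        then show ?thesis using V1_zero_outside[OF u False] by (simp add: A_def)
      qed
    qed
  qed
  have Blim: "(\<lambda>k. LINT x|lebesgue. B k x) \<longlonglongrightarrow> (LINT x|lebesgue. - (pgrad u x $ i) * \<phi> x)"
  proof (rule integral_dominated_convergence[where w="\<lambda>x. (L * C') * indicator K x"])
    have "bdd\<Omega> (\<lambda>x. pgrad u x $ i)" using V0v_ess_bounded[OF pgrad_V0v[OF u]] .
    then have "(\<lambda>x. indicator \<Omega> x *\<^sub>R pgrad u x $ i) \<in> borel_measurable lebesgue"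
      by (simp add: ess_bounded_def set_borel_measurable_def)
    moreover have "(\<lambda>x. indicator \<Omega> x *\<^sub>R pgrad u x $ i) = (\<lambda>x. pgrad u x $ i)"
      using U_subset by (auto simp: fun_eq_iff indicator_def pgrad_def)
    ultimately show "(\<lambda>x. - (pgrad u x $ i) * \<phi> x) \<in> borel_measurable lebesgue"
      using bm[OF \<phi>b] by simp
    show "B k \<in> borel_measurable lebesgue" for k
      unfolding B_def[abs_def] by (intro bm) measurable
    show "integrable lebesgue (\<lambda>x. (L * C') * indicator K x)" by (rule intK[OF K(1)])
    show "AE x in lebesgue. (\<lambda>k. B k x) \<longlonglongrightarrow> - (pgrad u x $ i) * \<phi> x"
      using AE_U
    proof eventually_elim
      case (elim x)
      show ?case
      proof (cases "x \<in> U")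
        case True
        have "(\<lambda>k. (u (x + t k *\<^sub>R (- e)) - u x) / t k) \<longlonglongrightarrow> pgrad u x \<bullet> (- e)"
          by (rule GDERIV_difference_quotient[OF V1_GDERIV[OF u True] t0]) (use t(1) in \<open>auto simp: less_imp_neq[symmetric]\<close>)
        then show ?thesis
          unfolding B_def by (intro tendsto_mult_right) (simp add: inner_e)
      next
        case False
        \<comment> \<open>The almost-everywhere statement leaves only points outside the domain
          here.\<close>
        then have "\<phi> x = 0" using elim K by blast
        then show ?thesis by (simp add: B_def)
      qed
    qed
    show "AE x in lebesgue. norm (B k x) \<le> (L * C') * indicator K x" for k
    proof (rule AE_I2)
      fix x
      show "norm (B k x) \<le> (L * C') * indicator K x"
      proof (cases "x \<in> K")
        case True
        have "closed_segment x (x - t k *\<^sub>R e) \<subseteq> ball x \<delta>"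
          using t[of k] norm_e \<delta>(1) by (intro closed_segment_subset) (auto simp: dist_norm)
        also have "\<dots> \<subseteq> closure \<Omega>" using \<delta>(2) True closure_subset[of \<Omega>] by blast
        finally have "\<bar>u (x - t k *\<^sub>R e) - u x\<bar> \<le> L * t k"
          using L(2)[of x "x - t k *\<^sub>R e"] t(1)[of k] norm_e by simp
        then have "\<bar>(u (x - t k *\<^sub>R e) - u x) / t k\<bar> \<le> L"
          using t(1)[of k] by (simp add: field_simps abs_divide)
        then have "\<bar>(u (x - t k *\<^sub>R e) - u x) / t k\<bar> * \<bar>\<phi> x\<bar> \<le> L * C'"
          using C'(2)[of x] L(1) by (intro mult_mono) auto
        then show ?thesis using True by (simp add: B_def abs_mult)
      qed (simp add: B_def K(3))
    qed
  qed
  have AB: "(LINT x|lebesgue. A k x) = (LINT x|lebesgue. B k x)" for k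
  proof -
    have i1: "integrable lebesgue (\<lambda>x. u x * \<phi> (x + s *\<^sub>R e))" for s
    proof (rule Bochner_Integration.integrable_bound[OF intK[OF cpt, of "C * C'"]])
      show "(\<lambda>x. u x * \<phi> (x + s *\<^sub>R e)) \<in> borel_measurable lebesgue"
        by (intro bm) measurable
      show "AE x in lebesgue. norm (u x * \<phi> (x + s *\<^sub>R e)) \<le> norm (C * C' * indicator (closure \<Omega>) x)"
        using C C' V1_zero_outside[OF u] by (auto simp: indicator_def abs_mult intro!: AE_I2 mult_mono)
    qed
    have i2: "integrable lebesgue (\<lambda>x. u (x - s *\<^sub>R e) * \<phi> x)" for s
    proof (rule Bochner_Integration.integrable_bound[OF intK[OF K(1), of "C * C'"]])
      show "(\<lambda>x. u (x - s *\<^sub>R e) * \<phi> x) \<in> borel_measurable lebesgue"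
        by (intro bm) measurable
      show "AE x in lebesgue. norm (u (x - s *\<^sub>R e) * \<phi> x) \<le> norm (C * C' * indicator K x)"
        using C C' K(3) by (auto simp: indicator_def abs_mult intro!: AE_I2 mult_mono)
    qed
    have "(LINT x|lebesgue. A k x)
        = ((LINT x|lebesgue. u x * \<phi> (x + t k *\<^sub>R e)) - (LINT x|lebesgue. u x * \<phi> x)) / t k"
      using i1[of "t k"] i1[of 0]
      by (simp add: A_def[abs_def] right_diff_distrib diff_divide_distrib)
    also have "(LINT x|lebesgue. u x * \<phi> (x + t k *\<^sub>R e))
        = (LINT x|lebesgue. u (x - t k *\<^sub>R e) * \<phi> x)"
    proof -
      have "(\<lambda>x. u (x - t k *\<^sub>R e) * \<phi> x) \<in> borel_measurable borel"
        by measurable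
      from integral_lebesgue_translation[OF this, of "t k *\<^sub>R e"]
      show ?thesis by (simp add: add.commute)
    qed
    also have "((LINT x|lebesgue. u (x - t k *\<^sub>R e) * \<phi> x) - (LINT x|lebesgue. u x * \<phi> x)) / t k
        = (LINT x|lebesgue. B k x)"
      using i2[of "t k"] i2[of 0]
      by (simp add: B_def[abs_def] left_diff_distrib diff_divide_distrib)
    finally show ?thesis .
  qed
  have "(LINT x|lebesgue. u x * grad \<phi> x $ i) = (LINT x|lebesgue. - (pgrad u x $ i) * \<phi> x)"
    using LIMSEQ_unique[OF Alim] Blim AB by simp
  moreover have "(LINT x:\<Omega>|lebesgue. u x * grad \<phi> x $ i) = (LINT x|lebesgue. u x * grad \<phi> x $ i)"
    unfolding set_lebesgue_integral_def
  proof (rule Bochner_Integration.integral_cong[OF refl])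
    fix x
    have "x \<notin> \<Omega> \<Longrightarrow> grad \<phi> x = 0" using C1c_grad_outside[of K \<phi>, OF K(1,3)] K(2) by blast
    then show "indicator \<Omega> x *\<^sub>R (u x * grad \<phi> x $ i) = u x * grad \<phi> x $ i"
      by (auto simp: indicator_def)
  qed
  moreover have "(LINT x:\<Omega>|lebesgue. pgrad u x $ i * \<phi> x) = (LINT x|lebesgue. pgrad u x $ i * \<phi> x)"
    unfolding set_lebesgue_integral_def
  proof (rule Bochner_Integration.integral_cong[OF refl])
    fix x
    show "indicator \<Omega> x *\<^sub>R (pgrad u x $ i * \<phi> x) = pgrad u x $ i * \<phi> x"
      using K(2,3) by (auto simp: indicator_def)
  qed
  ultimately show ?thesis by simp
qed

lemma V1_L2O: "u \<in> V \<Longrightarrow> L2O \<Omega> u"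
  using integrable_ess_bounded[OF ess_bounded_mult[OF V1_ess_bounded_\<Omega> V1_ess_bounded_\<Omega>], of u u]
    V1_ess_bounded_\<Omega>[of u]
  by (auto simp: L2O_def ess_bounded_def power2_eq_square)

text \<open>Makes discrete functions admissible in the coercivity and trace inequalities.\<close>

lemma V1_weak_grad:
  assumes u: "u \<in> V" shows "weak_grad \<Omega> u (pgrad u)"
proof -
  have b: "bdd\<Omega> (\<lambda>x. pgrad u x $ i)" for i
    using V0v_ess_bounded[OF pgrad_V0v[OF u]] .
  have "L2O \<Omega> (\<lambda>x. pgrad u x $ i)" for i
    using integrable_ess_bounded[OF ess_bounded_mult[OF b b], of i i] b[of i]
    by (auto simp: L2O_def ess_bounded_def power2_eq_square)
  then show ?thesis
    using V1_integration_by_parts[OF u] by (auto simp: weak_grad_def)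
qed

end

section \<open>Total variation of piecewise linear functions\<close>

lemma set_integral_sum_finite:
  fixes f :: "'i \<Rightarrow> 'a \<Rightarrow> real"
  assumes "\<And>i. i \<in> I \<Longrightarrow> set_integrable \<mu> A (f i)"
  shows "(LINT x:A|\<mu>. \<Sum>i\<in>I. f i x) = (\<Sum>i\<in>I. LINT x:A|\<mu>. f i x)"
  using assms unfolding set_lebesgue_integral_def set_integrable_def scaleR_sum_right
  by (rule Bochner_Integration.integral_sum)

lemma ess_bounded_abs:
  assumes "ess_bounded \<mu> A f" shows "ess_bounded \<mu> A (\<lambda>x. \<bar>f x\<bar>)"
proof -
  have "(\<lambda>x. \<bar>indicator A x *\<^sub>R f x\<bar>) \<in> borel_measurable \<mu>"
    using assms by (intro borel_measurable_abs) (auto simp: ess_bounded_def set_borel_measurable_def)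
  then show ?thesis
    using assms by (auto simp: ess_bounded_def set_borel_measurable_def abs_mult)
qed

text \<open>Squaring smooths the kink of the positive part at 0, which makes it usable as a factor
  of a continuously differentiable cutoff.\<close>

lemma has_field_derivative_max_zero_power2:
  "((\<lambda>t::real. (max 0 t)\<^sup>2) has_field_derivative 2 * max 0 t) (at t)"
proof (cases "t = 0")
  case True
  have "((\<lambda>h::real. (max 0 h)\<^sup>2 / h) \<longlongrightarrow> 0) (at 0)"
  proof (rule Lim_null_comparison[where g="\<lambda>h. \<bar>h\<bar>"])
    show "\<forall>\<^sub>F h in at 0. norm ((max 0 h)\<^sup>2 / h) \<le> \<bar>h::real\<bar>"
      by (intro always_eventually allI) (auto simp: max_def power2_eq_square)
    show "((\<lambda>h::real. \<bar>h\<bar>) \<longlongrightarrow> 0) (at 0)" by (auto intro!: tendsto_eq_intros)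
  qed
  then show ?thesis using True by (simp add: DERIV_def)
next
  case False
  show ?thesis
  proof (cases "t < 0")
    case True
    have "((\<lambda>t::real. 0) has_field_derivative 2 * max 0 t) (at t)" using True by simp
    then show ?thesis
      by (rule has_field_derivative_transform_within_open[of _ _ _ "{..<0}"]) (use True in auto)
  next
    case f: False
    have "((\<lambda>t::real. t\<^sup>2) has_field_derivative 2 * max 0 t) (at t)"
      using f False by (auto intro!: derivative_eq_intros simp: max_def)
    then show ?thesis
      by (rule has_field_derivative_transform_within_open[of _ _ _ "{0<..}"]) (use f False in auto)
  qed
qed

text \<open>The facet inequalities of the polytope provide the construction: a product of truncated
  slacks is positive exactly at points with enough slack in every inequality, and a rational
  function squeezes it into the unit interval.\<close>

lemma polytope_cutoffs:
  fixes T :: "(real^'n) set"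
  assumes "polytope T"
  obtains \<phi> :: "nat \<Rightarrow> real^'n \<Rightarrow> real" where "\<And>k. C1c (interior T) (\<phi> k)"
    "\<And>k x. 0 \<le> \<phi> k x \<and> \<phi> k x \<le> 1" "\<And>x. x \<in> interior T \<Longrightarrow> (\<lambda>k. \<phi> k x) \<longlonglongrightarrow> 1"
proof -
  obtain H where H: "finite H" "T = \<Inter>H" "\<forall>h\<in>H. \<exists>a b. a \<noteq> 0 \<and> h = {x. a \<bullet> x \<le> b}"
    using polytope_imp_polyhedron[OF assms] unfolding polyhedron_def by blast
  then obtain a b where ab: "\<And>h. h \<in> H \<Longrightarrow> a h \<noteq> 0 \<and> h = {x. a h \<bullet> x \<le> b h}" by metis
  have compact_T: "compact T" using polytope_imp_compact[OF assms] .
  define \<epsilon> where "\<epsilon> k = 1 / real (Suc k)" for k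
  \<comment> \<open>Lowering every slack by \<open>\<epsilon> k\<close> confines the support to the
    compact set \<open>P k\<close> in the interior; the loss tends to 0 with
    \<open>k\<close>.\<close>
  define w where "w k x = (\<Prod>h\<in>H. (max 0 (b h - a h \<bullet> x - \<epsilon> k))\<^sup>2)" for k x
  \<comment> \<open>The square keeps the denominator positive for every real argument, so the outer
    function is smooth on the whole line. It vanishes at 0, and the growing factor drives it to 1
    wherever the limit of \<open>w\<close> is positive.\<close>
  define \<phi> where "\<phi> k x = 1 - 1 / (1 + real (Suc k) * (w k x)\<^sup>2)" for k x
  have \<epsilon>0: "\<epsilon> k > 0" for k by (simp add: \<epsilon>_def)
  have \<epsilon>lim: "\<epsilon> \<longlonglongrightarrow> 0"
    unfolding \<epsilon>_def by (rule tendsto_divide_Suc)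
  have pos: "1 + real (Suc k) * y\<^sup>2 > 0" for k and y :: real
    by (intro add_pos_nonneg mult_nonneg_nonneg) auto
  have aff: "C1fun (\<lambda>x. b h - a h \<bullet> x - \<epsilon> k)" for h k
  proof (rule C1funI[where D="\<lambda>x. - a h"])
    show "GDERIV (\<lambda>x. b h - a h \<bullet> x - \<epsilon> k) x :> - a h" for x
      unfolding gderiv_def by (auto intro!: derivative_eq_intros simp: inner_commute)
  qed simp
  have "C1fun (w k)" for k
    unfolding w_def[abs_def]
    by (intro C1fun_prod H(1) C1fun_compose[OF aff has_field_derivative_max_zero_power2] continuous_intros)
  then have C1: "C1fun (\<phi> k)" for k
    unfolding \<phi>_def[abs_def]
  proof (rule C1fun_compose)
    show "((\<lambda>y. 1 - 1 / (1 + real (Suc k) * y\<^sup>2)) has_field_derivative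
        2 * real (Suc k) * y / (1 + real (Suc k) * y\<^sup>2)\<^sup>2) (at y)" for y :: real
      using pos[of k y]
      by (auto intro!: derivative_eq_intros simp: power2_eq_square field_simps;
          simp add: minus_divide_left)
    show "continuous_on UNIV (\<lambda>y. 2 * real (Suc k) * y / (1 + real (Suc k) * y\<^sup>2)\<^sup>2)"
      using pos[of k] by (intro continuous_intros) (metis less_irrefl zero_eq_power2 UNIV_I)
  qed
  define P where "P k = {x. \<forall>h\<in>H. a h \<bullet> x \<le> b h - \<epsilon> k}" for k
  have P_closed: "closed (P k)" for k
  proof -
    have "P k = (\<Inter>h\<in>H. {x. a h \<bullet> x \<le> b h - \<epsilon> k})" by (auto simp: P_def)
    then show ?thesis by (auto intro: closed_halfspace_le)
  qed
  have P_interior: "P k \<subseteq> interior T" for k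
  proof -
    define W where "W = (\<Inter>h\<in>H. {x. a h \<bullet> x < b h})"
    have "open W" unfolding W_def using H(1) by (intro open_INT) (auto intro: open_halfspace_lt)
    moreover have "W \<subseteq> T" using H(2) ab by (force simp: W_def)
    moreover have "P k \<subseteq> W" using \<epsilon>0[of k] by (force simp: P_def W_def)
    ultimately show ?thesis using interior_maximal by blast
  qed
  have P_compact: "compact (P k)" for k
    using P_closed P_interior interior_subset compact_T
    by (meson bounded_subset compact_eq_bounded_closed order_trans)
  have outside: "\<phi> k x = 0" if x: "x \<notin> P k" for k x
  proof -
    obtain h where h: "h \<in> H" "b h - \<epsilon> k < a h \<bullet> x" using x by (auto simp: P_def not_le)
    then have "w k x = 0" unfolding w_def using H(1)
      by (intro prod_zero bexI[of _ h]) auto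
    then show ?thesis by (simp add: \<phi>_def)
  qed
  have "C1c (interior T) (\<phi> k)" for k
    by (rule C1cI[OF C1 P_compact P_interior outside])
  moreover have "0 \<le> \<phi> k x \<and> \<phi> k x \<le> 1" for k x
    using pos[of k "w k x"] by (simp add: \<phi>_def divide_le_eq)
  moreover have "(\<lambda>k. \<phi> k x) \<longlonglongrightarrow> 1" if x: "x \<in> interior T" for x
  proof -
    have strict: "a h \<bullet> x < b h" if h: "h \<in> H" for h
    proof -
      have "x \<in> interior {x. a h \<bullet> x \<le> b h}"
        using x H(2) h ab[OF h] interior_mono[of T h] by auto
      moreover have "interior {x. a h \<bullet> x \<le> b h} = {x. a h \<bullet> x < b h}"
        using ab[OF h] by (intro interior_halfspace_le) simp
      ultimately show ?thesis by blast
    qed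
    define w0 where "w0 = (\<Prod>h\<in>H. (max 0 (b h - a h \<bullet> x - 0))\<^sup>2)"
    have "0 < w0" unfolding w0_def by (intro prod_pos ballI zero_less_power) (simp add: strict)
    moreover have "(\<lambda>k. w k x) \<longlonglongrightarrow> w0"
      unfolding w_def w0_def by (intro tendsto_intros \<epsilon>lim)
    ultimately have "(\<lambda>k. (w k x)\<^sup>2) \<longlonglongrightarrow> w0\<^sup>2" "0 < w0\<^sup>2" by (auto intro: tendsto_power)
    then have "filterlim (\<lambda>k. (w k x)\<^sup>2 * real (Suc k)) at_top sequentially"
      by (rule filterlim_tendsto_pos_mult_at_top)
        (rule filterlim_compose[OF filterlim_real_sequentially filterlim_Suc])
    then have "filterlim (\<lambda>k. 1 + (w k x)\<^sup>2 * real (Suc k)) at_top sequentially"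
      by (rule filterlim_tendsto_add_at_top[OF tendsto_const])
    then have "(\<lambda>k. 1 / (1 + (w k x)\<^sup>2 * real (Suc k))) \<longlonglongrightarrow> 0"
      by (rule real_tendsto_divide_at_top[OF tendsto_const])
    then have "(\<lambda>k. 1 - 1 / (1 + (w k x)\<^sup>2 * real (Suc k))) \<longlonglongrightarrow> 1 - 0"
      by (intro tendsto_intros)
    then show ?thesis by (simp add: \<phi>_def mult.commute)
  qed
  ultimately show ?thesis using that by blast
qed

section \<open>Total variation as an integral over the elements\<close>

context mesh
begin

text \<open>Test fields are bounded componentwise by 1, so the dual norm on gradients is the l1
  norm: this is the integrand of the anisotropic total variation.\<close>

definition grad_l1 :: "(real^'n \<Rightarrow> real) \<Rightarrow> real^'n \<Rightarrow> real" where
  "grad_l1 u x = (\<Sum>j\<in>UNIV. \<bar>pgrad u x $ j\<bar>)"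

lemma grad_l1_ess_bounded:
  assumes "u \<in> V" shows "bdd\<Omega> (grad_l1 u)"
  unfolding grad_l1_def
  by (intro ess_bounded_sum ess_bounded_abs V0v_ess_bounded pgrad_V0v assms sets_\<Omega>)

lemma inner_grad_l1: "(\<And>j. \<bar>q $ j\<bar> \<le> 1) \<Longrightarrow> \<bar>pgrad u x \<bullet> q\<bar> \<le> grad_l1 u x"
  unfolding inner_vec_def inner_real_def grad_l1_def
  by (intro order_trans[OF sum_abs] sum_mono) (simp add: abs_mult mult_left_le)

lemma V1_divergence:
  assumes u: "u \<in> V" and G: "G \<in> TVtests \<Omega>"
  shows "(LINT x:\<Omega>|lebesgue. u x * divg G x) = (LINT x:\<Omega>|lebesgue. - (pgrad u x \<bullet> G x))"
proof -
  have C: "C1c \<Omega> (\<lambda>y. G y $ i)" for i using G by (simp add: TVtests_def)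
  have "(LINT x:\<Omega>|lebesgue. u x * divg G x)
      = (\<Sum>i\<in>UNIV. LINT x:\<Omega>|lebesgue. u x * grad (\<lambda>y. G y $ i) x $ i)"
    unfolding divg_def sum_distrib_left
    by (intro set_integral_sum_finite integrable_ess_bounded ess_bounded_mult V1_ess_bounded_\<Omega> u
        C1c_ess_bounded C)
  also have "\<dots> = (\<Sum>i\<in>UNIV. - (LINT x:\<Omega>|lebesgue. pgrad u x $ i * G x $ i))"
    using V1_integration_by_parts[OF u C] by simp
  also have "\<dots> = - (LINT x:\<Omega>|lebesgue. pgrad u x \<bullet> G x)"
    unfolding inner_vec_def inner_real_def sum_negf
    by (intro arg_cong[where f=uminus] set_integral_sum_finite[symmetric] integrable_ess_bounded
        ess_bounded_mult V0v_ess_bounded pgrad_V0v u C1c_ess_bounded C)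
  also have "\<dots> = (LINT x:\<Omega>|lebesgue. - (pgrad u x \<bullet> G x))"
    by (simp add: set_lebesgue_integral_def)
  finally show ?thesis .
qed

lemma TVtests_ess_bounded: "G \<in> TVtests \<Omega> \<Longrightarrow> bdd\<Omega> (\<lambda>x. G x $ i)"
  by (auto simp: TVtests_def intro: C1c_ess_bounded)

lemma V1_divergence_le:
  assumes u: "u \<in> V" and G: "G \<in> TVtests \<Omega>"
  shows "(LINT x:\<Omega>|lebesgue. u x * divg G x) \<le> (LINT x:\<Omega>|lebesgue. grad_l1 u x)"
  unfolding V1_divergence[OF assms]
proof (rule set_integral_mono)
  have "bdd\<Omega> (\<lambda>x. (-1) * (pgrad u x \<bullet> G x))"
    by (intro ess_bounded_cmult ess_bounded_inner sets_\<Omega> V0v_ess_bounded pgrad_V0v u TVtests_ess_bounded G)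
  then show "set_integrable lebesgue \<Omega> (\<lambda>x. - (pgrad u x \<bullet> G x))"
    using integrable_ess_bounded by fastforce
  show "set_integrable lebesgue \<Omega> (grad_l1 u)" by (intro integrable_ess_bounded grad_l1_ess_bounded u)
  show "- (pgrad u x \<bullet> G x) \<le> grad_l1 u x" for x
    using inner_grad_l1[of "G x" u x] G by (auto simp: TVtests_def)
qed

text \<open>Besides membership in \<open>BV\<close> this supplies the boundedness without which the
  real-valued supremum in \<open>TV\<close> could not be used as an upper bound.\<close>

lemma V1_BV:
  assumes u: "u \<in> V" shows "BV \<Omega> u"
  unfolding BV_def
proof
  show "set_integrable lebesgue \<Omega> u" by (intro integrable_ess_bounded V1_ess_bounded_\<Omega> u)
  show "bdd_above ((\<lambda>G. LINT x:\<Omega>|lebesgue. u x * divg G x) ` TVtests \<Omega>)"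
    by (rule bdd_aboveI2[OF V1_divergence_le[OF u]])
qed

lemma C1c_mono: "C1c A \<phi> \<Longrightarrow> A \<subseteq> B \<Longrightarrow> C1c B \<phi>"
  by (auto simp: C1c_def)

text \<open>The optimal field is minus the sign of the gradient, which jumps between elements.
  Cutoffs supported in the element interiors make it smooth, and disjointness of the interiors
  preserves the componentwise bound 1.\<close>

lemma sign_tests:
  assumes u: "u \<in> V"
  obtains G where "\<And>k::nat. G k \<in> TVtests \<Omega>"
    "\<And>x. x \<in> U \<Longrightarrow> (\<lambda>k. - (pgrad u x \<bullet> G k x)) \<longlonglongrightarrow> grad_l1 u x"
proof -
  have "\<exists>\<phi>. (\<forall>k. C1c (interior T) (\<phi> k)) \<and> (\<forall>k x. 0 \<le> \<phi> k x \<and> \<phi> k x \<le> 1) \<and>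
      (\<forall>x\<in>interior T. (\<lambda>k::nat. \<phi> k x) \<longlonglongrightarrow> 1)" if "T \<in> \<T>" for T
    using polytope_cutoffs[OF simplex_imp_polytope[OF simplices[OF that]]] by metis
  then obtain \<phi> where \<phi>: "\<And>T k. T \<in> \<T> \<Longrightarrow> C1c (interior T) (\<phi> T k)"
    "\<And>T k x. T \<in> \<T> \<Longrightarrow> 0 \<le> \<phi> T k x \<and> \<phi> T k x \<le> 1"
    "\<And>T x. T \<in> \<T> \<Longrightarrow> x \<in> interior T \<Longrightarrow> (\<lambda>k::nat. \<phi> T k x) \<longlonglongrightarrow> 1"
    by metis
  have \<phi>0: "\<phi> T k x = 0" if T: "T \<in> \<T>" and x: "x \<notin> interior T" for T k x
  proof -
    obtain K where "K \<subseteq> interior T" "\<And>x. x \<notin> K \<Longrightarrow> \<phi> T k x = 0"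
      using C1c_support[OF \<phi>(1)[OF T]] by metis
    then show ?thesis using x by blast
  qed
  obtain c where c: "\<And>T x. T \<in> \<T> \<Longrightarrow> x \<in> interior T \<Longrightarrow> pgrad u x = c T"
    using pgrad_V0v[OF u] unfolding V0v_def by blast
  define G where "G k x = (\<chi> j. \<Sum>T\<in>\<T>. (- sgn (c T $ j)) * \<phi> T k x)" for k x
  have Gin: "G k x = (\<chi> j. - sgn (c T $ j) * \<phi> T k x)" if T: "T \<in> \<T>" "x \<in> interior T" for k x T
  proof -
    have "(\<Sum>S\<in>\<T>. (- sgn (c S $ j)) * \<phi> S k x) = (- sgn (c T $ j)) * \<phi> T k x" for j
    proof -
      have "(\<Sum>S\<in>\<T>. (- sgn (c S $ j)) * \<phi> S k x)
          = (\<Sum>S\<in>\<T>. if S = T then (- sgn (c T $ j)) * \<phi> T k x else 0)"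
        using \<phi>0[of _ x k] interior_simplex_eq[OF _ T(1) _ T(2)]
        by (intro sum.cong refl) (metis mult_zero_right)
      then show ?thesis using T finite_\<T> by simp
    qed
    then show ?thesis by (simp add: G_def)
  qed
  have "G k \<in> TVtests \<Omega>" for k
    unfolding TVtests_def
  proof (intro CollectI conjI allI)
    fix i
    show "C1c \<Omega> (\<lambda>y. G k y $ i)"
      unfolding G_def vec_lambda_beta
      by (intro C1c_sum C1c_cmult C1c_mono[OF \<phi>(1) interior_simplex_subset])
  next
    fix x i
    show "\<bar>G k x $ i\<bar> \<le> 1"
    proof (cases "\<exists>T\<in>\<T>. x \<in> interior T")
      case True
      then obtain T where T: "T \<in> \<T>" "x \<in> interior T" by blast
      have "\<bar>sgn (c T $ i)\<bar> * \<bar>\<phi> T k x\<bar> \<le> 1 * 1"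
        using \<phi>(2)[OF T(1), of k x] by (intro mult_mono) (auto simp: sgn_if)
      then show ?thesis by (simp add: Gin[OF T] abs_mult)
    next
      case False
      then have "(\<Sum>T\<in>\<T>. (- sgn (c T $ i)) * \<phi> T k x) = 0"
        using \<phi>0 by (intro sum.neutral) auto
      then show ?thesis by (simp add: G_def)
    qed
  qed
  moreover have "(\<lambda>k. - (pgrad u x \<bullet> G k x)) \<longlonglongrightarrow> grad_l1 u x" if xU: "x \<in> U" for x
  proof -
    obtain T where T: "T \<in> \<T>" "x \<in> interior T" using xU by (auto simp: U_def)
    have "- (pgrad u x \<bullet> G k x) = grad_l1 u x * \<phi> T k x" for k
      by (simp add: Gin[OF T] c[OF T] inner_vec_def grad_l1_def sum_distrib_right abs_sgn
          mult.assoc flip: sum_negf)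
    moreover have "(\<lambda>k. grad_l1 u x * \<phi> T k x) \<longlonglongrightarrow> grad_l1 u x * 1"
      by (intro tendsto_mult_left \<phi>(3) T)
    ultimately show ?thesis by simp
  qed
  ultimately show ?thesis using that by blast
qed

text \<open>One direction is duality after integration by parts, the other dominated convergence
  along \<open>sign_tests\<close> with \<open>grad_l1 u\<close> as majorant. Continuity of
  \<open>u\<close> across element faces is what excludes a jump part.\<close>

lemma TV_V1:
  assumes u: "u \<in> V" shows "TV \<Omega> u = (LINT x:\<Omega>|lebesgue. grad_l1 u x)"
proof (rule antisym)
  obtain G where G: "\<And>k::nat. G k \<in> TVtests \<Omega>"
    "\<And>x. x \<in> U \<Longrightarrow> (\<lambda>k. - (pgrad u x \<bullet> G k x)) \<longlonglongrightarrow> grad_l1 u x"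
    using sign_tests[OF u] by metis
  show "TV \<Omega> u \<le> (LINT x:\<Omega>|lebesgue. grad_l1 u x)"
    unfolding TV_def using G(1)[of 0] V1_divergence_le[OF u] by (intro cSUP_least) auto
  have bd: "bdd_above ((\<lambda>G. LINT x:\<Omega>|lebesgue. u x * divg G x) ` TVtests \<Omega>)"
    using V1_BV[OF u] by (simp add: BV_def)
  have int: "set_integrable lebesgue \<Omega> (grad_l1 u)" by (intro integrable_ess_bounded grad_l1_ess_bounded u)
  have inner: "bdd\<Omega> (\<lambda>x. pgrad u x \<bullet> G k x)" for k
    by (intro ess_bounded_inner sets_\<Omega> V0v_ess_bounded pgrad_V0v u TVtests_ess_bounded G(1))
  have "(\<lambda>k. LINT x:\<Omega>|lebesgue. - (pgrad u x \<bullet> G k x)) \<longlonglongrightarrow> (LINT x:\<Omega>|lebesgue. grad_l1 u x)"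
    unfolding set_lebesgue_integral_def
  proof (rule integral_dominated_convergence[where w="\<lambda>x. indicator \<Omega> x *\<^sub>R grad_l1 u x"])
    show "(\<lambda>x. indicator \<Omega> x *\<^sub>R grad_l1 u x) \<in> borel_measurable lebesgue"
      using int by (auto simp: set_integrable_def)
    show "integrable lebesgue (\<lambda>x. indicator \<Omega> x *\<^sub>R grad_l1 u x)"
      using int by (simp add: set_integrable_def)
    show "(\<lambda>x. indicator \<Omega> x *\<^sub>R - (pgrad u x \<bullet> G k x)) \<in> borel_measurable lebesgue" for k
      using inner[of k] by (simp add: ess_bounded_def set_borel_measurable_def)
    show "AE x in lebesgue. (\<lambda>k. indicator \<Omega> x *\<^sub>R - (pgrad u x \<bullet> G k x)) \<longlonglongrightarrow> indicator \<Omega> x *\<^sub>R grad_l1 u x"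
      using AE_U
    proof eventually_elim
      case (elim x)
      then show ?case
        by (cases "x \<in> \<Omega>") (use G(2)[of x] in simp_all)
    qed
    show "AE x in lebesgue. norm (indicator \<Omega> x *\<^sub>R - (pgrad u x \<bullet> G k x)) \<le> indicator \<Omega> x *\<^sub>R grad_l1 u x" for k
      using inner_grad_l1 G(1)[of k] by (intro AE_I2) (auto simp: indicator_def TVtests_def)
  qed
  then have "(\<lambda>k. LINT x:\<Omega>|lebesgue. u x * divg (G k) x) \<longlonglongrightarrow> (LINT x:\<Omega>|lebesgue. grad_l1 u x)"
    by (simp add: V1_divergence[OF u G(1)])
  then show "(LINT x:\<Omega>|lebesgue. grad_l1 u x) \<le> TV \<Omega> u"
    by (rule LIMSEQ_le_const2) (auto simp: TV_def intro!: cSUP_upper bd G(1))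
qed

lemma vipO_le_TV:
  assumes u: "u \<in> V" and q: "q \<in> B1 \<T>"
  shows "vip (pgrad u) q \<le> TV \<Omega> u"
  unfolding TV_V1[OF u] vipO_def
proof (rule set_integral_mono)
  have "q \<in> W" using q by (simp add: B1_def)
  then show "set_integrable lebesgue \<Omega> (\<lambda>x. pgrad u x \<bullet> q x)"
    by (intro integrable_ess_bounded ess_bounded_inner sets_\<Omega> V0v_ess_bounded pgrad_V0v u)
  show "set_integrable lebesgue \<Omega> (grad_l1 u)" by (intro integrable_ess_bounded grad_l1_ess_bounded u)
  show "pgrad u x \<bullet> q x \<le> grad_l1 u x" for x
    using inner_grad_l1[of "q x" u x] q by (auto simp: B1_def)
qed

text \<open>Cutoffs are unnecessary for the discrete dual variable, because the sign of a piecewise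
  constant gradient is itself piecewise constant. Since \<open>sgn 0 = 0\<close>, it also vanishes
  on the skeleton, as canonical representatives must.\<close>

lemma TV_attained:
  assumes u: "u \<in> V"
  shows "\<exists>q\<in>B1 \<T>. vip (pgrad u) q = TV \<Omega> u"
proof
  define q where "q x = (\<chi> j. sgn (pgrad u x $ j))" for x
  obtain c where c: "\<forall>x. (\<forall>T\<in>\<T>. x \<in> interior T \<longrightarrow> pgrad u x = c T) \<and>
      ((\<forall>T\<in>\<T>. x \<notin> interior T) \<longrightarrow> pgrad u x = 0)"
    using pgrad_V0v[OF u] unfolding V0v_def by blast
  then have "\<forall>x. (\<forall>T\<in>\<T>. x \<in> interior T \<longrightarrow> q x = (\<chi> j. sgn (c T $ j))) \<and>
      ((\<forall>T\<in>\<T>. x \<notin> interior T) \<longrightarrow> q x = 0)"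
    by (auto simp: q_def vec_eq_iff)
  then have "q \<in> W" unfolding V0v_def by (intro CollectI exI[of _ "\<lambda>T. \<chi> j. sgn (c T $ j)"])
  then show "q \<in> B1 \<T>" by (auto simp: B1_def q_def sgn_if)
  have "pgrad u x \<bullet> q x = grad_l1 u x" for x
    by (simp add: q_def inner_vec_def grad_l1_def abs_sgn)
  then show "vip (pgrad u) q = TV \<Omega> u"
    by (simp add: TV_V1[OF u] vipO_def)
qed

end

section \<open>Surface measure and the discrete gradient\<close>

lemma sets_bmeas: "sets (bmeas \<Omega> (\<T> :: (real^'n) set set)) = sets borel"
  using sets.sigma_sets_eq[of "borel :: (real^'n) measure"]
  by (simp add: bmeas_def sets_measure_of_conv)

lemma space_bmeas: "space (bmeas \<Omega> \<T>) = UNIV"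
  using sets_eq_imp_space_eq[OF sets_bmeas] by simp

text \<open>The dimension hypothesis puts the facet into a hyperplane, so a unit normal exists and
  the choice in \<open>fnormal\<close> really has norm 1. Each point of the prism is then its
  projection plus a multiple in [0,1] of a unit vector.\<close>

lemma fprism_bounded:
  fixes F :: "(real^'n) set"
  assumes "bounded F" "aff_dim F = int CARD('n) - 1"
  shows "bounded (fprism F)"
proof -
  have "aff_dim F = int (DIM(real^'n) - 1)"
    using assms(2) zero_less_card_finite[where 'a='n] by (simp add: of_nat_diff)
  from iffD1[OF aff_dim_eq_hyperplane this]
  obtain a b where ab: "a \<noteq> 0" "affine hull F = {x. a \<bullet> x = b}"
    by (elim exE conjE)
  have "norm (a /\<^sub>R norm a) = 1 \<and> (\<forall>x\<in>F. \<forall>y\<in>F. (x - y) \<bullet> (a /\<^sub>R norm a) = 0)"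
  proof (intro conjI ballI)
    fix x y assume "x \<in> F" "y \<in> F"
    then have "a \<bullet> x = b" "a \<bullet> y = b" using ab(2) hull_inc[of _ F affine] by blast+
    then show "(x - y) \<bullet> (a /\<^sub>R norm a) = 0" by (simp add: inner_diff_left inner_diff_right inner_commute)
  qed (use ab(1) in simp)
  then have nu: "norm (fnormal F) = 1"
    unfolding fnormal_def by (rule someI2) simp
  obtain R where R: "\<And>x. x \<in> F \<Longrightarrow> norm x \<le> R" using assms(1) by (auto simp: bounded_iff)
  have "norm y \<le> R + 1" if y: "y \<in> fprism F" for y
  proof -
    define s where "s = (y - fbase F) \<bullet> fnormal F"
    have "y = fproj F y + s *\<^sub>R fnormal F" by (simp add: fproj_def s_def)
    then have "norm y \<le> norm (fproj F y) + norm (s *\<^sub>R fnormal F)"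
      by (metis norm_triangle_ineq)
    moreover have "0 \<le> s" "s \<le> 1" "fproj F y \<in> F" using y by (auto simp: fprism_def s_def)
    ultimately show ?thesis using R[of "fproj F y"] nu by simp
  qed
  then show ?thesis by (auto simp: bounded_iff)
qed

lemma emeasure_lebesgue_bounded_subset:
  fixes A B :: "'a::euclidean_space set"
  assumes "bounded B" "A \<subseteq> B" shows "emeasure lebesgue A < \<infinity>"
proof (cases "A \<in> sets lebesgue")
  case True
  have "bounded A" using assms bounded_subset by blast
  then obtain R where R: "A \<subseteq> cball 0 R" by (auto simp: bounded_iff subset_iff)
  have "emeasure lebesgue A \<le> emeasure lebesgue (cball (0::'a) R)"
    by (rule emeasure_mono[OF R]) simp
  also have "\<dots> < \<infinity>" using emeasure_bounded_finite[OF bounded_cball] by simp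
  finally show ?thesis .
qed (simp add: emeasure_notin_sets)

context mesh
begin

abbreviation "S \<equiv> bmeas \<Omega> \<T>"

lemma bfacets_bounded:
  assumes "F \<in> bfacets \<Omega> \<T>" shows "bounded (fprism F)"
proof -
  obtain T where T: "T \<in> \<T>" "F face_of T" "aff_dim F = int CARD('n) - 1"
    using assms by (auto simp: bfacets_def)
  then have "bounded F"
    using bounded_subset[OF compact_imp_bounded[OF compact_simplex'] face_of_imp_subset] by blast
  then show ?thesis using T(3) by (rule fprism_bounded)
qed

text \<open>\<open>measure_of\<close> takes either the value of the given set function or 0; the
  former is a sum of volumes of parts of bounded prisms, so both are finite.\<close>

lemma emeasure_bmeas: "emeasure S A < \<infinity>"
proof -
  have "(\<Sum>F\<in>bfacets \<Omega> \<T>. emeasure lebesgue (fprism F \<inter> fproj F -` A)) < \<infinity>"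
    using emeasure_lebesgue_bounded_subset[OF bfacets_bounded]
    by (cases "finite (bfacets \<Omega> \<T>)") (auto simp: ennreal_sum_less_top)
  then show ?thesis by (simp add: bmeas_def emeasure_measure_of_conv)
qed

lemma frontier_sets: "frontier \<Omega> \<in> sets S"
  by (simp add: sets_bmeas)

lemma V1_ess_bounded_S: "u \<in> V \<Longrightarrow> A \<in> sets S \<Longrightarrow> ess_bounded S A u"
  by (rule V1_ess_bounded) (auto simp: sets_bmeas space_bmeas)

text \<open>The points are the vertices: an affine function that vanishes at the vertices of a
  simplex vanishes on their hull, because its zero set is convex.\<close>

lemma V1_separating_points:
  obtains N where "finite N" "\<And>u. u \<in> V \<Longrightarrow> (\<And>x. x \<in> N \<Longrightarrow> u x = 0) \<Longrightarrow> u = 0"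
proof -
  have "\<exists>C. finite C \<and> T = convex hull C" if "T \<in> \<T>" for T
    using simplices[OF that] unfolding simplex by blast
  then obtain C where C: "\<And>T. T \<in> \<T> \<Longrightarrow> finite (C T) \<and> T = convex hull (C T)" by metis
  show ?thesis
  proof (rule that[of "\<Union>T\<in>\<T>. C T"])
    show "finite (\<Union>T\<in>\<T>. C T)" using C finite_\<T> by blast
    fix u assume u: "u \<in> V" and 0: "\<And>x. x \<in> (\<Union>T\<in>\<T>. C T) \<Longrightarrow> u x = 0"
    have "u x = 0" if xT: "x \<in> T" "T \<in> \<T>" for x T
    proof -
      obtain a b where ab: "\<And>x. x \<in> T \<Longrightarrow> u x = a \<bullet> x + b"
        by (rule V1_affine[OF u xT(2)]) blast
      have CT: "C T \<subseteq> T" using C[OF xT(2)] hull_subset by metis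
      have "C T \<subseteq> {x. a \<bullet> x = - b}"
      proof
        fix y assume y: "y \<in> C T"
        then have "u y = 0" using 0 xT(2) by blast
        moreover have "u y = a \<bullet> y + b" using ab CT y by blast
        ultimately show "y \<in> {x. a \<bullet> x = - b}" by simp
      qed
      then have "convex hull (C T) \<subseteq> {x. a \<bullet> x = - b}"
        by (intro hull_minimal) (auto simp: convex_hyperplane)
      then have "a \<bullet> x = - b" using C[OF xT(2)] xT(1) by blast
      then show ?thesis using ab[OF xT(1)] by simp
    qed
    then have "u x = 0" for x
      using V1_zero_outside[OF u, of x] Union_\<T> by blast
    then show "u = 0" by (simp add: fun_eq_iff)
  qed
qed

lemma V0v_separating_points:
  obtains N where "finite N" "\<And>p. p \<in> W \<Longrightarrow> (\<And>x. x \<in> N \<Longrightarrow> p x = 0) \<Longrightarrow> p = 0"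
proof -
  define s where "s T = (SOME x. x \<in> interior T)" for T :: "(real^'n) set"
  have s: "s T \<in> interior T" if "T \<in> \<T>" for T
    unfolding s_def using interior_simplex_nonempty[OF that] by (simp add: some_in_eq)
  show ?thesis
  proof (rule that[of "s ` \<T>"])
    show "finite (s ` \<T>)" using finite_\<T> by simp
    fix p assume p: "p \<in> W" and 0: "\<And>x. x \<in> s ` \<T> \<Longrightarrow> p x = 0"
    obtain c where c: "\<And>x T. T \<in> \<T> \<Longrightarrow> x \<in> interior T \<Longrightarrow> p x = c T"
      "\<And>x. (\<forall>T\<in>\<T>. x \<notin> interior T) \<Longrightarrow> p x = 0"
      using p unfolding V0v_def by blast
    have "c T = 0" if "T \<in> \<T>" for T using c(1)[OF that s[OF that]] 0 that by auto
    then have "p x = 0" for x using c by (cases "\<exists>T\<in>\<T>. x \<in> interior T") auto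
    then show "p = 0" by (simp add: fun_eq_iff)
  qed
qed

lemma V1_finite_form_space:
  assumes "form_space V B"
  shows "\<exists>\<Lambda>. finite_form_space V B \<Lambda>"
proof -
  obtain N where N: "finite N" "\<And>u. u \<in> V \<Longrightarrow> (\<And>x. x \<in> N \<Longrightarrow> u x = 0) \<Longrightarrow> u = 0"
    using V1_separating_points by metis
  interpret form_space "V" B by fact
  have "finite_form_space V B ((\<lambda>x u. u x) ` N)"
  proof
    show "linear_on V l" if "l \<in> (\<lambda>x u. u x) ` N" for l
      using that by (auto simp: linear_on_def)
    show "u = 0" if "u \<in> V" "\<And>l. l \<in> (\<lambda>x u. u x) ` N \<Longrightarrow> l u = 0" for u
      using N(2)[OF that(1)] that(2) by blast
  qed (use N in auto)
  then show ?thesis by blast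
qed

lemma form_space_ipO: "form_space V ip"
  by unfold_locales (simp_all add: subspace_V1 bilinear_ipO ipO_commute ipO_pos)

section \<open>The coupling form and the norm of the discrete gradient\<close>

definition D :: "(real^'n \<Rightarrow> real) \<Rightarrow> (real^'n \<Rightarrow> real^'n) \<Rightarrow> real" where
  "D u p = vip (pgrad u) p"

lemma D_left_linear: "p \<in> W \<Longrightarrow> linear_on V (\<lambda>u. D u p)"
  using pgrad_V0v linear_on_add[OF bilinear_on_left[OF bilinear_vipO]]
    linear_on_scale[OF bilinear_on_left[OF bilinear_vipO]]
  by (intro linear_onI) (simp_all add: D_def pgrad_add pgrad_scale)

lemma D_right_linear: "u \<in> V \<Longrightarrow> linear_on W (D u)"
  unfolding D_def by (intro bilinear_on_right[OF bilinear_vipO] pgrad_V0v)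

lemma D_simps:
  assumes "u \<in> V" "p \<in> W"
  shows "v \<in> V \<Longrightarrow> D (u + v) p = D u p + D v p"
    "v \<in> V \<Longrightarrow> D (u - v) p = D u p - D v p" "D (c *\<^sub>R u) p = c * D u p"
    "q \<in> W \<Longrightarrow> D u (p + q) = D u p + D u q"
    "q \<in> W \<Longrightarrow> D u (p - q) = D u p - D u q" "D u (c *\<^sub>R p) = c * D u p"
  using linear_on_add[OF D_left_linear[OF assms(2)]] linear_on_add[OF D_right_linear[OF assms(1)]]
    linear_on_diff[OF D_left_linear[OF assms(2)] subspace_V1]
    linear_on_diff[OF D_right_linear[OF assms(1)] subspace_V0v]
    linear_on_scale[OF D_left_linear[OF assms(2)]] linear_on_scale[OF D_right_linear[OF assms(1)]]
    assms
  by simp_all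

lemma vnrmO_grad:
  assumes u: "u \<in> V" shows "vnrm (grad u) = sqrt (vip (pgrad u) (pgrad u))"
proof -
  have "bdd\<Omega> (\<lambda>x. grad u x \<bullet> grad u x)"
    by (intro ess_bounded_inner sets_\<Omega> grad_ess_bounded u)
  then have "vip (grad u) (grad u) = vip (pgrad u) (pgrad u)"
    unfolding vipO_def ess_bounded_def
    by (intro set_integral_lebesgue_cong_AE AE_U_imp) (auto simp: pgrad_def)
  then show ?thesis by (simp add: vnrmO_def)
qed

lemma bilinear_pgrad: "bilinear_on V (\<lambda>u v. vip (pgrad u) (pgrad v))"
  using pgrad_V0v
  by (intro bilinear_on_symI[OF vipO_commute] subspace_V1 linear_onI)
    (simp_all add: pgrad_add pgrad_scale vipO_scale bilinear_on_simps[OF bilinear_vipO subspace_V0v])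

text \<open>A real supremum dominates its members only if they are bounded above;
  \<open>form_bounded\<close> provides the bound \<open>sqrt C\<close> on the quotients.\<close>

lemma gradnorm_bound:
  assumes u: "u \<in> V"
  shows "sqrt (vip (pgrad u) (pgrad u)) \<le> gnorm * sqrt (ip u u)"
proof (cases "u = 0")
  case True
  then have "pgrad u = 0" using pgrad_scale[OF u, of 0] by simp
  then show ?thesis using True by (simp add: vipO_def ipO_def)
next
  case False
  obtain \<Lambda> where "finite_form_space V ip \<Lambda>"
    using V1_finite_form_space[OF form_space_ipO] by blast
  then interpret finite_form_space "V" "ip" \<Lambda> .
  obtain C where C: "\<And>v. v \<in> V \<Longrightarrow> vip (pgrad v) (pgrad v) \<le> C * ip v v"
    using form_bounded[OF bilinear_pgrad] by blast
  have ratio: "vnrm (grad v) / nrm v \<le> sqrt C" if v: "v \<in> V - {\<lambda>x. 0}" for v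
  proof -
    have v': "v \<in> V" "v \<noteq> 0" using v by (auto simp: zero_fun_def)
    have "sqrt (vip (pgrad v) (pgrad v)) \<le> sqrt (C * ip v v)" using C[OF v'(1)] by simp
    then show ?thesis
      using ipO_pos[OF v'] by (simp add: vnrmO_grad[OF v'(1)] nrmO_def real_sqrt_mult divide_le_eq)
  qed
  have "vnrm (grad u) / nrm u \<le> gnorm"
    unfolding gradnorm_def using u False ratio
    by (intro cSUP_upper bdd_aboveI2[where M="sqrt C"]) (auto simp: zero_fun_def)
  then show ?thesis
    using ipO_pos[OF u False] by (simp add: vnrmO_grad[OF u] nrmO_def divide_le_eq)
qed

text \<open>The absolute value keeps the factor nonnegative whatever the sign of the supremum, which
  is over an empty set if \<open>V1\<close> is trivial. It does no harm, since the step size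
  condition contains only the square.\<close>

lemma D_bound:
  assumes u: "u \<in> V" and p: "p \<in> W"
  shows "\<bar>D u p\<bar> \<le> \<bar>gnorm\<bar> * sqrt (ip u u) * sqrt (vip p p)"
proof -
  have "(D u p)\<^sup>2 \<le> vip (pgrad u) (pgrad u) * vip p p"
    unfolding D_def
    by (rule psd_cauchy_schwarz[OF bilinear_vipO subspace_V0v pgrad_V0v[OF u] p vipO_commute vipO_nonneg])
  from real_sqrt_le_mono[OF this]
  have "\<bar>D u p\<bar> \<le> sqrt (vip (pgrad u) (pgrad u)) * sqrt (vip p p)"
    by (simp add: real_sqrt_mult)
  also have "\<dots> \<le> \<bar>gnorm\<bar> * sqrt (ip u u) * sqrt (vip p p)"
  proof (rule mult_right_mono)
    have "gnorm * sqrt (ip u u) \<le> \<bar>gnorm\<bar> * sqrt (ip u u)"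
      using ipO_nonneg[of u] by (intro mult_right_mono) auto
    then show "sqrt (vip (pgrad u) (pgrad u)) \<le> \<bar>gnorm\<bar> * sqrt (ip u u)"
      using gradnorm_bound[OF u] by linarith
  qed (use vipO_nonneg in auto)
  finally show ?thesis .
qed

end

section \<open>The discrete state and adjoint equations\<close>

locale elliptic = mesh \<Omega> \<T> for \<Omega> :: "(real^'n) set" and \<T> +
  fixes \<Gamma> :: "(real^'n) set" and \<alpha> :: "real^'n \<Rightarrow> real^'n^'n" and \<beta> \<sigma> z :: "real^'n \<Rightarrow> real"
    and J :: "(real^'n \<Rightarrow> real) \<Rightarrow> real" and c1 c\<gamma> :: real
  assumes \<Gamma>: "openin (top_of_set (frontier \<Omega>)) \<Gamma>"
    and \<alpha>: "\<And>i j. bdd\<Omega> (\<lambda>x. \<alpha> x $ i $ j)"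
    and \<alpha>_sym: "AE x in lebesgue. x \<in> \<Omega> \<longrightarrow> (\<forall>i j. \<alpha> x $ i $ j = \<alpha> x $ j $ i)"
    and \<beta>: "bdd\<Omega> \<beta>"
    and \<sigma>: "ess_bounded (bmeas \<Omega> \<T>) (frontier \<Omega>) \<sigma>"
    and J: "linear_on V J"
    and c1: "0 < c1" "\<And>u g. L2O \<Omega> u \<Longrightarrow> weak_grad \<Omega> u g \<Longrightarrow> continuous_on (closure \<Omega>) u \<Longrightarrow>
      c1 * H1norm2 \<Omega> u g \<le> aform \<Omega> \<T> \<alpha> \<beta> \<sigma> u g u g"
    and c\<gamma>: "0 < c\<gamma>" "\<And>u g. L2O \<Omega> u \<Longrightarrow> weak_grad \<Omega> u g \<Longrightarrow> continuous_on (closure \<Omega>) u \<Longrightarrow>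
      sqrt (LINT x:frontier \<Omega>|bmeas \<Omega> \<T>. (u x)\<^sup>2) \<le> c\<gamma> * sqrt (H1norm2 \<Omega> u g)"
    and z: "set_borel_measurable (bmeas \<Omega> \<T>) \<Gamma> z" "set_integrable (bmeas \<Omega> \<T>) \<Gamma> (\<lambda>x. (z x)\<^sup>2)"
begin

abbreviation "adj \<equiv> uha \<Omega> \<T> \<Gamma> \<alpha> \<beta> \<sigma> J z"

text \<open>With \<open>pgrad\<close> instead of \<open>grad\<close> the form is bilinear by
  pointwise linearity; \<open>aform_grad\<close> returns to the form of the state equation.\<close>

definition a :: "(real^'n \<Rightarrow> real) \<Rightarrow> (real^'n \<Rightarrow> real) \<Rightarrow> real" where
  "a u v = aform \<Omega> \<T> \<alpha> \<beta> \<sigma> u (pgrad u) v (pgrad v)"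

lemma \<Gamma>_subset: "\<Gamma> \<subseteq> frontier \<Omega>"
  using \<Gamma> openin_imp_subset by blast

lemma \<Gamma>_sets: "\<Gamma> \<in> sets S"
proof -
  obtain W where "open W" "\<Gamma> = frontier \<Omega> \<inter> W" using \<Gamma> openin_open by metis
  then show ?thesis by (auto simp: sets_bmeas intro!: sets.Int borel_open borel_closed)
qed

lemma diffusion_ess_bounded:
  assumes "\<And>j. bdd\<Omega> (\<lambda>x. p x $ j)" "\<And>j. bdd\<Omega> (\<lambda>x. q x $ j)"
  shows "bdd\<Omega> (\<lambda>x. (\<alpha> x *v p x) \<bullet> q x)"
proof (rule ess_bounded_inner[OF sets_\<Omega> _ assms(2)])
  show "bdd\<Omega> (\<lambda>x. (\<alpha> x *v p x) $ i)" for i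
    unfolding matrix_vector_mult_def vec_lambda_beta
    by (intro ess_bounded_sum ess_bounded_mult sets_\<Omega> \<alpha> assms)
qed

lemmas integrable_S = ess_bounded_set_integrable[OF _ _ emeasure_bmeas]

lemma pgrad_ess_bounded: "u \<in> V \<Longrightarrow> bdd\<Omega> (\<lambda>x. pgrad u x $ j)"
  using V0v_ess_bounded pgrad_V0v by blast

lemma aform_grad:
  assumes "u \<in> V" "v \<in> V"
  shows "aform \<Omega> \<T> \<alpha> \<beta> \<sigma> u (grad u) v (grad v) = a u v"
proof -
  have "bdd\<Omega> (\<lambda>x. (\<alpha> x *v grad u x) \<bullet> grad v x)"
    by (intro diffusion_ess_bounded grad_ess_bounded assms)
  then have "(LINT x:\<Omega>|lebesgue. (\<alpha> x *v grad u x) \<bullet> grad v x)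
      = (LINT x:\<Omega>|lebesgue. (\<alpha> x *v pgrad u x) \<bullet> pgrad v x)"
    unfolding ess_bounded_def
    by (intro set_integral_lebesgue_cong_AE AE_U_imp) (auto simp: pgrad_def)
  then show ?thesis by (simp add: a_def aform_def)
qed

lemma diffusion_symmetric:
  assumes "u \<in> V" "v \<in> V"
  shows "(LINT x:\<Omega>|lebesgue. (\<alpha> x *v pgrad u x) \<bullet> pgrad v x)
    = (LINT x:\<Omega>|lebesgue. (\<alpha> x *v pgrad v x) \<bullet> pgrad u x)"
proof (rule set_integral_lebesgue_cong_AE)
  show "set_borel_measurable lebesgue \<Omega> (\<lambda>x. (\<alpha> x *v pgrad u x) \<bullet> pgrad v x)"
    using diffusion_ess_bounded[OF pgrad_ess_bounded pgrad_ess_bounded] assms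
    by (simp add: ess_bounded_def)
  show "AE x in lebesgue. x \<in> \<Omega> \<longrightarrow> (\<alpha> x *v pgrad u x) \<bullet> pgrad v x = (\<alpha> x *v pgrad v x) \<bullet> pgrad u x"
    using \<alpha>_sym
  proof eventually_elim
    case (elim x)
    show ?case
    proof
      assume "x \<in> \<Omega>"
      then have "transpose (\<alpha> x) = \<alpha> x" using elim by (simp add: transpose_def vec_eq_iff)
      then show "(\<alpha> x *v pgrad u x) \<bullet> pgrad v x = (\<alpha> x *v pgrad v x) \<bullet> pgrad u x"
        by (metis dot_lmul_matrix inner_commute matrix_transpose_mul transpose_matrix_vector)
    qed
  qed
qed

lemma a_commute: "u \<in> V \<Longrightarrow> v \<in> V \<Longrightarrow> a u v = a v u"
  unfolding a_def aform_def using diffusion_symmetric[of u v] by (simp add: mult.assoc mult.commute[of "u _"])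

lemma a_linear: "u \<in> V \<Longrightarrow> linear_on V (a u)"
proof (rule linear_onI)
  fix v w assume V: "u \<in> V" "v \<in> V" "w \<in> V"
  have 1: "(LINT x:\<Omega>|lebesgue. (\<alpha> x *v pgrad u x) \<bullet> (pgrad v x + pgrad w x))
      = (LINT x:\<Omega>|lebesgue. (\<alpha> x *v pgrad u x) \<bullet> pgrad v x) + (LINT x:\<Omega>|lebesgue. (\<alpha> x *v pgrad u x) \<bullet> pgrad w x)"
    unfolding inner_add_right
    by (intro set_integral_add integrable_ess_bounded diffusion_ess_bounded pgrad_ess_bounded V)
  have 2: "(LINT x:\<Omega>|lebesgue. \<beta> x * u x * (v x + w x))
      = (LINT x:\<Omega>|lebesgue. \<beta> x * u x * v x) + (LINT x:\<Omega>|lebesgue. \<beta> x * u x * w x)"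
    unfolding distrib_left
    by (intro set_integral_add integrable_ess_bounded ess_bounded_mult \<beta> V1_ess_bounded_\<Omega> V)
  have 3: "(LINT x:frontier \<Omega>|S. \<sigma> x * u x * (v x + w x))
      = (LINT x:frontier \<Omega>|S. \<sigma> x * u x * v x) + (LINT x:frontier \<Omega>|S. \<sigma> x * u x * w x)"
    unfolding distrib_left
    by (intro set_integral_add integrable_S ess_bounded_mult \<sigma> V1_ess_bounded_S V frontier_sets)
  show "a u (v + w) = a u v + a u w"
    using 1 2 3 unfolding a_def aform_def pgrad_add[OF V(2,3)] by simp
next
  fix c v assume V: "u \<in> V" "v \<in> V"
  show "a u (c *\<^sub>R v) = c * a u v"
    unfolding a_def aform_def pgrad_scale[OF V(2)]
    by (simp add: mult.left_commute[of _ c] distrib_left)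
qed

lemma a_bilinear: "bilinear_on V a"
  by (intro bilinear_on_symI a_commute subspace_V1 a_linear)

definition H1 :: "(real^'n \<Rightarrow> real) \<Rightarrow> real" where
  "H1 u = H1norm2 \<Omega> u (pgrad u)"

lemma H1_eq: "H1 u = ip u u + vip (pgrad u) (pgrad u)"
  unfolding H1_def H1norm2_def ipO_def vipO_def power2_norm_eq_inner by (simp add: power2_eq_square)

lemma ipO_le_H1: "ip u u \<le> H1 u"
  using vipO_nonneg[of "pgrad u"] by (simp add: H1_eq)

lemma a_coercive: "u \<in> V \<Longrightarrow> c1 * H1 u \<le> a u u"
  unfolding H1_def a_def by (intro c1 V1_L2O V1_weak_grad V1_continuous)

lemma trace_bound: "u \<in> V \<Longrightarrow> sqrt (LINT x:frontier \<Omega>|S. (u x)\<^sup>2) \<le> c\<gamma> * sqrt (H1 u)"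
  unfolding H1_def by (intro c\<gamma> V1_L2O V1_weak_grad V1_continuous)

text \<open>Positivity comes from coercivity and definiteness of the L2 product. With the vertex
  functionals it yields unique solvability by Riesz representation.\<close>

sublocale a: form_space V a
proof
  show "0 < a u u" if "u \<in> V" "u \<noteq> 0" for u
  proof -
    have "0 < c1 * H1 u" using ipO_pos[OF that] ipO_le_H1[of u] c1(1) by simp
    then show ?thesis using a_coercive[OF that(1)] by linarith
  qed
qed (simp_all add: subspace_V1 a_bilinear a_commute)

lemma a_solvable:
  assumes "linear_on V l" shows "\<exists>!u. u \<in> V \<and> (\<forall>v\<in>V. a u v = l v)"
proof -
  obtain \<Lambda> where "finite_form_space V a \<Lambda>"
    using V1_finite_form_space[OF a.form_space_axioms] by blast
  then interpret finite_form_space V a \<Lambda> .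
  show ?thesis by (rule riesz[OF assms])
qed

section \<open>Solution operators, the adjoint identity and the reduced cost\<close>

definition solve :: "((real^'n \<Rightarrow> real) \<Rightarrow> real) \<Rightarrow> real^'n \<Rightarrow> real" where
  "solve l = (THE u. u \<in> V \<and> (\<forall>v\<in>V. a u v = l v))"

lemma solve:
  assumes "linear_on V l"
  shows "solve l \<in> V" "v \<in> V \<Longrightarrow> a (solve l) v = l v"
  using theI'[OF a_solvable[OF assms]] by (auto simp: solve_def)

lemma solve_unique:
  assumes "linear_on V l" "u \<in> V" "\<And>v. v \<in> V \<Longrightarrow> a u v = l v"
  shows "solve l = u"
  unfolding solve_def using assms by (intro the1_equality a_solvable) auto

definition sol :: "(real^'n \<Rightarrow> real) \<Rightarrow> real^'n \<Rightarrow> real" where "sol f = solve (ip f)"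

lemma ipO_linear_on: "f \<in> V \<Longrightarrow> linear_on V (ip f)"
  using bilinear_on_right[OF bilinear_ipO] .

lemma sol: "f \<in> V \<Longrightarrow> sol f \<in> V" "f \<in> V \<Longrightarrow> v \<in> V \<Longrightarrow> a (sol f) v = ip f v"
  unfolding sol_def by (simp_all add: solve ipO_linear_on)

lemma sol_add:
  assumes "f \<in> V" "g \<in> V" shows "sol (f + g) = sol f + sol g"
  unfolding sol_def[of "f + g"]
  using assms subspace_add[OF subspace_V1]
  by (intro solve_unique ipO_linear_on)
    (simp_all add: sol a.form_simps bilinear_on_simps[OF bilinear_ipO subspace_V1])

lemma sol_scale:
  assumes "f \<in> V" shows "sol (c *\<^sub>R f) = c *\<^sub>R sol f"
  unfolding sol_def[of "c *\<^sub>R f"]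
proof (intro solve_unique ipO_linear_on)
  show cf: "c *\<^sub>R f \<in> V" "c *\<^sub>R sol f \<in> V" using assms sol(1) subspace_scale[OF subspace_V1] by auto
  show "a (c *\<^sub>R sol f) v = ip (c *\<^sub>R f) v" if "v \<in> V" for v
    using a.form_simps(5)[OF sol(1)[OF assms] sol(1)[OF assms] that]
      bilinear_on_simps(5)[OF bilinear_ipO subspace_V1 assms assms that] sol(2)[OF assms that] by simp
qed

definition u0 :: "real^'n \<Rightarrow> real" where "u0 = solve J"

lemma u0: "u0 \<in> V" "v \<in> V \<Longrightarrow> a u0 v = J v"
  unfolding u0_def by (simp_all add: solve J)

text \<open>The state is affine in the control: \<open>sol\<close> is its linear part and
  \<open>u0\<close> the response to the boundary functional alone.\<close>

lemma uh_eq: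
  assumes "f \<in> V" shows "uh \<Omega> \<T> \<alpha> \<beta> \<sigma> J f = sol f + u0"
proof -
  have lin: "linear_on V (\<lambda>v. ip f v + J v)"
    using ipO_linear_on[OF assms] J by (auto simp: linear_on_def algebra_simps)
  have "uh \<Omega> \<T> \<alpha> \<beta> \<sigma> J f = solve (\<lambda>v. ip f v + J v)"
    unfolding uh_def solve_def using aform_grad by (intro arg_cong[where f=The] ext) auto
  also have "\<dots> = sol f + u0"
    using assms subspace_add[OF subspace_V1]
    by (intro solve_unique lin) (simp_all add: sol u0 a.form_simps)
  finally show ?thesis .
qed

text \<open>\<open>z\<close> is only square integrable and \<open>v\<close> only bounded, so the
  product is dominated through \<open>\<bar>z\<bar> \<le> 1 + z\<^sup>2\<close> on a set of finite
  measure.\<close>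

lemma integrable_mult_z:
  assumes "v \<in> V" shows "set_integrable S \<Gamma> (\<lambda>x. z x * v x)"
proof -
  obtain C where C: "0 \<le> C" "\<And>x. \<bar>v x\<bar> \<le> C" using V1_bounded[OF assms] by metis
  have vm: "set_borel_measurable S \<Gamma> v"
    using V1_ess_bounded_S[OF assms \<Gamma>_sets] by (simp add: ess_bounded_def)
  have "(\<lambda>x. (indicator \<Gamma> x *\<^sub>R z x) * (indicator \<Gamma> x *\<^sub>R v x)) \<in> borel_measurable S"
    using z(1) vm unfolding set_borel_measurable_def by (rule borel_measurable_times)
  moreover have "(\<lambda>x. (indicator \<Gamma> x *\<^sub>R z x) * (indicator \<Gamma> x *\<^sub>R v x)) = (\<lambda>x. indicator \<Gamma> x *\<^sub>R (z x * v x))"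
    by (auto simp: fun_eq_iff indicator_def)
  ultimately have m: "(\<lambda>x. indicator \<Gamma> x *\<^sub>R (z x * v x)) \<in> borel_measurable S" by simp
  have "set_integrable S \<Gamma> (\<lambda>x. C * (1 + (z x)\<^sup>2))"
    using z(2) integrable_S[OF ess_bounded_const[OF \<Gamma>_sets] \<Gamma>_sets]
    by (intro set_integrable_mult_right set_integral_add) auto
  then show ?thesis
    unfolding set_integrable_def
  proof (rule Bochner_Integration.integrable_bound[OF _ m])
    show "AE x in S. norm (indicator \<Gamma> x *\<^sub>R (z x * v x)) \<le> norm (indicator \<Gamma> x *\<^sub>R (C * (1 + (z x)\<^sup>2)))"
    proof (rule AE_I2)
      fix x
      have "\<bar>z x\<bar> \<le> 1 + (z x)\<^sup>2"
        using sum_squares_bound[of "\<bar>z x\<bar>" 1] zero_le_power2[of "z x"] by simp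
      then have "\<bar>z x\<bar> * \<bar>v x\<bar> \<le> (1 + (z x)\<^sup>2) * C"
        using C by (intro mult_mono) auto
      then show "norm (indicator \<Gamma> x *\<^sub>R (z x * v x)) \<le> norm (indicator \<Gamma> x *\<^sub>R (C * (1 + (z x)\<^sup>2)))"
        using C(1) by (auto simp: indicator_def abs_mult mult.commute)
    qed
  qed
qed

lemma integrable_mult_V:
  assumes "u \<in> V" "v \<in> V" "A \<in> sets S" shows "set_integrable S A (\<lambda>x. u x * v x)"
  using assms by (intro integrable_S ess_bounded_mult V1_ess_bounded_S)

definition zV :: "(real^'n \<Rightarrow> real) \<Rightarrow> real" where "zV v = bip \<Omega> \<T> \<Gamma> z v"

lemma zV_linear: "linear_on V zV"
proof (rule linear_onI)
  fix v w assume "v \<in> V" "w \<in> V"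
  then show "zV (v + w) = zV v + zV w"
    unfolding zV_def bip_def plus_fun_apply distrib_left
    by (intro set_integral_add integrable_mult_z)
next
  fix c v show "zV (c *\<^sub>R v) = c * zV v"
    by (simp add: zV_def bip_def mult.left_commute[of _ c])
qed

definition b :: "(real^'n \<Rightarrow> real) \<Rightarrow> (real^'n \<Rightarrow> real) \<Rightarrow> real" where "b = bip \<Omega> \<T> \<Gamma>"

lemma b_bilinear: "bilinear_on V b"
proof (intro bilinear_on_symI subspace_V1 linear_onI)
  show "b u v = b v u" for u v by (simp add: b_def bip_def mult.commute)
  show "b u (v + w) = b u v + b u w" if "u \<in> V" "v \<in> V" "w \<in> V" for u v w
    unfolding b_def bip_def plus_fun_apply distrib_left
    using that by (intro set_integral_add integrable_mult_V \<Gamma>_sets)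
  show "b u (c *\<^sub>R v) = c * b u v" for u v c
    by (simp add: b_def bip_def mult.left_commute[of _ c])
qed

lemma b_commute: "b u v = b v u"
  by (simp add: b_def bip_def mult.commute)

lemma b_nonneg: "0 \<le> b u u"
  unfolding b_def bip_def set_lebesgue_integral_def by (intro Bochner_Integration.integral_nonneg) auto

lemma bip_minus_z:
  assumes "u \<in> V" "v \<in> V"
  shows "bip \<Omega> \<T> \<Gamma> (\<lambda>x. u x - z x) v = b u v - zV v"
  unfolding b_def zV_def bip_def left_diff_distrib
  by (intro set_integral_diff integrable_mult_V integrable_mult_z \<Gamma>_sets assms)

lemma uha_eq:
  assumes f: "f \<in> V"
  shows "adj f = solve (\<lambda>v. b (sol f + u0) v - zV v)"
    and "linear_on V (\<lambda>v. b (sol f + u0) v - zV v)"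
proof -
  have V: "sol f + u0 \<in> V" using sol(1)[OF f] u0(1) subspace_add[OF subspace_V1] by blast
  show "linear_on V (\<lambda>v. b (sol f + u0) v - zV v)"
    using bilinear_on_right[OF b_bilinear V] zV_linear by (auto simp: linear_on_def algebra_simps)
  show "adj f = solve (\<lambda>v. b (sol f + u0) v - zV v)"
    unfolding uha_def solve_def uh_eq[OF f] using aform_grad bip_minus_z[OF V]
    by (intro arg_cong[where f=The] ext) auto
qed

text \<open>The Hessian of the misfit as a function of the control; \<open>l\<close> below is its
  derivative at the zero control.\<close>

definition Q :: "(real^'n \<Rightarrow> real) \<Rightarrow> (real^'n \<Rightarrow> real) \<Rightarrow> real" where "Q f g = b (sol f) (sol g)"

definition l :: "(real^'n \<Rightarrow> real) \<Rightarrow> real" where "l g = b u0 (sol g) - zV (sol g)"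

lemma Q_commute: "Q f g = Q g f"
  by (simp add: Q_def b_commute)

lemma Q_bilinear: "bilinear_on V Q"
  by (intro bilinear_on_symI[OF Q_commute] subspace_V1 linear_onI; unfold Q_def)
    (simp_all add: sol sol_add sol_scale linear_on_add[OF bilinear_on_right[OF b_bilinear]]
      linear_on_scale[OF bilinear_on_right[OF b_bilinear]])

lemma l_linear: "linear_on V l"
  by (intro linear_onI; unfold l_def)
    (simp_all add: sol u0 sol_add sol_scale linear_on_add[OF bilinear_on_right[OF b_bilinear]]
      linear_on_scale[OF bilinear_on_right[OF b_bilinear]]
      linear_on_add[OF zV_linear] linear_on_scale[OF zV_linear] algebra_simps)

text \<open>The adjoint trick: \<open>g\<close> is replaced by the left side of the equation for
  \<open>sol g\<close>, symmetry swaps the arguments, and the adjoint equation evaluates the result.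
  Hence the adjoint state represents the gradient of the misfit.\<close>

lemma ipO_uha:
  assumes f: "f \<in> V" and g: "g \<in> V"
  shows "adj f \<in> V" "ip g (adj f) = Q f g + l g"
proof -
  define w where "w = adj f"
  have w: "w \<in> V" "\<And>v. v \<in> V \<Longrightarrow> a w v = b (sol f + u0) v - zV v"
    unfolding w_def uha_eq(1)[OF f] by (simp_all add: solve uha_eq(2)[OF f])
  then show "adj f \<in> V" by (simp add: w_def)
  have "ip g w = a (sol g) w" using sol(2)[OF g w(1)] by simp
  also have "\<dots> = a w (sol g)" using a_commute sol(1)[OF g] w(1) by blast
  also have "\<dots> = b (sol f + u0) (sol g) - zV (sol g)" using w(2) sol(1)[OF g] by blast
  also have "\<dots> = Q f g + l g"
    using sol(1)[OF f] sol(1)[OF g] u0(1)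
    by (simp add: Q_def l_def bilinear_on_simps[OF b_bilinear subspace_V1])
  finally show "ip g (adj f) = Q f g + l g" by (simp add: w_def)
qed

text \<open>Coercivity and Cauchy-Schwarz bound the energy of \<open>sol f\<close> by the control,
  the trace inequality bounds its boundary values by the energy, and \<open>\<Gamma>\<close> is part
  of the boundary. This is the Lipschitz constant in the step size condition.\<close>

lemma Q_bound:
  assumes f: "f \<in> V" shows "Q f f \<le> c\<gamma>\<^sup>2 / c1\<^sup>2 * ip f f"
proof -
  define s where "s = sol f"
  have s: "s \<in> V" using sol(1)[OF f] by (simp add: s_def)
  have H0: "0 \<le> H1 s" using ipO_le_H1[of s] ipO_nonneg[of s] by linarith
  have "(ip f s)\<^sup>2 \<le> ip f f * ip s s"
    by (rule psd_cauchy_schwarz[OF bilinear_ipO subspace_V1 f s ipO_commute ipO_nonneg])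
  also have "\<dots> \<le> ip f f * H1 s" using ipO_le_H1 ipO_nonneg by (intro mult_left_mono)
  finally have cs: "(ip f s)\<^sup>2 \<le> ip f f * H1 s" .
  have "c1 * H1 s \<le> ip f s" using a_coercive[OF s] sol(2)[OF f s] by (simp add: s_def)
  then have "(c1 * H1 s)\<^sup>2 \<le> (ip f s)\<^sup>2" using H0 c1(1) by (intro power_mono) auto
  then have "(c1\<^sup>2 * H1 s) * H1 s \<le> ip f f * H1 s" using cs by (simp add: power2_eq_square mult_ac)
  \<comment> \<open>The factor \<open>H1 s\<close> common to both sides is cancelled; if it is zero
    the claim is immediate.\<close>
  then have H: "H1 s \<le> ip f f / c1\<^sup>2"
    using H0 c1(1) ipO_nonneg[of f]
    by (cases "H1 s = 0") (auto simp: field_simps mult_le_cancel_right)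
  have int: "set_integrable S A (\<lambda>x. (s x)\<^sup>2)" if "A \<in> sets S" for A
    using integrable_mult_V[OF s s that] by (simp add: power2_eq_square)
  have "Q f f = (LINT x:\<Gamma>|S. (s x)\<^sup>2)" by (simp add: Q_def b_def bip_def s_def power2_eq_square)
  also have "\<dots> \<le> (LINT x:frontier \<Omega>|S. (s x)\<^sup>2)"
    using int[OF \<Gamma>_sets] int[OF frontier_sets] \<Gamma>_subset
    unfolding set_lebesgue_integral_def set_integrable_def
    by (intro integral_mono) (auto simp: indicator_def)
  also have "\<dots> \<le> c\<gamma>\<^sup>2 * H1 s"
  proof -
    have "0 \<le> (LINT x:frontier \<Omega>|S. (s x)\<^sup>2)"
      unfolding set_lebesgue_integral_def by (intro Bochner_Integration.integral_nonneg) auto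
    moreover have "(sqrt (LINT x:frontier \<Omega>|S. (s x)\<^sup>2))\<^sup>2 \<le> (c\<gamma> * sqrt (H1 s))\<^sup>2"
      using trace_bound[OF s] calculation by (intro power_mono) auto
    ultimately show ?thesis using H0 by (simp add: power_mult_distrib)
  qed
  also have "\<dots> \<le> c\<gamma>\<^sup>2 * (ip f f / c1\<^sup>2)" using H by (intro mult_left_mono) auto
  finally show ?thesis by simp
qed

text \<open>Separates a part independent of \<open>f\<close>, so that comparing costs involves only
  \<open>Q\<close>, \<open>l\<close> and the total variation.\<close>

lemma cost_eq:
  assumes f: "f \<in> V"
  shows "cost \<Omega> \<T> \<Gamma> \<alpha> \<beta> \<sigma> J z \<rho> f
    = Q f f / 2 + l f + (b u0 u0 / 2 - zV u0 + bip \<Omega> \<T> \<Gamma> z z / 2) + \<rho> * TV \<Omega> f"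
proof -
  define u where "u = sol f + u0"
  have u: "u \<in> V" using sol(1)[OF f] u0(1) subspace_add[OF subspace_V1] by (simp add: u_def)
  have zz: "set_integrable S \<Gamma> (\<lambda>x. z x * z x)" using z(2) by (simp add: power2_eq_square)
  have "bip \<Omega> \<T> \<Gamma> (\<lambda>x. u x - z x) (\<lambda>x. u x - z x)
      = (LINT x:\<Gamma>|S. (u x * u x - z x * u x) - (z x * u x - z x * z x))"
    by (simp add: bip_def algebra_simps)
  also have "\<dots> = (b u u - zV u) - (zV u - bip \<Omega> \<T> \<Gamma> z z)"
  proof -
    note int = integrable_mult_V[OF u u \<Gamma>_sets] integrable_mult_z[OF u] zz
    show ?thesis
      unfolding b_def zV_def bip_def
      by (subst set_integral_diff(2), (intro set_integral_diff(1) int)+)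
        (simp add: set_integral_diff(2)[OF int(1,2)] set_integral_diff(2)[OF int(2,3)])
  qed
  also have "\<dots> = Q f f + 2 * l f + (b u0 u0 - 2 * zV u0 + bip \<Omega> \<T> \<Gamma> z z)"
    using sol(1)[OF f] u0(1) b_commute[of "sol f" u0] subspace_add[OF subspace_V1]
    by (simp add: Q_def l_def u_def bilinear_on_simps[OF b_bilinear subspace_V1]
        linear_on_add[OF zV_linear])
  finally show ?thesis by (simp add: cost_def uh_eq[OF f] u_def)
qed

end

section \<open>The primal-dual iteration\<close>

lemma quadratic_form_nonneg:
  fixes a b \<kappa> X Y :: real
  assumes "0 < a" "\<kappa>\<^sup>2 \<le> a * b"
  shows "2 * \<kappa> * X * Y \<le> a * X\<^sup>2 + b * Y\<^sup>2"
proof -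
  have "0 \<le> (a * X - \<kappa> * Y)\<^sup>2 + (a * b - \<kappa>\<^sup>2) * Y\<^sup>2"
    using assms by simp
  also have "\<dots> = a * (a * X\<^sup>2 + b * Y\<^sup>2 - 2 * \<kappa> * X * Y)"
    by (simp add: power2_eq_square algebra_simps)
  finally show ?thesis using assms(1) by (simp add: zero_le_mult_iff)
qed

text \<open>The form stays semidefinite after \<open>c\<close> is subtracted on the diagonal. The
  strict determinant condition leaves room for this.\<close>

lemma quadratic_form_coercive:
  fixes a b \<kappa> :: real
  assumes "0 < a" "0 < b" "\<kappa>\<^sup>2 < a * b"
  obtains c where "0 < c" "\<And>X Y. c * (X\<^sup>2 + Y\<^sup>2) \<le> a * X\<^sup>2 - 2 * \<kappa> * X * Y + b * Y\<^sup>2"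
proof
  \<comment> \<open>Determinant over trace: subtracting this \<open>c\<close> on the diagonal leaves
    a matrix with determinant exactly \<open>c\<^sup>2\<close> and positive upper left
    entry.\<close>
  define c where "c = (a * b - \<kappa>\<^sup>2) / (a + b)"
  have ab: "0 < a + b" using assms by simp
  show "0 < c" using assms by (simp add: c_def)
  have c: "c * (a + b) = a * b - \<kappa>\<^sup>2" using ab by (simp add: c_def)
  have "(a - c) * (a + b) = a\<^sup>2 + \<kappa>\<^sup>2" using c by (simp add: algebra_simps power2_eq_square)
  then have "0 < a - c" using ab assms(1) by (metis add_pos_nonneg zero_less_mult_pos2 zero_less_power zero_le_power2)
  moreover have "(a - c) * (b - c) = \<kappa>\<^sup>2 + c\<^sup>2" using c by (simp add: algebra_simps power2_eq_square)
  then have "\<kappa>\<^sup>2 \<le> (a - c) * (b - c)" by simp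
  ultimately show "c * (X\<^sup>2 + Y\<^sup>2) \<le> a * X\<^sup>2 - 2 * \<kappa> * X * Y + b * Y\<^sup>2" for X Y
    using quadratic_form_nonneg[of "a - c" \<kappa> "b - c" X Y] by (simp add: algebra_simps)
qed

locale primal_dual = elliptic \<Omega> \<T> \<Gamma> \<alpha> \<beta> \<sigma> z J c1 c\<gamma>
  for \<Omega> \<Gamma> :: "(real^'n) set" and \<T> \<alpha> \<beta> \<sigma> z J c1 c\<gamma> +
  fixes lo hi \<rho> \<tau> \<theta> :: real
    and f :: "nat \<Rightarrow> real^'n \<Rightarrow> real" and p :: "nat \<Rightarrow> real^'n \<Rightarrow> real^'n"
  assumes \<rho>: "0 < \<rho>" and \<tau>: "0 < \<tau>" and \<theta>: "0 < \<theta>"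
    and stepsize: "\<rho>\<^sup>2 * (gnorm)\<^sup>2 < (1 / \<tau> - c\<gamma>\<^sup>2 / c1\<^sup>2) * (\<theta> / \<tau>)"
    and init: "f 0 \<in> Fadh \<Omega> \<T> lo hi" "p 0 \<in> W"
    and f_Suc: "f (Suc n) \<in> Fadh \<Omega> \<T> lo hi"
    and f_min: "g \<in> Fadh \<Omega> \<T> lo hi \<Longrightarrow>
          ip (f (Suc n)) (adj (f n)) + \<rho> * vip (grad (f (Suc n))) (p n)
            + 1 / (2 * \<tau>) * (nrm (\<lambda>x. f (Suc n) x - f n x))\<^sup>2
          \<le> ip g (adj (f n)) + \<rho> * vip (grad g) (p n)
            + 1 / (2 * \<tau>) * (nrm (\<lambda>x. g x - f n x))\<^sup>2"
    and p_Suc: "p (Suc n) \<in> W"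
    and p_max: "q \<in> W \<Longrightarrow>
          ereal (\<rho> * vip (grad (\<lambda>x. 2 * f (Suc n) x - f n x)) q
                 - \<theta> / (2 * \<tau>) * (vnrm (\<lambda>x. q x - p n x))\<^sup>2) - indB1 \<T> q
          \<le> ereal (\<rho> * vip (grad (\<lambda>x. 2 * f (Suc n) x - f n x)) (p (Suc n))
                 - \<theta> / (2 * \<tau>) * (vnrm (\<lambda>x. p (Suc n) x - p n x))\<^sup>2) - indB1 \<T> (p (Suc n))"
begin

abbreviation "F \<equiv> Fadh \<Omega> \<T> lo hi"
abbreviation "tcost \<equiv> cost \<Omega> \<T> \<Gamma> \<alpha> \<beta> \<sigma> J z \<rho>"

text \<open>Bounded variation is automatic in \<open>V1\<close>, so only the pointwise bounds remain
  as a constraint; convexity and closedness are read off from them.\<close>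

lemma F_iff: "u \<in> F \<longleftrightarrow> u \<in> V \<and> (AE x in lebesgue. x \<in> \<Omega> \<longrightarrow> u x \<in> {lo..hi})"
  using V1_BV[of u] by (auto simp: Fadh_def Fad_def)

lemma F_V: "u \<in> F \<Longrightarrow> u \<in> V"
  by (simp add: F_iff)

lemma B1_W: "q \<in> B1 \<T> \<Longrightarrow> q \<in> W"
  by (simp add: B1_def)

lemma fF: "f n \<in> F"
  using init(1) f_Suc by (cases n) auto

lemma fV: "f n \<in> V"
  using fF F_V by blast

lemma pW: "p n \<in> W"
  using init(2) p_Suc by (cases n) auto

lemma convex_F: "convex F"
proof (rule convexI)
  fix u v and s t :: real assume u: "u \<in> F" and v: "v \<in> F" and st: "0 \<le> s" "0 \<le> t" "s + t = 1"
  have "s *\<^sub>R u + t *\<^sub>R v \<in> V"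
    using u v F_V subspace_V1 by (intro subspace_add subspace_scale) auto
  moreover have "AE x in lebesgue. x \<in> \<Omega> \<longrightarrow> u x \<in> {lo..hi}" "AE x in lebesgue. x \<in> \<Omega> \<longrightarrow> v x \<in> {lo..hi}"
    using u v by (simp_all add: F_iff)
  then have "AE x in lebesgue. x \<in> \<Omega> \<longrightarrow> s *\<^sub>R u x + t *\<^sub>R v x \<in> {lo..hi}"
    by eventually_elim (use convexD[OF convex_real_interval(5), of _ lo hi _ s t] st in blast)
  ultimately show "s *\<^sub>R u + t *\<^sub>R v \<in> F" by (simp add: F_iff)
qed

lemma convex_B1: "convex (B1 \<T>)"
proof (rule convexI)
  fix q r and s t :: real assume q: "q \<in> B1 \<T>" and r: "r \<in> B1 \<T>" and st: "0 \<le> s" "0 \<le> t" "s + t = 1"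
  have "s *\<^sub>R q + t *\<^sub>R r \<in> W"
    using q r B1_W subspace_V0v by (intro subspace_add subspace_scale) auto
  moreover have "\<bar>(s *\<^sub>R q + t *\<^sub>R r) x $ j\<bar> \<le> 1" for x j
  proof -
    have "q x $ j \<in> {-1..1}" "r x $ j \<in> {-1..1}" using q r by (auto simp: B1_def abs_le_iff minus_le_iff)
    then have "s *\<^sub>R (q x $ j) + t *\<^sub>R (r x $ j) \<in> {-1..1}"
      using st by (intro convexD[OF convex_real_interval(5)])
    then show ?thesis by (simp add: abs_le_iff)
  qed
  ultimately show "s *\<^sub>R q + t *\<^sub>R r \<in> B1 \<T>" by (simp add: B1_def)
qed

lemma zero_B1: "0 \<in> B1 \<T>"
  using subspace_0[OF subspace_V0v] by (simp add: B1_def)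

lemma nrmO_power2: "(nrm u)\<^sup>2 = ip u u"
  by (simp add: nrmO_def ipO_nonneg)

lemma vnrmO_power2: "(vnrm q)\<^sup>2 = vip q q"
  by (simp add: vnrmO_def vipO_nonneg)

text \<open>Outside \<open>B1\<close> the objective equals minus infinity, while it is finite at
  0.\<close>

lemma p_Suc_B1: "p (Suc n) \<in> B1 \<T>"
proof (rule ccontr)
  assume "p (Suc n) \<notin> B1 \<T>"
  then show False
    using p_max[OF B1_W[OF zero_B1], of n] zero_B1 by (simp add: indB1_def zero_fun_def)
qed

lemma f_variational:
  assumes g: "g \<in> F"
  shows "0 \<le> Q (f n) (g - f (Suc n)) + l (g - f (Suc n)) + \<rho> * D (g - f (Suc n)) (p n)
    + 1 / \<tau> * ip (f (Suc n) - f n) (g - f (Suc n))"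
proof -
  note Dl = D_left_linear[OF pW[of n]] and Ql = bilinear_on_right[OF Q_bilinear fV[of n]]
  have lin: "linear_on V (\<lambda>h. Q (f n) h + l h + \<rho> * D h (p n))"
    by (intro linear_onI) (simp_all add: linear_on_add[OF Dl] linear_on_scale[OF Dl]
        linear_on_add[OF Ql] linear_on_scale[OF Ql] linear_on_add[OF l_linear]
        linear_on_scale[OF l_linear] algebra_simps)
  \<comment> \<open>The adjoint identity turns the term with the adjoint state into the explicit
    evaluation of \<open>Q\<close> at \<open>f n\<close>; this is where the forward step
    appears.\<close>
  have obj: "ip h (adj (f n)) + \<rho> * vip (grad h) (p n)
        + 1 / (2 * \<tau>) * (nrm (\<lambda>x. h x - f n x))\<^sup>2
      = Q (f n) h + l h + \<rho> * D h (p n) + (1 / \<tau>) / 2 * ip (h - f n) (h - f n)" if "h \<in> V" for h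
    using that fV pW by (simp add: ipO_uha vipO_grad D_def nrmO_power2 fun_diff_def)
  have "0 \<le> Q (f n) (g - f (Suc n)) + l (g - f (Suc n)) + \<rho> * D (g - f (Suc n)) (p n)
      + (1 / \<tau>) * ip (f (Suc n) - f n) (g - f (Suc n))"
  proof (rule quadratic_first_order[OF bilinear_ipO subspace_V1 ipO_commute lin _ convex_F fV f_Suc _ g])
    show "F \<subseteq> V" using F_V by blast
    show "Q (f n) (f (Suc n)) + l (f (Suc n)) + \<rho> * D (f (Suc n)) (p n)
        + (1 / \<tau>) / 2 * ip (f (Suc n) - f n) (f (Suc n) - f n)
      \<le> Q (f n) h + l h + \<rho> * D h (p n) + (1 / \<tau>) / 2 * ip (h - f n) (h - f n)" if "h \<in> F" for h
      using f_min[OF that, of n] by (simp only: obj fV F_V[OF that])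
  qed
  then show ?thesis by simp
qed

text \<open>The maximisation is negated so that \<open>quadratic_first_order\<close> applies; inside
  \<open>B1\<close> the indicator is 0 and drops out on both sides.\<close>

lemma p_variational:
  assumes q: "q \<in> B1 \<T>"
  shows "0 \<le> - \<rho> * D (2 *\<^sub>R f (Suc n) - f n) (q - p (Suc n))
    + \<theta> / \<tau> * vip (p (Suc n) - p n) (q - p (Suc n))"
proof -
  define e where "e = 2 *\<^sub>R f (Suc n) - f n"
  have e: "e \<in> V" using fV subspace_V1 by (simp add: e_def subspace_diff subspace_scale)
  have e_eq: "(\<lambda>x. 2 * f (Suc n) x - f n x) = e" by (simp add: e_def fun_eq_iff)
  note De = D_right_linear[OF e]
  have lin: "linear_on W (\<lambda>r. - \<rho> * D e r)"
    by (intro linear_onI) (simp_all add: linear_on_add[OF De] linear_on_scale[OF De] algebra_simps)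
  have "0 \<le> - \<rho> * D e (q - p (Suc n)) + \<theta> / \<tau> * vip (p (Suc n) - p n) (q - p (Suc n))"
  proof (rule quadratic_first_order[OF bilinear_vipO subspace_V0v vipO_commute lin _ convex_B1 pW p_Suc_B1 _ q])
    show "B1 \<T> \<subseteq> W" using B1_W by blast
    show "- \<rho> * D e (p (Suc n)) + \<theta> / \<tau> / 2 * vip (p (Suc n) - p n) (p (Suc n) - p n)
        \<le> - \<rho> * D e r + \<theta> / \<tau> / 2 * vip (r - p n) (r - p n)" if "r \<in> B1 \<T>" for r
      using p_max[OF B1_W[OF that], of n] that p_Suc_B1[of n]
      by (simp add: e_eq indB1_def vipO_grad[OF e] B1_W pW D_def vnrmO_power2 fun_diff_def)
  qed
  then show ?thesis by (simp add: e_def)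
qed

text \<open>\<open>Mz\<close> is the metric of the Condat-Vu splitting.\<close>

definition "Z = V \<times> W"
definition "Mz x y = 1 / \<tau> * ip (fst x) (fst y) - \<rho> * D (fst x) (snd y) - \<rho> * D (fst y) (snd x)
  + \<theta> / \<tau> * vip (snd x) (snd y)"
definition "Kz x y = \<rho> * D (fst y) (snd x) - \<rho> * D (fst x) (snd y)"
definition "Qz x y = Q (fst x) (fst y)"
definition "lz x = l (fst x)"
definition "\<mu> n = (f n, p n)"
abbreviation "sqn x \<equiv> ip (fst x) (fst x) + vip (snd x) (snd x)"

lemma subspace_Z: "subspace Z"
  unfolding Z_def by (intro subspace_Times subspace_V1 subspace_V0v)

lemma Z_D: "x \<in> Z \<Longrightarrow> fst x \<in> V" "x \<in> Z \<Longrightarrow> snd x \<in> W"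
  by (auto simp: Z_def)

lemma Mz_commute: "Mz x y = Mz y x"
  by (simp add: Mz_def ipO_commute[of "fst x"] vipO_commute[of "snd x"])

lemmas ip_simps = linear_on_add[OF bilinear_on_right[OF bilinear_ipO]]
  linear_on_scale[OF bilinear_on_right[OF bilinear_ipO]]
  linear_on_add[OF bilinear_on_right[OF bilinear_vipO]]
  linear_on_scale[OF bilinear_on_right[OF bilinear_vipO]]

lemma bilinear_Mz: "bilinear_on Z Mz"
  by (intro bilinear_on_symI[OF Mz_commute] subspace_Z linear_onI; unfold Mz_def)
    (simp_all add: Z_D ip_simps D_simps algebra_simps)

lemma bilinear_Kz: "bilinear_on Z Kz"
  unfolding bilinear_on_def
  by (intro ballI conjI linear_onI; unfold Kz_def)
    (simp_all add: Z_D D_simps algebra_simps)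

lemma bilinear_Qz: "bilinear_on Z Qz"
  unfolding bilinear_on_def Qz_def
  by (intro ballI conjI linear_onI)
    (simp_all add: Z_D linear_on_add[OF bilinear_on_right[OF Q_bilinear]]
      linear_on_scale[OF bilinear_on_right[OF Q_bilinear]]
      linear_on_add[OF bilinear_on_left[OF Q_bilinear]]
      linear_on_scale[OF bilinear_on_left[OF Q_bilinear]])

lemma linear_lz: "linear_on Z lz"
  unfolding lz_def
  by (intro linear_onI) (simp_all add: Z_D linear_on_add[OF l_linear] linear_on_scale[OF l_linear])

text \<open>By \<open>D_bound\<close> and \<open>Q_bound\<close> the difference of the two forms
  dominates a quadratic form in the two norms, whose determinant is positive exactly by the step
  size condition. That condition also forces \<open>1 / \<tau>\<close> above the Lipschitz constant,
  since the product is positive and \<open>\<theta> / \<tau>\<close> is.\<close>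

lemma Mz_coercive:
  obtains c where "0 < c"
    "\<And>x. x \<in> Z \<Longrightarrow> Qz x x + c * sqn x \<le> Mz x x"
proof -
  define L where "L = c\<gamma>\<^sup>2 / c1\<^sup>2"
  define \<kappa> where "\<kappa> = \<rho> * \<bar>gnorm\<bar>"
  have b: "0 < \<theta> / \<tau>" using \<tau> \<theta> by simp
  have k: "\<kappa>\<^sup>2 < (1 / \<tau> - L) * (\<theta> / \<tau>)"
    using stepsize by (simp add: \<kappa>_def L_def power_mult_distrib)
  then have "0 < (1 / \<tau> - L) * (\<theta> / \<tau>)" using zero_le_power2[of \<kappa>] by linarith
  then have a: "0 < 1 / \<tau> - L" using b by (metis zero_less_mult_pos2)
  obtain c where c: "0 < c"
    "\<And>X Y. c * (X\<^sup>2 + Y\<^sup>2) \<le> (1 / \<tau> - L) * X\<^sup>2 - 2 * \<kappa> * X * Y + (\<theta> / \<tau>) * Y\<^sup>2"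
    using quadratic_form_coercive[OF a b k] by metis
  show ?thesis
  proof (rule that[OF c(1)])
    fix x assume x: "x \<in> Z"
    define X Y where "X = sqrt (ip (fst x) (fst x))" and "Y = sqrt (vip (snd x) (snd x))"
    have X2: "X\<^sup>2 = ip (fst x) (fst x)" and Y2: "Y\<^sup>2 = vip (snd x) (snd x)"
      by (simp_all add: X_def Y_def ipO_nonneg vipO_nonneg)
    have "\<rho> * D (fst x) (snd x) \<le> \<rho> * (\<bar>gnorm\<bar> * X * Y)"
      using D_bound[OF Z_D[OF x]] \<rho> by (intro mult_left_mono) (auto simp: X_def Y_def)
    then have "\<rho> * D (fst x) (snd x) \<le> \<kappa> * X * Y" by (simp add: \<kappa>_def mult.assoc)
    moreover have "Qz x x \<le> L * X\<^sup>2"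
      using Q_bound[OF Z_D(1)[OF x]] by (simp add: Qz_def L_def X2)
    moreover have "Mz x x = 1 / \<tau> * X\<^sup>2 - 2 * (\<rho> * D (fst x) (snd x)) + \<theta> / \<tau> * Y\<^sup>2"
      by (simp add: Mz_def X2 Y2)
    ultimately have "Qz x x + c * (X\<^sup>2 + Y\<^sup>2) \<le> Mz x x"
      using c(2)[of X Y] by (simp add: left_diff_distrib)
    then show "Qz x x + c * sqn x \<le> Mz x x"
      by (simp add: X2 Y2)
  qed
qed

lemma Qz_nonneg: "0 \<le> Qz x x"
  by (simp add: Qz_def Q_def b_nonneg)

lemma form_space_Mz: "form_space Z Mz"
proof
  show "0 < Mz x x" if x: "x \<in> Z" "x \<noteq> 0" for x
  proof -
    obtain c where c: "0 < c"
      "Qz x x + c * sqn x \<le> Mz x x"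
      using Mz_coercive x(1) by metis
    have "fst x \<noteq> 0 \<or> snd x \<noteq> 0" using x(2) by (simp add: prod_eq_iff)
    then have "0 < sqn x"
      using ipO_pos[OF Z_D(1)[OF x(1)]] vipO_pos[OF Z_D(2)[OF x(1)]] ipO_nonneg[of "fst x"]
        vipO_nonneg[of "snd x"] by (smt (verit))
    then have "0 < c * sqn x" using c(1) by simp
    then show ?thesis using c(2) Qz_nonneg[of x] by linarith
  qed
qed (use subspace_Z bilinear_Mz Mz_commute in auto)

lemma finite_form_space_Mz: "\<exists>\<Lambda>. finite_form_space Z Mz \<Lambda>"
proof -
  obtain N where N: "finite N" "\<And>u. u \<in> V \<Longrightarrow> (\<And>x. x \<in> N \<Longrightarrow> u x = 0) \<Longrightarrow> u = 0"
    using V1_separating_points by metis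
  obtain N' where N': "finite N'" "\<And>q. q \<in> W \<Longrightarrow> (\<And>x. x \<in> N' \<Longrightarrow> q x = 0) \<Longrightarrow> q = 0"
    using V0v_separating_points by metis
  define \<Lambda> :: "((real^'n \<Rightarrow> real) \<times> (real^'n \<Rightarrow> real^'n) \<Rightarrow> real) set"
    where "\<Lambda> = (\<lambda>x w. fst w x) ` N \<union> (\<lambda>(x, j) w. snd w x $ j) ` (N' \<times> UNIV)"
  interpret form_space Z Mz by (rule form_space_Mz)
  have "finite_form_space Z Mz \<Lambda>"
  proof
    show "finite \<Lambda>" using N(1) N'(1) by (simp add: \<Lambda>_def)
    show "linear_on Z h" if "h \<in> \<Lambda>" for h
      using that by (auto simp: \<Lambda>_def linear_on_def)
    fix w assume w: "w \<in> Z" and 0: "\<And>h. h \<in> \<Lambda> \<Longrightarrow> h w = 0"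
    have "fst w x = 0" if "x \<in> N" for x
      using 0[of "\<lambda>w. fst w x"] that by (auto simp: \<Lambda>_def)
    then have "fst w = 0" using N(2) Z_D(1)[OF w] by blast
    moreover have "snd w x $ j = 0" if "x \<in> N'" for x j
      using 0[of "\<lambda>w. snd w x $ j"] that by (force simp: \<Lambda>_def)
    then have "snd w = 0" using N'(2) Z_D(2)[OF w] by (simp add: vec_eq_iff)
    ultimately show "w = 0" by (simp add: prod_eq_iff)
  qed
  then show ?thesis by blast
qed

lemma ipO_bounded_F: "\<exists>R. \<forall>u\<in>F. ip u u \<le> R"
proof (intro exI ballI)
  fix u assume u: "u \<in> F"
  define m where "m = max \<bar>lo\<bar> \<bar>hi\<bar>"
  have ae: "AE x in lebesgue. x \<in> \<Omega> \<longrightarrow> u x \<in> {lo..hi}" using u by (simp add: F_iff)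
  have int: "set_integrable lebesgue \<Omega> (\<lambda>x. u x * u x)"
    by (intro integrable_ess_bounded ess_bounded_mult V1_ess_bounded_\<Omega> F_V u)
  have c: "set_integrable lebesgue \<Omega> (\<lambda>x. m * m)"
    by (intro integrable_ess_bounded ess_bounded_const sets_\<Omega>)
  show "ip u u \<le> (LINT x:\<Omega>|lebesgue. m * m)"
    unfolding ipO_def set_lebesgue_integral_def
  proof (rule integral_mono_AE)
    show "AE x in lebesgue. indicat_real \<Omega> x *\<^sub>R (u x * u x) \<le> indicat_real \<Omega> x *\<^sub>R (m * m)"
      using ae
    proof eventually_elim
      case (elim x)
      have "u x * u x \<le> m * m" if "x \<in> \<Omega>"
      proof -
        have "\<bar>u x\<bar> \<le> m" using elim that by (auto simp: m_def)
        then have "\<bar>u x\<bar> * \<bar>u x\<bar> \<le> m * m" by (intro mult_mono) auto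
        then show ?thesis by simp
      qed
      then show ?case by (auto simp: indicator_def)
    qed
  qed (use int c in \<open>auto simp: set_integrable_def\<close>)
qed

lemma vipO_bounded_B1: "\<exists>R. \<forall>q\<in>B1 \<T>. vip q q \<le> R"
proof (intro exI ballI)
  fix q assume q: "q \<in> B1 \<T>"
  show "vip q q \<le> (LINT x:\<Omega>|lebesgue. real CARD('n))"
    unfolding vipO_def
  proof (rule set_integral_mono)
    show "set_integrable lebesgue \<Omega> (\<lambda>x. q x \<bullet> q x)"
      by (intro integrable_ess_bounded ess_bounded_inner sets_\<Omega> V0v_ess_bounded B1_W q)
    show "set_integrable lebesgue \<Omega> (\<lambda>x. real CARD('n))"
      by (intro integrable_ess_bounded ess_bounded_const sets_\<Omega>)
    show "q x \<bullet> q x \<le> real CARD('n)" for x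
    proof -
      have "q x $ j * q x $ j \<le> 1" for j
      proof -
        have "\<bar>q x $ j\<bar> \<le> 1" using q by (simp add: B1_def)
        then have "\<bar>q x $ j\<bar> * \<bar>q x $ j\<bar> \<le> 1 * 1" by (intro mult_mono) auto
        then show ?thesis by simp
      qed
      then have "q x \<bullet> q x \<le> (\<Sum>j\<in>(UNIV::'n set). 1)"
        unfolding inner_vec_def inner_real_def by (intro sum_mono)
      then show ?thesis by simp
    qed
  qed
qed

lemma Mz_bounded: "\<exists>R. \<forall>x\<in>F \<times> B1 \<T>. Mz x x \<le> R"
proof -
  obtain R where R: "\<And>u. u \<in> F \<Longrightarrow> ip u u \<le> R" using ipO_bounded_F by blast
  obtain R' where R': "\<And>q. q \<in> B1 \<T> \<Longrightarrow> vip q q \<le> R'" using vipO_bounded_B1 by blast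
  define \<kappa> where "\<kappa> = \<rho> * \<bar>gnorm\<bar>"
  have "Mz x x \<le> (1 / \<tau> + \<kappa>) * R + (\<theta> / \<tau> + \<kappa>) * R'" if x: "x \<in> F \<times> B1 \<T>" for x
  proof -
    have fs: "fst x \<in> F" "snd x \<in> B1 \<T>" using x by auto
    define X Y where "X = sqrt (ip (fst x) (fst x))" and "Y = sqrt (vip (snd x) (snd x))"
    have X2: "X\<^sup>2 = ip (fst x) (fst x)" and Y2: "Y\<^sup>2 = vip (snd x) (snd x)"
      by (simp_all add: X_def Y_def ipO_nonneg vipO_nonneg)
    have "\<rho> * \<bar>D (fst x) (snd x)\<bar> \<le> \<rho> * (\<bar>gnorm\<bar> * X * Y)"
      using D_bound[OF F_V[OF fs(1)] B1_W[OF fs(2)]] \<rho> by (intro mult_left_mono) (auto simp: X_def Y_def)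
    then have "\<rho> * \<bar>D (fst x) (snd x)\<bar> \<le> \<kappa> * (X * Y)" by (simp add: \<kappa>_def mult.assoc)
    moreover have "\<kappa> * (2 * X * Y) \<le> \<kappa> * (X\<^sup>2 + Y\<^sup>2)"
      using sum_squares_bound[of X Y] \<rho> by (intro mult_left_mono) (auto simp: \<kappa>_def)
    moreover have "\<rho> * (- D (fst x) (snd x)) \<le> \<rho> * \<bar>D (fst x) (snd x)\<bar>"
      using \<rho> by (intro mult_left_mono) auto
    moreover have "Mz x x = 1 / \<tau> * X\<^sup>2 - 2 * (\<rho> * D (fst x) (snd x)) + \<theta> / \<tau> * Y\<^sup>2"
      by (simp add: Mz_def X2 Y2)
    ultimately have "Mz x x \<le> (1 / \<tau> + \<kappa>) * X\<^sup>2 + (\<theta> / \<tau> + \<kappa>) * Y\<^sup>2"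
      by (simp add: algebra_simps)
    also have "\<dots> \<le> (1 / \<tau> + \<kappa>) * R + (\<theta> / \<tau> + \<kappa>) * R'"
      using R[OF fs(1)] R'[OF fs(2)] \<tau> \<theta> \<rho> unfolding X2 Y2
      by (intro add_mono mult_left_mono) (auto simp: \<kappa>_def)
    finally show ?thesis .
  qed
  then show ?thesis by blast
qed

lemma \<mu>_Z: "\<mu> n \<in> Z"
  by (simp add: \<mu>_def Z_def fV pW)

text \<open>The primal step uses the old \<open>p\<close>, the dual step the extrapolated
  \<open>f\<close>. Rewriting both at the new iterate gives the skew form, and the two corrections
  are the off-diagonal terms of \<open>Mz\<close>.\<close>

lemma \<mu>_step:
  assumes x: "x \<in> F \<times> B1 \<T>"
  shows "0 \<le> Qz (\<mu> n) (x - \<mu> (Suc n)) + lz (x - \<mu> (Suc n))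
      + Kz (\<mu> (Suc n)) (x - \<mu> (Suc n)) + Mz (\<mu> (Suc n) - \<mu> n) (x - \<mu> (Suc n))"
proof -
  obtain g q where x_eq: "x = (g, q)" and g: "g \<in> F" and q: "q \<in> B1 \<T>" using x by auto
  define f0 f1 p0 p1 where "f0 = f n" and "f1 = f (Suc n)" and "p0 = p n" and "p1 = p (Suc n)"
  have V: "f0 \<in> V" "f1 \<in> V" "g - f1 \<in> V" "f1 - f0 \<in> V"
    and W: "p0 \<in> W" "p1 \<in> W" "q - p1 \<in> W" "p1 - p0 \<in> W"
    using fV pW F_V[OF g] B1_W[OF q] subspace_V1 subspace_V0v
    by (auto simp: f0_def f1_def p0_def p1_def intro: subspace_diff)
  have 1: "0 \<le> Q f0 (g - f1) + l (g - f1) + \<rho> * D (g - f1) p0 + 1 / \<tau> * ip (f1 - f0) (g - f1)"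
    using f_variational[OF g] by (simp add: f0_def f1_def p0_def)
  have 2: "\<rho> * D (2 *\<^sub>R f1 - f0) (q - p1) \<le> \<theta> / \<tau> * vip (p1 - p0) (q - p1)"
    using p_variational[OF q] by (simp add: f0_def f1_def p0_def p1_def)
  \<comment> \<open>The extrapolation supplies precisely the correction that makes the metric
    symmetric: \<open>f1\<close> belongs to \<open>Kz\<close> and the increment to
    \<open>Mz\<close>.\<close>
  have "2 *\<^sub>R f1 - f0 = f1 + (f1 - f0)" by (simp add: scaleR_2)
  then have "D (2 *\<^sub>R f1 - f0) (q - p1) = D f1 (q - p1) + D (f1 - f0) (q - p1)"
    using V W by (simp only: D_simps)
  then have 3: "\<rho> * D (2 *\<^sub>R f1 - f0) (q - p1) = \<rho> * D f1 (q - p1) + \<rho> * D (f1 - f0) (q - p1)"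
    by (simp add: distrib_left)
  have "D (g - f1) (p1 - p0) = D (g - f1) p1 - D (g - f1) p0"
    using V W by (simp only: D_simps)
  then have 4: "\<rho> * D (g - f1) (p1 - p0) = \<rho> * D (g - f1) p1 - \<rho> * D (g - f1) p0"
    by (simp add: right_diff_distrib)
  have \<mu>: "\<mu> n = (f0, p0)" "\<mu> (Suc n) = (f1, p1)"
    by (simp_all add: \<mu>_def f0_def f1_def p0_def p1_def)
  show ?thesis
    using 1 2 3 4 unfolding x_eq \<mu> Qz_def lz_def Kz_def Mz_def diff_Pair fst_conv snd_conv by linarith
qed

lemma forward_backward_Mz:
  assumes "finite_form_space Z Mz \<Lambda>"
  shows "\<exists>R. forward_backward Z Mz \<Lambda> Qz Kz lz (F \<times> B1 \<T>) \<mu> R"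
proof -
  interpret finite_form_space Z Mz \<Lambda> by fact
  obtain R where R: "\<And>x. x \<in> F \<times> B1 \<T> \<Longrightarrow> Mz x x \<le> R" using Mz_bounded by blast
  have "forward_backward Z Mz \<Lambda> Qz Kz lz (F \<times> B1 \<T>) \<mu> R"
  proof
    show "bilinear_on Z Qz" "bilinear_on Z Kz" "linear_on Z lz"
      by (rule bilinear_Qz bilinear_Kz linear_lz)+
    show "Qz x y = Qz y x" for x y by (simp add: Qz_def Q_commute)
    show "0 \<le> Qz x x" for x by (rule Qz_nonneg)
    show "Qz x x \<le> Mz x x" if x: "x \<in> Z" for x
    proof -
      obtain c where c: "0 < c"
        "Qz x x + c * sqn x \<le> Mz x x"
        using Mz_coercive x by metis
      then have "0 \<le> c * sqn x"
        using ipO_nonneg vipO_nonneg by simp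
      then show ?thesis using c(2) by linarith
    qed
    show "Kz x x = 0" for x by (simp add: Kz_def)
    show "F \<times> B1 \<T> \<subseteq> Z" using F_V B1_W by (auto simp: Z_def)
    show "convex (F \<times> B1 \<T>)" by (intro convex_Times convex_F convex_B1)
    show "x \<in> F \<times> B1 \<T> \<Longrightarrow> Mz x x \<le> R" for x by (rule R)
    show "\<mu> 0 \<in> Z" by (rule \<mu>_Z)
    show "\<mu> (Suc n) \<in> F \<times> B1 \<T>" for n by (simp add: \<mu>_def fF p_Suc_B1)
    show "x \<in> F \<times> B1 \<T> \<Longrightarrow> 0 \<le> Qz (\<mu> n) (x - \<mu> (Suc n)) + lz (x - \<mu> (Suc n))
      + Kz (\<mu> (Suc n)) (x - \<mu> (Suc n)) + Mz (\<mu> (Suc n) - \<mu> n) (x - \<mu> (Suc n))" for n x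
      by (rule \<mu>_step)
    fix x a assume x: "\<And>n. x n \<in> F \<times> B1 \<T>" and a: "a \<in> Z" and cv: "conv x a"
    have xZ: "x n \<in> Z" for n using x[of n] F_V B1_W by (auto simp: Z_def)
    \<comment> \<open>Point evaluations are linear on \<open>Z\<close>, so convergence of
      coordinates implies pointwise convergence, and the pointwise constraints survive the
      limit.\<close>
    have lim1: "(\<lambda>n. fst (x n) y) \<longlonglongrightarrow> fst a y" for y
      by (rule conv_linear[OF cv xZ a, where l="\<lambda>w. fst w y"]) (simp add: linear_on_def)
    have lim2: "(\<lambda>n. snd (x n) y $ j) \<longlonglongrightarrow> snd a y $ j" for y j
      by (rule conv_linear[OF cv xZ a, where l="\<lambda>w. snd w y $ j"]) (simp add: linear_on_def)
    have "fst a \<in> F"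
    proof -
      \<comment> \<open>Countably many null sets are merged, so that one exceptional set serves the
        whole sequence.\<close>
      have "AE y in lebesgue. \<forall>n. y \<in> \<Omega> \<longrightarrow> fst (x n) y \<in> {lo..hi}"
        unfolding AE_all_countable using x by (auto simp: F_iff mem_Times_iff)
      then have "AE y in lebesgue. y \<in> \<Omega> \<longrightarrow> fst a y \<in> {lo..hi}"
      proof eventually_elim
        case (elim y)
        show ?case
        proof
          assume "y \<in> \<Omega>"
          then have "fst (x n) y \<in> {lo..hi}" for n using elim by blast
          then show "fst a y \<in> {lo..hi}"
            by (rule Lim_in_closed_set[OF closed_atLeastAtMost always_eventually[OF allI] _ lim1]) simp
        qed
      qed
      then show ?thesis using Z_D(1)[OF a] by (simp add: F_iff)
    qed
    moreover have "\<bar>snd a y $ j\<bar> \<le> 1" for y j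
    proof (rule LIMSEQ_le_const2[OF tendsto_rabs[OF lim2]])
      have "\<bar>snd (x n) y $ j\<bar> \<le> 1" for n using x[of n] by (simp add: B1_def mem_Times_iff)
      then show "\<exists>N. \<forall>n\<ge>N. \<bar>snd (x n) y $ j\<bar> \<le> 1" by simp
    qed
    then have "snd a \<in> B1 \<T>" using Z_D(2)[OF a] by (simp add: B1_def)
    ultimately show "a \<in> F \<times> B1 \<T>" by (simp add: mem_Times_iff)
  qed
  then show ?thesis by blast
qed

lemma norms_le_Mz:
  obtains c where "0 < c"
    "\<And>x. x \<in> Z \<Longrightarrow> (nrm (fst x))\<^sup>2 + (vnrm (snd x))\<^sup>2 \<le> c * Mz x x"
proof -
  obtain c where c: "0 < c"
    "\<And>x. x \<in> Z \<Longrightarrow> Qz x x + c * sqn x \<le> Mz x x"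
    using Mz_coercive by metis
  show ?thesis
  proof (rule that[of "1 / c"])
    fix x assume "x \<in> Z"
    then have "c * sqn x \<le> Mz x x"
      using c(2)[of x] Qz_nonneg[of x] by linarith
    then show "(nrm (fst x))\<^sup>2 + (vnrm (snd x))\<^sup>2 \<le> 1 / c * Mz x x"
      using c(1) by (simp add: nrmO_power2 vnrmO_power2 field_simps)
  qed (use c(1) in simp)
qed

section \<open>Saddle points, minimisers and convergence\<close>

definition saddle_point :: "(real^'n \<Rightarrow> real) \<Rightarrow> (real^'n \<Rightarrow> real^'n) \<Rightarrow> bool" where
  "saddle_point fs ps \<longleftrightarrow> fs \<in> F \<and> ps \<in> B1 \<T> \<and> (\<forall>g\<in>F. \<forall>q\<in>B1 \<T>.
     0 \<le> Q fs (g - fs) + l (g - fs) + \<rho> * D (g - fs) ps - \<rho> * D fs (q - ps))"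

lemma saddle_pointD:
  assumes "saddle_point fs ps"
  shows "fs \<in> F" "ps \<in> B1 \<T>" "g \<in> F \<Longrightarrow> q \<in> B1 \<T> \<Longrightarrow>
     0 \<le> Q fs (g - fs) + l (g - fs) + \<rho> * D (g - fs) ps - \<rho> * D fs (q - ps)"
  using assms unfolding saddle_point_def by blast+

text \<open>Testing with \<open>g = fs\<close> isolates the dual part, so \<open>ps\<close> is at
  least as good as the field that attains the total variation; no member of \<open>B1\<close> is
  better.\<close>

lemma saddle_point_TV:
  assumes "saddle_point fs ps" shows "D fs ps = TV \<Omega> fs"
proof -
  note fs = saddle_pointD(1)[OF assms] and ps = saddle_pointD(2)[OF assms]
  note V = F_V[OF fs] and W = B1_W[OF ps]
  obtain q where q: "q \<in> B1 \<T>" "D fs q = TV \<Omega> fs" using TV_attained[OF V] by (auto simp: D_def)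
  have "0 \<le> Q fs 0 + l 0 + \<rho> * D 0 ps - \<rho> * D fs (q - ps)"
    using saddle_pointD(3)[OF assms fs q(1)] by simp
  moreover have "Q fs 0 = 0" by (rule linear_on_zero[OF bilinear_on_right[OF Q_bilinear V] subspace_V1])
  moreover have "l 0 = 0" by (rule linear_on_zero[OF l_linear subspace_V1])
  moreover have "D 0 ps = 0" by (rule linear_on_zero[OF D_left_linear[OF W] subspace_V1])
  moreover have "D fs (q - ps) = D fs q - D fs ps" by (rule D_simps(5)[OF V B1_W[OF q(1)] W])
  ultimately have "\<rho> * (D fs q - D fs ps) \<le> 0" by simp
  then have "TV \<Omega> fs \<le> D fs ps" using \<rho> q(2) by (simp add: mult_le_0_iff)
  moreover have "D fs ps \<le> TV \<Omega> fs" unfolding D_def by (rule vipO_le_TV[OF V ps])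
  ultimately show ?thesis by simp
qed

text \<open>Testing with \<open>q = ps\<close> isolates the primal part. \<open>D g ps\<close>
  bounds the total variation of \<open>g\<close> from below with equality at \<open>fs\<close>, so
  \<open>ps\<close> serves as a subgradient; convexity of \<open>Q\<close> does the rest.\<close>

lemma saddle_point_minimizes:
  assumes sp: "saddle_point fs ps" and g: "g \<in> F"
  shows "tcost fs \<le> tcost g"
proof -
  note fs = saddle_pointD(1)[OF sp] and ps = saddle_pointD(2)[OF sp]
  note V = F_V[OF fs] F_V[OF g] and W = B1_W[OF ps]
  have gV: "g - fs \<in> V" using V subspace_V1 by (simp add: subspace_diff)
  have "0 \<le> Q fs (g - fs) + l (g - fs) + \<rho> * D (g - fs) ps - \<rho> * D fs (ps - ps)"
    by (rule saddle_pointD(3)[OF sp g ps])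
  moreover have "D fs (ps - ps) = 0" unfolding D_simps(5)[OF V(1) W W] by simp
  moreover have "D (g - fs) ps = D g ps - D fs ps" using D_simps(2)[OF V(2) W V(1)] .
  moreover have "l (g - fs) = l g - l fs" using linear_on_diff[OF l_linear subspace_V1 V(2,1)] .
  moreover have "Q fs (g - fs) = Q g g / 2 - Q fs fs / 2 - Q (g - fs) (g - fs) / 2"
    using V gV Q_commute[of g fs] by (simp add: bilinear_on_simps[OF Q_bilinear subspace_V1] field_simps)
  moreover have "0 \<le> Q (g - fs) (g - fs)" by (simp add: Q_def b_nonneg)
  moreover have "\<rho> * D g ps \<le> \<rho> * TV \<Omega> g"
    using vipO_le_TV[OF V(2) ps] \<rho> by (intro mult_left_mono) (auto simp: D_def)
  moreover have "\<rho> * D fs ps = \<rho> * TV \<Omega> fs" using saddle_point_TV[OF sp] by simp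
  ultimately show ?thesis
    unfolding cost_eq[OF V(1)] cost_eq[OF V(2)] by (simp add: right_diff_distrib)
qed

lemma convergence:
  "\<exists>r fs ps. strict_mono r \<and> saddle_point fs ps \<and>
     (\<lambda>k. nrm (f (r k) - fs)) \<longlonglongrightarrow> 0 \<and> (\<lambda>k. vnrm (p (r k) - ps)) \<longlonglongrightarrow> 0"
  and rate: "(\<lambda>n. (nrm (f (Suc n) - f n))\<^sup>2 + (vnrm (p (Suc n) - p n))\<^sup>2) \<in> O(\<lambda>n. 1 / real n)"
proof -
  obtain \<Lambda> where FS: "finite_form_space Z Mz \<Lambda>" using finite_form_space_Mz by blast
  obtain R where "forward_backward Z Mz \<Lambda> Qz Kz lz (F \<times> B1 \<T>) \<mu> R"
    using forward_backward_Mz[OF FS] by blast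
  then interpret FB: forward_backward Z Mz \<Lambda> Qz Kz lz "F \<times> B1 \<T>" \<mu> R .
  obtain c where c: "0 < c"
    "\<And>x. x \<in> Z \<Longrightarrow> (nrm (fst x))\<^sup>2 + (vnrm (snd x))\<^sup>2 \<le> c * Mz x x"
    using norms_le_Mz by metis
  obtain s r where s: "FB.solution s" and r: "strict_mono r" and cv: "FB.conv (\<mu> \<circ> r) s"
    using FB.cluster_point_solution by blast
  obtain fs ps where s_eq: "s = (fs, ps)" by (cases s)
  have sp: "saddle_point fs ps"
    unfolding saddle_point_def
  proof (intro conjI ballI)
    show "fs \<in> F" "ps \<in> B1 \<T>" using s by (auto simp: FB.solution_def s_eq)
    fix g q assume "g \<in> F" "q \<in> B1 \<T>"
    then have "(g, q) \<in> F \<times> B1 \<T>" by simp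
    then have "0 \<le> Qz s ((g, q) - s) + lz ((g, q) - s) + Kz s ((g, q) - s)"
      using s unfolding FB.solution_def by blast
    then show "0 \<le> Q fs (g - fs) + l (g - fs) + \<rho> * D (g - fs) ps - \<rho> * D fs (q - ps)"
      by (simp add: s_eq Qz_def lz_def Kz_def)
  qed
  have sZ: "s \<in> Z" using s FB.CV by (simp add: FB.solution_def)
  have lim: "(\<lambda>k. c * Mz (\<mu> (r k) - s) (\<mu> (r k) - s)) \<longlonglongrightarrow> c * 0"
    using FB.conv_norm[OF cv _ sZ] \<mu>_Z by (intro tendsto_mult_left) (simp add: comp_def)
  have bnd: "(nrm (f (r k) - fs))\<^sup>2 + (vnrm (p (r k) - ps))\<^sup>2 \<le> c * Mz (\<mu> (r k) - s) (\<mu> (r k) - s)" for k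
    using c(2)[OF FB.VD[OF \<mu>_Z sZ], of "r k"] by (simp add: \<mu>_def s_eq)
  have "(\<lambda>k. (nrm (f (r k) - fs))\<^sup>2) \<longlonglongrightarrow> 0"
    by (rule tendsto_sandwich[OF _ _ tendsto_const lim[simplified]])
      (auto intro!: always_eventually order_trans[OF _ bnd])
  then have l1: "(\<lambda>k. nrm (f (r k) - fs)) \<longlonglongrightarrow> 0" by (simp add: power_tendsto_0_iff)
  have "(\<lambda>k. (vnrm (p (r k) - ps))\<^sup>2) \<longlonglongrightarrow> 0"
    by (rule tendsto_sandwich[OF _ _ tendsto_const lim[simplified]])
      (auto intro!: always_eventually order_trans[OF _ bnd])
  then have l2: "(\<lambda>k. vnrm (p (r k) - ps)) \<longlonglongrightarrow> 0" by (simp add: power_tendsto_0_iff)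
  show "\<exists>r fs ps. strict_mono r \<and> saddle_point fs ps \<and>
     (\<lambda>k. nrm (f (r k) - fs)) \<longlonglongrightarrow> 0 \<and> (\<lambda>k. vnrm (p (r k) - ps)) \<longlonglongrightarrow> 0"
    using r sp l1 l2 by blast
  obtain B where B: "\<And>n. real (Suc n) * Mz (\<mu> (Suc n) - \<mu> n) (\<mu> (Suc n) - \<mu> n) \<le> B"
    using FB.rate by blast
  show "(\<lambda>n. (nrm (f (Suc n) - f n))\<^sup>2 + (vnrm (p (Suc n) - p n))\<^sup>2) \<in> O(\<lambda>n. 1 / real n)"
  proof (rule bigoI[where c="c * B"])
    show "\<forall>\<^sub>F n in sequentially. norm ((nrm (f (Suc n) - f n))\<^sup>2 + (vnrm (p (Suc n) - p n))\<^sup>2)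
        \<le> c * B * norm (1 / real n)"
      \<comment> \<open>The index 0 is excluded because there \<open>1 / real n\<close> is 0 and the
        bound would demand a zero increment.\<close>
      using eventually_gt_at_top[of 0]
    proof eventually_elim
      case (elim n)
      define m where "m = Mz (\<mu> (Suc n) - \<mu> n) (\<mu> (Suc n) - \<mu> n)"
      have mem: "\<mu> (Suc n) - \<mu> n \<in> Z" by (rule FB.VD[OF \<mu>_Z \<mu>_Z])
      have m0: "0 \<le> m" unfolding m_def by (rule FB.nonneg[OF mem])
      have "real n * m \<le> real (Suc n) * m" using m0 by (intro mult_right_mono) auto
      then have "m \<le> B / real n" using B[of n] elim by (simp add: m_def field_simps)
      then have "c * m \<le> c * (B / real n)" using c(1) by (intro mult_left_mono) auto
      then show ?case using c(2)[OF mem] by (simp add: \<mu>_def m_def)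
    qed
  qed
qed

end

theorem theorem4p9:
  fixes \<Omega> \<Gamma> :: "(real^'n) set" and \<T> :: "(real^'n) set set"
    and \<alpha> :: "real^'n \<Rightarrow> real^'n^'n" and \<beta> \<sigma> z :: "real^'n \<Rightarrow> real"
    and J :: "(real^'n \<Rightarrow> real) \<Rightarrow> real"
    and \<alpha>low lo hi c1 c\<gamma> h \<rho> \<tau> \<theta> :: real
    and f :: "nat \<Rightarrow> real^'n \<Rightarrow> real" and p :: "nat \<Rightarrow> real^'n \<Rightarrow> real^'n"
  assumes dim: "CARD('n) \<ge> 2"
    and dom: "open \<Omega>" "bounded \<Omega>" "connected \<Omega>" "\<Omega> \<noteq> {}" "\<Omega> = interior (closure \<Omega>)"
    and mesh: "is_mesh \<Omega> \<T> h" and h: "0 < h" "h < 1"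
    and Gam: "openin (top_of_set (frontier \<Omega>)) \<Gamma>"
    and alpha_meas: "\<forall>i j. set_borel_measurable lebesgue \<Omega> (\<lambda>x. \<alpha> x $ i $ j)"
    and alpha_bdd: "\<exists>M. AE x in lebesgue. x \<in> \<Omega> \<longrightarrow> (\<forall>i j. \<bar>\<alpha> x $ i $ j\<bar> \<le> M)"
    and alpha_sym: "AE x in lebesgue. x \<in> \<Omega> \<longrightarrow> (\<forall>i j. \<alpha> x $ i $ j = \<alpha> x $ j $ i)"
    and alpha_ell: "\<alpha>low > 0" "AE x in lebesgue. x \<in> \<Omega> \<longrightarrow> (\<forall>\<xi>. \<alpha>low * (norm \<xi>)\<^sup>2 \<le> (\<alpha> x *v \<xi>) \<bullet> \<xi>)"
    and beta: "set_borel_measurable lebesgue \<Omega> \<beta>"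
      "\<exists>M. AE x in lebesgue. x \<in> \<Omega> \<longrightarrow> \<bar>\<beta> x\<bar> \<le> M"
      "AE x in lebesgue. x \<in> \<Omega> \<longrightarrow> 0 \<le> \<beta> x"
    and sigma: "set_borel_measurable (bmeas \<Omega> \<T>) (frontier \<Omega>) \<sigma>"
      "\<exists>M. AE x in bmeas \<Omega> \<T>. x \<in> frontier \<Omega> \<longrightarrow> \<bar>\<sigma> x\<bar> \<le> M"
      "AE x in bmeas \<Omega> \<T>. x \<in> frontier \<Omega> \<longrightarrow> 0 \<le> \<sigma> x"
    and pos: "(\<exists>\<beta>0>0. AE x in lebesgue. x \<in> \<Omega> \<longrightarrow> \<beta>0 \<le> \<beta> x)
            \<or> (\<exists>\<sigma>0>0. AE x in bmeas \<Omega> \<T>. x \<in> frontier \<Omega> \<longrightarrow> \<sigma>0 \<le> \<sigma> x)"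
    and J_lin: "\<forall>v\<in>V1 \<Omega> \<T>. \<forall>w\<in>V1 \<Omega> \<T>. \<forall>a b. J (\<lambda>x. a * v x + b * w x) = a * J v + b * J w"
    and J_trace: "\<forall>v\<in>V1 \<Omega> \<T>. \<forall>w\<in>V1 \<Omega> \<T>. (\<forall>x\<in>frontier \<Omega>. v x = w x) \<longrightarrow> J v = J w"
    and bounds: "lo \<le> hi"
    and c1: "c1 > 0" "\<forall>u g. L2O \<Omega> u \<and> weak_grad \<Omega> u g \<and> continuous_on (closure \<Omega>) u \<longrightarrow>
               c1 * H1norm2 \<Omega> u g \<le> aform \<Omega> \<T> \<alpha> \<beta> \<sigma> u g u g"
    and cgam: "c\<gamma> > 0" "\<forall>u g. L2O \<Omega> u \<and> weak_grad \<Omega> u g \<and> continuous_on (closure \<Omega>) u \<longrightarrow>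
               sqrt (LINT x:frontier \<Omega>|bmeas \<Omega> \<T>. (u x)\<^sup>2) \<le> c\<gamma> * sqrt (H1norm2 \<Omega> u g)"
    and rho: "\<rho> > 0"
    and z: "set_borel_measurable (bmeas \<Omega> \<T>) \<Gamma> z" "set_integrable (bmeas \<Omega> \<T>) \<Gamma> (\<lambda>x. (z x)\<^sup>2)"
    and step: "\<tau> > 0" "\<theta> > 0"
      "(1/\<tau> - c\<gamma>\<^sup>2 / c1\<^sup>2) * (\<theta> / \<tau>) > \<rho>\<^sup>2 * (gradnorm \<Omega> \<T>)\<^sup>2"
    and init: "f 0 \<in> Fadh \<Omega> \<T> lo hi" "p 0 \<in> V0v \<T>"
    and f_step: "\<forall>n. f (Suc n) \<in> Fadh \<Omega> \<T> lo hi \<and>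
       (\<forall>g\<in>Fadh \<Omega> \<T> lo hi.
          ipO \<Omega> (f (Suc n)) (uha \<Omega> \<T> \<Gamma> \<alpha> \<beta> \<sigma> J z (f n)) + \<rho> * vipO \<Omega> (grad (f (Suc n))) (p n)
            + 1 / (2 * \<tau>) * (nrmO \<Omega> (\<lambda>x. f (Suc n) x - f n x))\<^sup>2
          \<le> ipO \<Omega> g (uha \<Omega> \<T> \<Gamma> \<alpha> \<beta> \<sigma> J z (f n)) + \<rho> * vipO \<Omega> (grad g) (p n)
            + 1 / (2 * \<tau>) * (nrmO \<Omega> (\<lambda>x. g x - f n x))\<^sup>2)"
    and p_step: "\<forall>n. p (Suc n) \<in> V0v \<T> \<and>
       (\<forall>q\<in>V0v \<T>.
          ereal (\<rho> * vipO \<Omega> (grad (\<lambda>x. 2 * f (Suc n) x - f n x)) q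
                 - \<theta> / (2 * \<tau>) * (vnrmO \<Omega> (\<lambda>x. q x - p n x))\<^sup>2) - indB1 \<T> q
          \<le> ereal (\<rho> * vipO \<Omega> (grad (\<lambda>x. 2 * f (Suc n) x - f n x)) (p (Suc n))
                 - \<theta> / (2 * \<tau>) * (vnrmO \<Omega> (\<lambda>x. p (Suc n) x - p n x))\<^sup>2) - indB1 \<T> (p (Suc n)))"
  shows "(\<exists>r fs ps. strict_mono r \<and> fs \<in> Fadh \<Omega> \<T> lo hi \<and> ps \<in> B1 \<T> \<and>
            vipO \<Omega> (grad fs) ps = TV \<Omega> fs \<and>
            (\<lambda>k. nrmO \<Omega> (\<lambda>x. f (r k) x - fs x)) \<longlonglongrightarrow> 0 \<and>
            (\<lambda>k. vnrmO \<Omega> (\<lambda>x. p (r k) x - ps x)) \<longlonglongrightarrow> 0 \<and>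
            (\<forall>g\<in>Fadh \<Omega> \<T> lo hi. \<forall>q\<in>B1 \<T>.
               ipO \<Omega> (\<lambda>x. g x - fs x) (uha \<Omega> \<T> \<Gamma> \<alpha> \<beta> \<sigma> J z fs)
               + \<rho> * vipO \<Omega> (grad (\<lambda>x. g x - fs x)) ps
               - \<rho> * vipO \<Omega> (grad fs) (\<lambda>x. q x - ps x) \<ge> 0) \<and>
            (\<forall>g\<in>Fadh \<Omega> \<T> lo hi. cost \<Omega> \<T> \<Gamma> \<alpha> \<beta> \<sigma> J z \<rho> fs \<le> cost \<Omega> \<T> \<Gamma> \<alpha> \<beta> \<sigma> J z \<rho> g))
         \<and> (\<lambda>n. (nrmO \<Omega> (\<lambda>x. f (Suc n) x - f n x))\<^sup>2 + (vnrmO \<Omega> (\<lambda>x. p (Suc n) x - p n x))\<^sup>2)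
             \<in> O(\<lambda>n. 1 / real n)"
proof -
  note mesh_props = mesh[unfolded is_mesh_def]
  interpret pd: primal_dual \<Omega> \<Gamma> \<T> \<alpha> \<beta> \<sigma> z J c1 c\<gamma> lo hi \<rho> \<tau> \<theta> f p
  proof
    show "open \<Omega>" "bounded \<Omega>" "\<Omega> = interior (closure \<Omega>)" by (fact dom)+
    show "triangulation \<T>" "\<Union>\<T> = closure \<Omega>" using mesh_props by simp_all
    show "int CARD('n) simplex T" if "T \<in> \<T>" for T using mesh_props that by blast
    show "openin (top_of_set (frontier \<Omega>)) \<Gamma>" by (fact Gam)
    obtain M where M: "AE x in lebesgue. x \<in> \<Omega> \<longrightarrow> (\<forall>i j. \<bar>\<alpha> x $ i $ j\<bar> \<le> M)"
      using alpha_bdd by blast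
    show "ess_bounded lebesgue \<Omega> (\<lambda>x. \<alpha> x $ i $ j)" for i j
    proof -
      have "AE x in lebesgue. x \<in> \<Omega> \<longrightarrow> \<bar>\<alpha> x $ i $ j\<bar> \<le> M" using M by eventually_elim blast
      then show ?thesis using alpha_meas unfolding ess_bounded_def by blast
    qed
    show "AE x in lebesgue. x \<in> \<Omega> \<longrightarrow> (\<forall>i j. \<alpha> x $ i $ j = \<alpha> x $ j $ i)" by (fact alpha_sym)
    show "ess_bounded lebesgue \<Omega> \<beta>" unfolding ess_bounded_def using beta(1,2) by blast
    show "ess_bounded (bmeas \<Omega> \<T>) (frontier \<Omega>) \<sigma>" unfolding ess_bounded_def using sigma(1,2) by blast
    show "linear_on (V1 \<Omega> \<T>) J"
    proof (rule linear_onI)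
      fix v w assume "v \<in> V1 \<Omega> \<T>" "w \<in> V1 \<Omega> \<T>"
      then have "J (\<lambda>x. 1 * v x + 1 * w x) = 1 * J v + 1 * J w" using J_lin by blast
      then show "J (v + w) = J v + J w" by (simp add: plus_fun_def)
    next
      fix c v assume "v \<in> V1 \<Omega> \<T>"
      then have "J (\<lambda>x. c * v x + 0 * v x) = c * J v + 0 * J v" using J_lin by blast
      then show "J (c *\<^sub>R v) = c * J v" by (simp add: scaleR_fun_def)
    qed
    show "0 < c1" "0 < c\<gamma>" by (fact c1 cgam)+
    show "c1 * H1norm2 \<Omega> u g \<le> aform \<Omega> \<T> \<alpha> \<beta> \<sigma> u g u g"
      if "L2O \<Omega> u" "weak_grad \<Omega> u g" "continuous_on (closure \<Omega>) u" for u g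
      using c1(2) that by blast
    show "sqrt (LINT x:frontier \<Omega>|bmeas \<Omega> \<T>. (u x)\<^sup>2) \<le> c\<gamma> * sqrt (H1norm2 \<Omega> u g)"
      if "L2O \<Omega> u" "weak_grad \<Omega> u g" "continuous_on (closure \<Omega>) u" for u g
      using cgam(2) that by blast
  qed (use z rho step init f_step p_step in \<open>blast+\<close>)
  obtain r fs ps where r: "strict_mono r" and sp: "pd.saddle_point fs ps"
    and lim: "(\<lambda>k. nrmO \<Omega> (f (r k) - fs)) \<longlonglongrightarrow> 0" "(\<lambda>k. vnrmO \<Omega> (p (r k) - ps)) \<longlonglongrightarrow> 0"
    using pd.convergence by blast
  note fs = pd.saddle_pointD(1)[OF sp] and ps = pd.saddle_pointD(2)[OF sp]
  note V = pd.F_V[OF fs] and W = pd.B1_W[OF ps]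
  \<comment> \<open>The inequality was derived with \<open>pgrad\<close> and the form
    \<open>Q + l\<close>; the adjoint identity and a.e. equality of the gradients restore the
    original terms.\<close>
  have vi: "ipO \<Omega> (g - fs) (uha \<Omega> \<T> \<Gamma> \<alpha> \<beta> \<sigma> J z fs) + \<rho> * vipO \<Omega> (grad (g - fs)) ps
      - \<rho> * vipO \<Omega> (grad fs) (q - ps) \<ge> 0"
    if g: "g \<in> Fadh \<Omega> \<T> lo hi" and q: "q \<in> B1 \<T>" for g q
  proof -
    have mem: "g - fs \<in> V1 \<Omega> \<T>" "q - ps \<in> V0v \<T>"
      using V W pd.F_V[OF g] pd.B1_W[OF q] by (auto intro: subspace_diff pd.subspace_V1 pd.subspace_V0v)
    show ?thesis
      using pd.saddle_pointD(3)[OF sp g q]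
      unfolding pd.ipO_uha(2)[OF V mem(1)] pd.vipO_grad[OF mem(1) W] pd.vipO_grad[OF V mem(2)]
      by (simp only: pd.D_def)
  qed
  have tv: "vipO \<Omega> (grad fs) ps = TV \<Omega> fs"
    using pd.saddle_point_TV[OF sp] unfolding pd.vipO_grad[OF V W] by (simp only: pd.D_def)
  show ?thesis
    using r fs ps tv lim[unfolded fun_diff_def] vi[unfolded fun_diff_def]
      pd.saddle_point_minimizes[OF sp] pd.rate[unfolded fun_diff_def] by blast
qed

end
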